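(* Let $\kappa>0$ be a limit ordinal. The projection functor $\mathrm{ConfMnd}_{\mathrm p}^{\kappa}\to\mathbf{Cat}$, $(\mathcal E,\mathcal M,\mathsf T)\mapsto\mathcal E$, lifts (through the projection $\mathbf{Mnd}_s\to\mathbf{Cat}$, $(\mathcal E,\mathsf M)\mapsto\mathcal E$) to a functor $\mathrm{ConfMnd}_{\mathrm p}^{\kappa}\to\mathbf{Mnd}_s$ sending $(\mathcal E,\mathcal M,\mathsf T)$ to the free and algebraically free monad on $\mathsf T$.
   Context: **Ordinals.** An ordinal is a transitive set of transitive sets; $\alpha<\beta$ means $\alpha\in\beta$ and $\alpha\preceq\beta$ means $\alpha<\beta$ or $\alpha=\beta$. $\alpha$ is a limit ordinal if for every family $(\beta_i<\alpha)_{i\in I}$ with $I$ finite inhabited there is $\beta<\alpha$ with all $\beta_i<\beta$. An $\alpha$-chain is a diagram indexed by the poset $(\alpha,\preceq)$. **Strong morphisms.** A pointed endofunctor $\mathsf T=(T,\tau)$ on $\mathcal E$ is an endofunctor $T$ with $\tau:\mathrm{Id}\to T$; $\mathsf T\text{-}\mathrm{Alg}$ has objects $(A,a:TA\to A)$ with $a\tau_A=\mathrm{id}$. $\mathbf{PtdEndo}_s$: objects $(\mathcal E,\mathsf T)$; morphisms $(\mathcal E_1,(T_1,\tau_1))\to(\mathcal E_2,(T_2,\tau_2))$ are pairs of a functor $F:\mathcal E_1\to\mathcal E_2$ and a natural isomorphism $\gamma:FT_1\cong T_2F$ with $\gamma\circ F\tau_1=\tau_2F$. $\mathbf{Mnd}_s$: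 objects are pairs $(\mathcal E,\mathsf M)$ of a category and a monad on it; morphisms $(\mathcal E_1,(M_1,\eta_1,\mu_1))\to(\mathcal E_2,(M_2,\eta_2,\mu_2))$ are morphisms $(F,\gamma)$ of the underlying pointed endofunctors in $\mathbf{PtdEndo}_s$ with $\gamma\circ F\mu_1=\mu_2F\circ M_2\gamma\circ\gamma M_1$. **Free monads.** For a monad $\mathsf M=(M,\eta,\mu)$ let $\mathsf M_{\mathrm p}=(M,\eta)$. A monad $\mathsf M$ on $\mathcal E$ with a morphism of pointed endofunctors $\gamma:\mathsf T\to\mathsf M_{\mathrm p}$ is the *free monad on $\mathsf T$* if every morphism of pointed endofunctors $\mathsf T\to\mathsf M'_{\mathrm p}$ into a monad $\mathsf M'$ on $\mathcal E$ factors as $\gamma$ followed by a unique morphism of monads $\mathsf M\to\mathsf M'$ on $\mathcal E$, and the *algebraically free monad on $\mathsf T$* if the functor $\mathsf M\text{-}\mathrm{Alg}\to\mathsf T\text{-}\mathrm{Alg}$ induced by $\gamma$ is an isomorphism of categories. **Backdrops.** A wide subcategory $\mathcal M\hookrightarrow\mathcal E$ *has $\mathcal K$-indexed colimits in $\mathcal E$* if the category $\mathcal M$ has them and the inclusion preserves them; it is *closed under cobase change in $\mathcal E$* if for all $A\to B$ in $\mathcal M$ and $A\to X$ in $\mathcal E$ there is a pushout square in $\mathcal E$ whose map $X\to Y$ opposite $A\to B$ is in $\mathcal M$. $\mathcal M$ is a *$\kappa$-backdrop* if (a) $\mathcal M$ has colimits of $(1+\alpha)$-chains in $\mathcal E$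 for $\alpha<\kappa$; (b) $\kappa$-chains in $\mathcal M$ have colimits in $\mathcal E$; (c) $\mathcal M$ is closed under cobase change in $\mathcal E$. A functor $F:\mathcal E_1\to\mathcal E_2$ is *$\kappa$-backdrop-preserving* $(\mathcal E_1,\mathcal M_1)\to(\mathcal E_2,\mathcal M_2)$ if it sends $\mathcal M_1$ into $\mathcal M_2$ and preserves colimits of $(1+\alpha)$-chains in $\mathcal M_1$ for $\alpha<\kappa$, colimits of $\kappa$-chains in $\mathcal M_1$, and cobase changes of maps in $\mathcal M_1$. **The category $\mathrm{ConfMnd}_{\mathrm p}^{\kappa}$.** Objects are triples $(\mathcal E,\mathcal M,\mathsf T)$ of a category, a wide subcategory $\mathcal M\hookrightarrow\mathcal E$, and a pointed endofunctor $\mathsf T=(T,\tau)$ on $\mathcal E$ such that (a) $\mathcal M$ is a $\kappa$-backdrop in $\mathcal E$; (b) every $\tau_A$ is in $\mathcal M$; (c) for every $f:A\to B$ in $\mathcal M$ the pushout gap map $B\sqcup_ATA\to TB$ (induced by $\tau_B$ and $Tf$, pushout of $f$ and $\tau_A$) is in $\mathcal M$; (d) $T$ preserves colimits of $\kappa$-chains in $\mathcal M$. Morphisms $(\mathcal E_1,\mathcal M_1,\mathsf T_1)\to(\mathcal E_2,\mathcal M_2,\mathsf T_2)$ are morphisms $(F,\gamma):(\mathcal E_1,\mathsf T_1)\to(\mathcal E_2,\mathsf T_2)$ in $\mathbf{PtdEndo}_s$ such that $F$ is $\kappa$-backdrop-preserving $(\mathcal E_1,\mathcal M_1)\to(\mathcal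 E_2,\mathcal M_2)$. *)

theory Defs
  imports Main "HOL-Library.FuncSet"
begin

section \<open>Categories, functors, natural transformations\<close>

record ('o, 'a) cat =
  Obj :: "'o set"
  Arr :: "'a set"
  Dom :: "'a \<Rightarrow> 'o"
  Cod :: "'a \<Rightarrow> 'o"
  Idn :: "'o \<Rightarrow> 'a"
  Cmp :: "'a \<Rightarrow> 'a \<Rightarrow> 'a"  (infixl "\<cdot>\<index>" 70)

definition hom :: "('o, 'a) cat \<Rightarrow> 'o \<Rightarrow> 'o \<Rightarrow> 'a set" where
  "hom C A B = {f \<in> Arr C. Dom C f = A \<and> Cod C f = B}"

locale category =
  fixes C :: "('o, 'a) cat" (structure)
  assumes Dom_Obj: "f \<in> Arr C \<Longrightarrow> Dom C f \<in> Obj C"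
    and Cod_Obj: "f \<in> Arr C \<Longrightarrow> Cod C f \<in> Obj C"
    and Idn_hom: "A \<in> Obj C \<Longrightarrow> Idn C A \<in> hom C A A"
    and Cmp_hom: "\<lbrakk>f \<in> hom C A B; g \<in> hom C B D\<rbrakk> \<Longrightarrow> g \<cdot> f \<in> hom C A D"
    and Cmp_Idn: "f \<in> hom C A B \<Longrightarrow> f \<cdot> Idn C A = f"
    and Idn_Cmp: "f \<in> hom C A B \<Longrightarrow> Idn C B \<cdot> f = f"
    and Cmp_assoc: "\<lbrakk>f \<in> hom C A B; g \<in> hom C B D; h \<in> hom C D E\<rbrakk>
        \<Longrightarrow> (h \<cdot> g) \<cdot> f = h \<cdot> (g \<cdot> f)"

definition is_iso :: "('o, 'a) cat \<Rightarrow> 'a \<Rightarrow> bool" where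
  "is_iso C f \<longleftrightarrow> f \<in> Arr C \<and>
     (\<exists>g \<in> hom C (Cod C f) (Dom C f).
        g \<cdot>\<^bsub>C\<^esub> f = Idn C (Dom C f) \<and> f \<cdot>\<^bsub>C\<^esub> g = Idn C (Cod C f))"

record ('o, 'a, 'p, 'b) funct =
  omap :: "'o \<Rightarrow> 'p"
  amap :: "'a \<Rightarrow> 'b"

text \<open>The maps of a functor, and the components of a natural transformation, are
  extensional (undefined off the objects and arrows of the source category). Hence HOL
  equality of functors and of natural transformations is their mathematical equality.\<close>

definition cat_functor ::
  "('o, 'a) cat \<Rightarrow> ('p, 'b) cat \<Rightarrow> ('o, 'a, 'p, 'b) funct \<Rightarrow> bool" where
  "cat_functor C D F \<longleftrightarrow> category C \<and> category D \<and>
     omap F \<in> Obj C \<rightarrow>\<^sub>E Obj D \<and>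
     amap F \<in> Arr C \<rightarrow>\<^sub>E Arr D \<and>
     (\<forall>f \<in> Arr C. amap F f \<in> hom D (omap F (Dom C f)) (omap F (Cod C f))) \<and>
     (\<forall>A \<in> Obj C. amap F (Idn C A) = Idn D (omap F A)) \<and>
     (\<forall>f \<in> Arr C. \<forall>g \<in> Arr C. Dom C g = Cod C f \<longrightarrow>
        amap F (g \<cdot>\<^bsub>C\<^esub> f) = amap F g \<cdot>\<^bsub>D\<^esub> amap F f)"

definition id_functor :: "('o, 'a) cat \<Rightarrow> ('o, 'a, 'o, 'a) funct" where
  "id_functor C = \<lparr>omap = (\<lambda>A \<in> Obj C. A), amap = (\<lambda>f \<in> Arr C. f)\<rparr>"

text \<open>\<open>comp_functor C G F\<close> is the composite of \<open>F\<close> (with source category \<open>C\<close>)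
  followed by \<open>G\<close>.\<close>

definition comp_functor ::
  "('o, 'a) cat \<Rightarrow> ('p, 'b, 'q, 'c) funct \<Rightarrow> ('o, 'a, 'p, 'b) funct \<Rightarrow> ('o, 'a, 'q, 'c) funct" where
  "comp_functor C G F =
     \<lparr>omap = (\<lambda>A \<in> Obj C. omap G (omap F A)), amap = (\<lambda>f \<in> Arr C. amap G (amap F f))\<rparr>"

definition is_cat_iso ::
  "('o, 'a) cat \<Rightarrow> ('p, 'b) cat \<Rightarrow> ('o, 'a, 'p, 'b) funct \<Rightarrow> bool" where
  "is_cat_iso C D F \<longleftrightarrow> cat_functor C D F \<and>
     (\<exists>G. cat_functor D C G \<and>
        comp_functor C G F = id_functor C \<and> comp_functor D F G = id_functor D)"

definition nat_trans ::
  "('o, 'a) cat \<Rightarrow> ('p, 'b) cat \<Rightarrow> ('o, 'a, 'p, 'b) funct \<Rightarrow> ('o, 'a, 'p, 'b) funct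
     \<Rightarrow> ('o \<Rightarrow> 'b) \<Rightarrow> bool" where
  "nat_trans C D F G \<alpha> \<longleftrightarrow> cat_functor C D F \<and> cat_functor C D G \<and>
     \<alpha> \<in> extensional (Obj C) \<and>
     (\<forall>A \<in> Obj C. \<alpha> A \<in> hom D (omap F A) (omap G A)) \<and>
     (\<forall>f \<in> Arr C. \<alpha> (Cod C f) \<cdot>\<^bsub>D\<^esub> amap F f = amap G f \<cdot>\<^bsub>D\<^esub> \<alpha> (Dom C f))"

definition nat_iso ::
  "('o, 'a) cat \<Rightarrow> ('p, 'b) cat \<Rightarrow> ('o, 'a, 'p, 'b) funct \<Rightarrow> ('o, 'a, 'p, 'b) funct
     \<Rightarrow> ('o \<Rightarrow> 'b) \<Rightarrow> bool" where
  "nat_iso C D F G \<alpha> \<longleftrightarrow> nat_trans C D F G \<alpha> \<and> (\<forall>A \<in> Obj C. is_iso D (\<alpha> A))"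

text \<open>Categories of structured objects. Arrows carry their source and target, since the same
  underlying datum may be a morphism between different pairs of objects. The identity on \<open>x\<close>
  is \<open>idt x\<close>; \<open>cmp x y z g f\<close> is the composite of \<open>f\<close> from \<open>x\<close> to \<open>y\<close>
  followed by \<open>g\<close> from \<open>y\<close> to \<open>z\<close>.\<close>

datatype ('x, 'f) tagged = Tagged (source: 'x) (target: 'x) (body: 'f)

definition concrete_cat ::
  "'x set \<Rightarrow> ('x \<Rightarrow> 'x \<Rightarrow> 'f set) \<Rightarrow> ('x \<Rightarrow> 'f) \<Rightarrow> ('x \<Rightarrow> 'x \<Rightarrow> 'x \<Rightarrow> 'f \<Rightarrow> 'f \<Rightarrow> 'f)
     \<Rightarrow> ('x, ('x, 'f) tagged) cat" where
  "concrete_cat X H idt cmp =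
     \<lparr>Obj = X,
      Arr = {Tagged x y f | x y f. x \<in> X \<and> y \<in> X \<and> f \<in> H x y},
      Dom = source,
      Cod = target,
      Idn = (\<lambda>x. Tagged x x (idt x)),
      Cmp = (\<lambda>g f. Tagged (source f) (target g)
                (cmp (source f) (target f) (target g) (body g) (body f)))\<rparr>"

text \<open>Categories with objects in \<open>'o\<close> and arrows in \<open>'a\<close>; these types play the role of the
  universe.\<close>

definition Cat ::
  "(('o, 'a) cat, (('o, 'a) cat, ('o, 'a, 'o, 'a) funct) tagged) cat" where
  "Cat = concrete_cat {C. category C} (\<lambda>C D. {F. cat_functor C D F})
     id_functor (\<lambda>C D E G F. comp_functor C G F)"


section \<open>Colimits and pushouts\<close>

definition is_cocone ::
  "('i, 'u) cat \<Rightarrow> ('o, 'a) cat \<Rightarrow> ('i, 'u, 'o, 'a) funct \<Rightarrow> 'o \<Rightarrow> ('i \<Rightarrow> 'a) \<Rightarrow> bool" where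
  "is_cocone J C D X \<iota> \<longleftrightarrow> X \<in> Obj C \<and>
     (\<forall>j \<in> Obj J. \<iota> j \<in> hom C (omap D j) X) \<and>
     (\<forall>u \<in> Arr J. \<iota> (Cod J u) \<cdot>\<^bsub>C\<^esub> amap D u = \<iota> (Dom J u))"

definition is_colimit ::
  "('i, 'u) cat \<Rightarrow> ('o, 'a) cat \<Rightarrow> ('i, 'u, 'o, 'a) funct \<Rightarrow> 'o \<Rightarrow> ('i \<Rightarrow> 'a) \<Rightarrow> bool" where
  "is_colimit J C D X \<iota> \<longleftrightarrow> is_cocone J C D X \<iota> \<and>
     (\<forall>Y c. is_cocone J C D Y c \<longrightarrow>
        (\<exists>!f. f \<in> hom C X Y \<and> (\<forall>j \<in> Obj J. f \<cdot>\<^bsub>C\<^esub> \<iota> j = c j)))"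

definition preserves_colimit ::
  "('i, 'u) cat \<Rightarrow> ('o, 'a) cat \<Rightarrow> ('p, 'b) cat \<Rightarrow> ('o, 'a, 'p, 'b) funct
     \<Rightarrow> ('i, 'u, 'o, 'a) funct \<Rightarrow> bool" where
  "preserves_colimit J C C' F D \<longleftrightarrow>
     (\<forall>X \<iota>. is_colimit J C D X \<iota> \<longrightarrow>
        is_colimit J C' (comp_functor J F D) (omap F X) (\<lambda>j. amap F (\<iota> j)))"

text \<open>\<open>is_pushout C f g p q\<close>: the square with span \<open>f\<close>, \<open>g\<close> and cospan \<open>p\<close>, \<open>q\<close> is a
  pushout; \<open>p\<close> is opposite \<open>g\<close>, and \<open>q\<close> is opposite \<open>f\<close>.\<close>

definition is_pushout :: "('o, 'a) cat \<Rightarrow> 'a \<Rightarrow> 'a \<Rightarrow> 'a \<Rightarrow> 'a \<Rightarrow> bool" where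
  "is_pushout C f g p q \<longleftrightarrow>
     f \<in> Arr C \<and> g \<in> Arr C \<and> p \<in> Arr C \<and> q \<in> Arr C \<and>
     Dom C f = Dom C g \<and> Dom C p = Cod C f \<and> Dom C q = Cod C g \<and> Cod C p = Cod C q \<and>
     p \<cdot>\<^bsub>C\<^esub> f = q \<cdot>\<^bsub>C\<^esub> g \<and>
     (\<forall>Y. \<forall>h \<in> hom C (Cod C f) Y. \<forall>k \<in> hom C (Cod C g) Y. h \<cdot>\<^bsub>C\<^esub> f = k \<cdot>\<^bsub>C\<^esub> g \<longrightarrow>
        (\<exists>!u. u \<in> hom C (Cod C p) Y \<and> u \<cdot>\<^bsub>C\<^esub> p = h \<and> u \<cdot>\<^bsub>C\<^esub> q = k))"


section \<open>Ordinals and chains\<close>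

text \<open>An ordinal is a (reflexive) well-order relation \<open>\<kappa>\<close>. The ordinals \<open>\<alpha> < \<kappa>\<close> are the
  elements \<open>a\<close> of its field, and \<open>seg \<kappa> a\<close> is \<open>\<alpha>\<close> as a well-order in its own right.\<close>

definition seg :: "'k rel \<Rightarrow> 'k \<Rightarrow> 'k rel" where
  "seg \<kappa> a = Restr \<kappa> (underS \<kappa> a)"

text \<open>The empty well-order is a limit ordinal in this sense: only inhabited families need a
  strict upper bound.\<close>

definition limit_ordinal :: "'k rel \<Rightarrow> bool" where
  "limit_ordinal \<kappa> \<longleftrightarrow> Well_order \<kappa> \<and>
     (\<forall>B. finite B \<and> B \<noteq> {} \<and> B \<subseteq> Field \<kappa> \<longrightarrow> (\<exists>b \<in> Field \<kappa>. B \<subseteq> underS \<kappa> b))"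

text \<open>The ordinal sum \<open>1 + \<alpha>\<close>: a new least element \<open>None\<close> is added to \<open>\<alpha>\<close>.\<close>

definition one_plus :: "'i rel \<Rightarrow> 'i option rel" where
  "one_plus r = {(None, None)} \<union> {(None, Some i) | i. i \<in> Field r}
     \<union> {(Some i, Some j) | i j. (i, j) \<in> r}"

definition poset_cat :: "'i rel \<Rightarrow> ('i, 'i \<times> 'i) cat" where
  "poset_cat r =
     \<lparr>Obj = Field r, Arr = r, Dom = fst, Cod = snd, Idn = (\<lambda>i. (i, i)),
      Cmp = (\<lambda>q p. (fst p, snd q))\<rparr>"


section \<open>Wide subcategories and backdrops\<close>

definition wide_subcat :: "('o, 'a) cat \<Rightarrow> 'a set \<Rightarrow> bool" where
  "wide_subcat E M \<longleftrightarrow> M \<subseteq> Arr E \<and> (\<forall>A \<in> Obj E. Idn E A \<in> M) \<and>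
     (\<forall>f \<in> M. \<forall>g \<in> M. Dom E g = Cod E f \<longrightarrow> g \<cdot>\<^bsub>E\<^esub> f \<in> M)"

definition subcat :: "('o, 'a) cat \<Rightarrow> 'a set \<Rightarrow> ('o, 'a) cat" where
  "subcat E M = E\<lparr>Arr := M\<rparr>"

text \<open>The inclusion of \<open>subcat E M\<close> into \<open>E\<close> is \<open>id_functor (subcat E M)\<close>, regarded as a
  functor to \<open>E\<close>. Composing a functor with it gives back the same record, so a diagram in
  \<open>subcat E M\<close> is used as a diagram in \<open>E\<close> without further notation.\<close>

definition has_colimits_in ::
  "('i, 'u) cat \<Rightarrow> ('o, 'a) cat \<Rightarrow> 'a set \<Rightarrow> bool" where
  "has_colimits_in J E M \<longleftrightarrow>
     (\<forall>D. cat_functor J (subcat E M) D \<longrightarrow>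
        (\<exists>X \<iota>. is_colimit J (subcat E M) D X \<iota>) \<and>
        preserves_colimit J (subcat E M) E (id_functor (subcat E M)) D)"

definition closed_cobase_change :: "('o, 'a) cat \<Rightarrow> 'a set \<Rightarrow> bool" where
  "closed_cobase_change E M \<longleftrightarrow>
     (\<forall>f \<in> M. \<forall>g \<in> Arr E. Dom E g = Dom E f \<longrightarrow> (\<exists>p q. is_pushout E f g p q \<and> q \<in> M))"

definition backdrop :: "'k rel \<Rightarrow> ('o, 'a) cat \<Rightarrow> 'a set \<Rightarrow> bool" where
  "backdrop \<kappa> E M \<longleftrightarrow> category E \<and> wide_subcat E M \<and>
     (\<forall>a \<in> Field \<kappa>. has_colimits_in (poset_cat (one_plus (seg \<kappa> a))) E M) \<and>
     (\<forall>D. cat_functor (poset_cat \<kappa>) (subcat E M) D \<longrightarrow>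
        (\<exists>X \<iota>. is_colimit (poset_cat \<kappa>) E D X \<iota>)) \<and>
     closed_cobase_change E M"

text \<open>Colimits of chains in \<open>M\<close> are taken in the ambient category. (The subcategory \<open>M\<close> need
  not contain the isomorphisms; its own colimits of \<open>1 + \<alpha>\<close>-chains are ambient colimits.)\<close>

definition preserves_chain_colimits ::
  "'i rel \<Rightarrow> ('o, 'a) cat \<Rightarrow> 'a set \<Rightarrow> ('p, 'b) cat \<Rightarrow> ('o, 'a, 'p, 'b) funct \<Rightarrow> bool" where
  "preserves_chain_colimits r E M E' F \<longleftrightarrow>
     (\<forall>D. cat_functor (poset_cat r) (subcat E M) D \<longrightarrow>
        preserves_colimit (poset_cat r) E E' F D)"

definition backdrop_preserving ::
  "'k rel \<Rightarrow> ('o, 'a) cat \<Rightarrow> 'a set \<Rightarrow> ('p, 'b) cat \<Rightarrow> 'b set \<Rightarrow> ('o, 'a, 'p, 'b) funct \<Rightarrow> bool" where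
  "backdrop_preserving \<kappa> E1 M1 E2 M2 F \<longleftrightarrow> cat_functor E1 E2 F \<and>
     (\<forall>f \<in> M1. amap F f \<in> M2) \<and>
     (\<forall>a \<in> Field \<kappa>. preserves_chain_colimits (one_plus (seg \<kappa> a)) E1 M1 E2 F) \<and>
     preserves_chain_colimits \<kappa> E1 M1 E2 F \<and>
     (\<forall>f \<in> M1. \<forall>g p q. is_pushout E1 f g p q \<longrightarrow>
        is_pushout E2 (amap F f) (amap F g) (amap F p) (amap F q))"


section \<open>Pointed endofunctors and monads\<close>

record ('o, 'a) ptd_endo =
  endo :: "('o, 'a, 'o, 'a) funct"
  point :: "'o \<Rightarrow> 'a"

record ('o, 'a) mnd = "('o, 'a) ptd_endo" +
  multn :: "'o \<Rightarrow> 'a"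

definition is_ptd_endo :: "('o, 'a) cat \<Rightarrow> ('o, 'a) ptd_endo \<Rightarrow> bool" where
  "is_ptd_endo E T \<longleftrightarrow> nat_trans E E (id_functor E) (endo T) (point T)"

definition ptd_of :: "('o, 'a) mnd \<Rightarrow> ('o, 'a) ptd_endo" where
  "ptd_of M = \<lparr>endo = endo M, point = point M\<rparr>"

definition is_monad :: "('o, 'a) cat \<Rightarrow> ('o, 'a) mnd \<Rightarrow> bool" where
  "is_monad E M \<longleftrightarrow> is_ptd_endo E (ptd_of M) \<and>
     nat_trans E E (comp_functor E (endo M) (endo M)) (endo M) (multn M) \<and>
     (\<forall>A \<in> Obj E.
        multn M A \<cdot>\<^bsub>E\<^esub> point M (omap (endo M) A) = Idn E (omap (endo M) A) \<and>
        multn M A \<cdot>\<^bsub>E\<^esub> amap (endo M) (point M A) = Idn E (omap (endo M) A) \<and>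
        multn M A \<cdot>\<^bsub>E\<^esub> multn M (omap (endo M) A) = multn M A \<cdot>\<^bsub>E\<^esub> amap (endo M) (multn M A))"

text \<open>Morphisms over a fixed category.\<close>

definition ptd_endo_hom ::
  "('o, 'a) cat \<Rightarrow> ('o, 'a) ptd_endo \<Rightarrow> ('o, 'a) ptd_endo \<Rightarrow> ('o \<Rightarrow> 'a) \<Rightarrow> bool" where
  "ptd_endo_hom E T T' \<gamma> \<longleftrightarrow> is_ptd_endo E T \<and> is_ptd_endo E T' \<and>
     nat_trans E E (endo T) (endo T') \<gamma> \<and>
     (\<forall>A \<in> Obj E. \<gamma> A \<cdot>\<^bsub>E\<^esub> point T A = point T' A)"

definition monad_hom ::
  "('o, 'a) cat \<Rightarrow> ('o, 'a) mnd \<Rightarrow> ('o, 'a) mnd \<Rightarrow> ('o \<Rightarrow> 'a) \<Rightarrow> bool" where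
  "monad_hom E M M' \<phi> \<longleftrightarrow> is_monad E M \<and> is_monad E M' \<and>
     ptd_endo_hom E (ptd_of M) (ptd_of M') \<phi> \<and>
     (\<forall>A \<in> Obj E. \<phi> A \<cdot>\<^bsub>E\<^esub> multn M A =
        multn M' A \<cdot>\<^bsub>E\<^esub> (amap (endo M') (\<phi> A) \<cdot>\<^bsub>E\<^esub> \<phi> (omap (endo M) A)))"

definition is_free_monad ::
  "('o, 'a) cat \<Rightarrow> ('o, 'a) ptd_endo \<Rightarrow> ('o, 'a) mnd \<Rightarrow> ('o \<Rightarrow> 'a) \<Rightarrow> bool" where
  "is_free_monad E T M \<gamma> \<longleftrightarrow> is_monad E M \<and> ptd_endo_hom E T (ptd_of M) \<gamma> \<and>
     (\<forall>M' \<delta>. is_monad E M' \<and> ptd_endo_hom E T (ptd_of M') \<delta> \<longrightarrow>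
        (\<exists>!\<phi>. monad_hom E M M' \<phi> \<and> (\<forall>A \<in> Obj E. \<delta> A = \<phi> A \<cdot>\<^bsub>E\<^esub> \<gamma> A)))"

definition ptd_Alg ::
  "('o, 'a) cat \<Rightarrow> ('o, 'a) ptd_endo \<Rightarrow> ('o \<times> 'a, ('o \<times> 'a, 'a) tagged) cat" where
  "ptd_Alg E T = concrete_cat
     {(A, a). A \<in> Obj E \<and> a \<in> hom E (omap (endo T) A) A \<and> a \<cdot>\<^bsub>E\<^esub> point T A = Idn E A}
     (\<lambda>(A, a) (B, b). {f \<in> hom E A B. f \<cdot>\<^bsub>E\<^esub> a = b \<cdot>\<^bsub>E\<^esub> amap (endo T) f})
     (\<lambda>(A, a). Idn E A)
     (\<lambda>x y z g f. g \<cdot>\<^bsub>E\<^esub> f)"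

definition monad_Alg ::
  "('o, 'a) cat \<Rightarrow> ('o, 'a) mnd \<Rightarrow> ('o \<times> 'a, ('o \<times> 'a, 'a) tagged) cat" where
  "monad_Alg E M = concrete_cat
     {(A, a). A \<in> Obj E \<and> a \<in> hom E (omap (endo M) A) A \<and> a \<cdot>\<^bsub>E\<^esub> point M A = Idn E A \<and>
        a \<cdot>\<^bsub>E\<^esub> multn M A = a \<cdot>\<^bsub>E\<^esub> amap (endo M) a}
     (\<lambda>(A, a) (B, b). {f \<in> hom E A B. f \<cdot>\<^bsub>E\<^esub> a = b \<cdot>\<^bsub>E\<^esub> amap (endo M) f})
     (\<lambda>(A, a). Idn E A)
     (\<lambda>x y z g f. g \<cdot>\<^bsub>E\<^esub> f)"

definition restrict_alg ::
  "('o, 'a) cat \<Rightarrow> ('o \<Rightarrow> 'a) \<Rightarrow> 'o \<times> 'a \<Rightarrow> 'o \<times> 'a" where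
  "restrict_alg E \<gamma> = (\<lambda>(A, a). (A, a \<cdot>\<^bsub>E\<^esub> \<gamma> A))"

definition alg_functor ::
  "('o, 'a) cat \<Rightarrow> ('o, 'a) mnd \<Rightarrow> ('o \<Rightarrow> 'a) \<Rightarrow>
     ('o \<times> 'a, ('o \<times> 'a, 'a) tagged, 'o \<times> 'a, ('o \<times> 'a, 'a) tagged) funct" where
  "alg_functor E M \<gamma> =
     \<lparr>omap = (\<lambda>x \<in> Obj (monad_Alg E M). restrict_alg E \<gamma> x),
      amap = (\<lambda>f \<in> Arr (monad_Alg E M).
        Tagged (restrict_alg E \<gamma> (source f)) (restrict_alg E \<gamma> (target f)) (body f))\<rparr>"

definition is_alg_free_monad ::
  "('o, 'a) cat \<Rightarrow> ('o, 'a) ptd_endo \<Rightarrow> ('o, 'a) mnd \<Rightarrow> ('o \<Rightarrow> 'a) \<Rightarrow> bool" where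
  "is_alg_free_monad E T M \<gamma> \<longleftrightarrow> is_monad E M \<and> ptd_endo_hom E T (ptd_of M) \<gamma> \<and>
     is_cat_iso (monad_Alg E M) (ptd_Alg E T) (alg_functor E M \<gamma>)"


section \<open>Strong morphisms\<close>

type_synonym ('o, 'a) strong = "('o, 'a, 'o, 'a) funct \<times> ('o \<Rightarrow> 'a)"

definition ptd_strong_hom ::
  "('o, 'a) cat \<Rightarrow> ('o, 'a) ptd_endo \<Rightarrow> ('o, 'a) cat \<Rightarrow> ('o, 'a) ptd_endo
     \<Rightarrow> ('o, 'a) strong set" where
  "ptd_strong_hom E1 T1 E2 T2 = {(F, \<gamma>). cat_functor E1 E2 F \<and>
     nat_iso E1 E2 (comp_functor E1 F (endo T1)) (comp_functor E1 (endo T2) F) \<gamma> \<and>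
     (\<forall>A \<in> Obj E1. \<gamma> A \<cdot>\<^bsub>E2\<^esub> amap F (point T1 A) = point T2 (omap F A))}"

definition monad_strong_hom ::
  "('o, 'a) cat \<Rightarrow> ('o, 'a) mnd \<Rightarrow> ('o, 'a) cat \<Rightarrow> ('o, 'a) mnd \<Rightarrow> ('o, 'a) strong set" where
  "monad_strong_hom E1 M1 E2 M2 =
     {(F, \<gamma>) \<in> ptd_strong_hom E1 (ptd_of M1) E2 (ptd_of M2).
        \<forall>A \<in> Obj E1. \<gamma> A \<cdot>\<^bsub>E2\<^esub> amap F (multn M1 A) =
          multn M2 (omap F A) \<cdot>\<^bsub>E2\<^esub>
            (amap (endo M2) (\<gamma> A) \<cdot>\<^bsub>E2\<^esub> \<gamma> (omap (endo M1) A))}"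

definition strong_id :: "('o, 'a) cat \<Rightarrow> ('o, 'a, 'o, 'a) funct \<Rightarrow> ('o, 'a) strong" where
  "strong_id E T = (id_functor E, \<lambda>A \<in> Obj E. Idn E (omap T A))"

text \<open>For \<open>(F, \<gamma>)\<close> from \<open>(E1, T1)\<close> to \<open>(E2, T2)\<close> and \<open>(G, \<delta>)\<close> from \<open>(E2, T2)\<close> to
  \<open>(E3, T3)\<close>, the composite of \<open>G\<gamma> : GFT1 \<rightarrow> GT2F\<close> and \<open>\<delta>F : GT2F \<rightarrow> T3GF\<close>.\<close>

definition strong_comp ::
  "('o, 'a) cat \<Rightarrow> ('o, 'a) cat \<Rightarrow> ('o, 'a) strong \<Rightarrow> ('o, 'a) strong \<Rightarrow> ('o, 'a) strong" where
  "strong_comp E1 E3 = (\<lambda>(G, \<delta>) (F, \<gamma>).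
     (comp_functor E1 G F, \<lambda>A \<in> Obj E1. \<delta> (omap F A) \<cdot>\<^bsub>E3\<^esub> amap G (\<gamma> A)))"

type_synonym ('o, 'a) mnd_obj = "('o, 'a) cat \<times> ('o, 'a) mnd"

definition Mnd_s ::
  "(('o, 'a) mnd_obj, (('o, 'a) mnd_obj, ('o, 'a) strong) tagged) cat" where
  "Mnd_s = concrete_cat
     {(E, M). category E \<and> is_monad E M}
     (\<lambda>(E1, M1) (E2, M2). monad_strong_hom E1 M1 E2 M2)
     (\<lambda>(E, M). strong_id E (endo M))
     (\<lambda>(E1, M1) (E2, M2) (E3, M3). strong_comp E1 E3)"

definition Mnd_s_proj ::
  "(('o, 'a) mnd_obj, (('o, 'a) mnd_obj, ('o, 'a) strong) tagged,
    ('o, 'a) cat, (('o, 'a) cat, ('o, 'a, 'o, 'a) funct) tagged) funct" where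
  "Mnd_s_proj =
     \<lparr>omap = (\<lambda>x \<in> Obj Mnd_s. fst x),
      amap = (\<lambda>f \<in> Arr Mnd_s. Tagged (fst (source f)) (fst (target f)) (fst (body f)))\<rparr>"

type_synonym ('o, 'a) conf_obj = "('o, 'a) cat \<times> 'a set \<times> ('o, 'a) ptd_endo"

text \<open>A pushout, and hence its gap map, is determined only up to isomorphism, and \<open>M\<close> need not
  contain the isomorphisms. The condition on gap maps is imposed for every choice of the
  pushout.\<close>

definition gap_maps_in :: "('o, 'a) cat \<Rightarrow> 'a set \<Rightarrow> ('o, 'a) ptd_endo \<Rightarrow> bool" where
  "gap_maps_in E M T \<longleftrightarrow>
     (\<forall>f \<in> M. \<forall>p q u. is_pushout E f (point T (Dom E f)) p q \<and>
        u \<in> hom E (Cod E p) (omap (endo T) (Cod E f)) \<and>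
        u \<cdot>\<^bsub>E\<^esub> p = point T (Cod E f) \<and> u \<cdot>\<^bsub>E\<^esub> q = amap (endo T) f \<longrightarrow> u \<in> M)"

definition is_conf_obj :: "'k rel \<Rightarrow> ('o, 'a) conf_obj \<Rightarrow> bool" where
  "is_conf_obj \<kappa> = (\<lambda>(E, M, T). category E \<and> wide_subcat E M \<and> is_ptd_endo E T \<and>
     backdrop \<kappa> E M \<and>
     (\<forall>A \<in> Obj E. point T A \<in> M) \<and>
     gap_maps_in E M T \<and>
     preserves_chain_colimits \<kappa> E M E (endo T))"

definition ConfMnd ::
  "'k rel \<Rightarrow> (('o, 'a) conf_obj, (('o, 'a) conf_obj, ('o, 'a) strong) tagged) cat" where
  "ConfMnd \<kappa> = concrete_cat
     {x. is_conf_obj \<kappa> x}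
     (\<lambda>(E1, M1, T1) (E2, M2, T2).
        {(F, \<gamma>) \<in> ptd_strong_hom E1 T1 E2 T2. backdrop_preserving \<kappa> E1 M1 E2 M2 F})
     (\<lambda>(E, M, T). strong_id E (endo T))
     (\<lambda>(E1, M1, T1) (E2, M2, T2) (E3, M3, T3). strong_comp E1 E3)"

definition ConfMnd_proj ::
  "'k rel \<Rightarrow>
   (('o, 'a) conf_obj, (('o, 'a) conf_obj, ('o, 'a) strong) tagged,
    ('o, 'a) cat, (('o, 'a) cat, ('o, 'a, 'o, 'a) funct) tagged) funct" where
  "ConfMnd_proj \<kappa> =
     \<lparr>omap = (\<lambda>x \<in> Obj (ConfMnd \<kappa>). fst x),
      amap = (\<lambda>f \<in> Arr (ConfMnd \<kappa>). Tagged (fst (source f)) (fst (target f)) (fst (body f)))\<rparr>"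

end

theory Submission
  imports Defs
begin

text \<open>The free algebra on \<open>A\<close> is the colimit \<open>X\<close> of a chain of objects \<open>X a\<close> (\<open>a < \<kappa>\<close>) in \<open>M\<close>
  with compatible maps \<open>T (X b) \<rightarrow> X a\<close> for \<open>b < a\<close>, which is the initial such chain under \<open>A\<close>.
  Here \<open>X a\<close> is the colimit of \<open>A\<close> and the \<open>Y b\<close> for \<open>b < a\<close>, and \<open>Y b\<close> arises from \<open>X b\<close> by
  pushout along the map \<open>m : P b \<rightarrow> T (X b)\<close>, where the corner \<open>P b\<close> is \<open>X b\<close> with all earlier
  \<open>T (X c)\<close> attached to it. The map \<open>m\<close> is in \<open>M\<close>, since \<open>P b\<close> is the colimit in \<open>M\<close> of the
  pushouts of \<open>X c \<rightarrow> X b\<close> and \<open>\<tau>\<close> on \<open>X c\<close>, on which \<open>m\<close> restricts to gap maps.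

  A backdrop-preserving functor preserves all the colimits used. So the image under a strong
  morphism of the free algebra on \<open>A\<close> is again free, on the image of \<open>A\<close>. This yields the
  comparison isomorphism of the free monads, and all coherence conditions on it hold by uniqueness
  of algebra maps out of free algebras.\<close>

section \<open>Categories and functors\<close>

text \<open>Two obstacles shape the proof. Colimits are unique only up to isomorphisms that may lie
  outside \<open>M\<close>, so membership in \<open>M\<close> need not pass from one choice to
  another; objects are therefore chosen by well-founded recursion together with maps in
  \<open>M\<close>. And the functors under which a free algebra must stay free are not known while
  it is built; so each universal property is recorded for the images under all backdrop-preserving
  functors out of \<open>(E, M)\<close>, of which the identity gives it in \<open>E\<close>. The
  corner is forced by coherence: \<open>T (X a) -> Y a\<close> has to restrict along
  \<open>T (X b) -> T (X a)\<close> to the map already given on \<open>T (X b)\<close>. Imposing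
  this afterwards would take a coequalizer, which a backdrop does not supply; gluing the earlier
  \<open>T (X b)\<close> to \<open>X a\<close> beforehand leaves a single pushout. Chains of length
  \<open>1 + \<alpha>\<close> have room for \<open>A\<close> at the bottom, even at the least stage.
  The limit hypothesis puts a stage strictly above each \<open>b\<close>, in which
  \<open>T (X b)\<close> acts; as \<open>T\<close> preserves the colimit \<open>X\<close>, this
  gives \<open>T X -> X\<close>.\<close>

lemma in_hom [simp]: "f \<in> hom C A B \<longleftrightarrow> f \<in> Arr C \<and> Dom C f = A \<and> Cod C f = B"
  by (simp add: hom_def)

context category
begin

lemma Dom_in_Obj [simp]: "f \<in> Arr C \<Longrightarrow> Dom C f \<in> Obj C"
  by (rule Dom_Obj)

lemma Cod_in_Obj [simp]: "f \<in> Arr C \<Longrightarrow> Cod C f \<in> Obj C"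
  by (rule Cod_Obj)

lemma Idn_arr [simp]:
  assumes "A \<in> Obj C"
  shows "Idn C A \<in> Arr C" "Dom C (Idn C A) = A" "Cod C (Idn C A) = A"
  using Idn_hom[OF assms] by simp_all

lemma Cmp_arr [simp]:
  assumes "f \<in> Arr C" "g \<in> Arr C" "Dom C g = Cod C f"
  shows "g \<cdot> f \<in> Arr C" "Dom C (g \<cdot> f) = Dom C f" "Cod C (g \<cdot> f) = Cod C g"
  using Cmp_hom[of f "Dom C f" "Cod C f" g "Cod C g"] assms by simp_all

lemma Cmp_Idn' [simp]: "\<lbrakk>f \<in> Arr C; Dom C f = A\<rbrakk> \<Longrightarrow> f \<cdot> Idn C A = f"
  using Cmp_Idn[of f A "Cod C f"] by simp

lemma Idn_Cmp' [simp]: "\<lbrakk>f \<in> Arr C; Cod C f = A\<rbrakk> \<Longrightarrow> Idn C A \<cdot> f = f"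
  using Idn_Cmp[of f "Dom C f" A] by simp

lemma assoc [simp]:
  "\<lbrakk>f \<in> Arr C; g \<in> Arr C; h \<in> Arr C; Dom C g = Cod C f; Dom C h = Cod C g\<rbrakk>
    \<Longrightarrow> (h \<cdot> g) \<cdot> f = h \<cdot> (g \<cdot> f)"
  using Cmp_assoc[of f "Dom C f" "Cod C f" g "Cod C g" h "Cod C h"] by simp

text \<open>As a simp rule, \<open>assoc\<close> nests composites to the right, so a known equation
  for \<open>g \<cdot> f\<close> no longer matches inside \<open>g \<cdot> (f \<cdot> z)\<close>.
  This rule applies it there; most diagram chases below alternate between the two.\<close>

lemma reassoc:
  assumes "g \<cdot> f = k" "f \<in> Arr C" "g \<in> Arr C" "Dom C g = Cod C f"
    and "z \<in> Arr C" "Cod C z = Dom C f"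
  shows "g \<cdot> (f \<cdot> z) = k \<cdot> z"
  unfolding assms(1)[symmetric] using assms(2-) by simp

lemma pushout_eq:
  assumes "is_pushout C f g p q" "u \<in> hom C (Cod C p) Y" "v \<in> hom C (Cod C p) Y"
    and "u \<cdot> p = v \<cdot> p" "u \<cdot> q = v \<cdot> q"
  shows "u = v"
proof -
  have *: "f \<in> Arr C" "g \<in> Arr C" "p \<in> Arr C" "q \<in> Arr C" "Dom C f = Dom C g"
    "Dom C p = Cod C f" "Dom C q = Cod C g" "Cod C p = Cod C q" "p \<cdot> f = q \<cdot> g"
    and univ: "\<And>Y h k. h \<in> hom C (Cod C f) Y \<Longrightarrow> k \<in> hom C (Cod C g) Y \<Longrightarrow> h \<cdot> f = k \<cdot> g
      \<Longrightarrow> \<exists>!u. u \<in> hom C (Cod C p) Y \<and> u \<cdot> p = h \<and> u \<cdot> q = k"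
    using assms(1) unfolding is_pushout_def by blast+
  have "(v \<cdot> p) \<cdot> f = (v \<cdot> q) \<cdot> g" using * assms by simp
  then have "\<exists>!u. u \<in> hom C (Cod C p) Y \<and> u \<cdot> p = v \<cdot> p \<and> u \<cdot> q = v \<cdot> q"
    using * assms by (intro univ) simp_all
  then show ?thesis using assms by blast
qed

lemma is_iso_inverse:
  assumes "is_iso C f" "f \<in> hom C A B"
  obtains g where "g \<in> hom C B A" "g \<cdot> f = Idn C A" "f \<cdot> g = Idn C B"
  using assms unfolding is_iso_def by auto

end

lemma pushoutD:
  assumes "is_pushout C f g p q"
  shows "f \<in> Arr C" "g \<in> Arr C" "p \<in> Arr C" "q \<in> Arr C"
    "Dom C f = Dom C g" "Dom C p = Cod C f" "Dom C q = Cod C g" "Cod C p = Cod C q"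
    "p \<cdot>\<^bsub>C\<^esub> f = q \<cdot>\<^bsub>C\<^esub> g"
  using assms unfolding is_pushout_def by blast+

lemma pushout_ex:
  assumes "is_pushout C f g p q" "h \<in> hom C (Cod C f) Y" "k \<in> hom C (Cod C g) Y"
    and "h \<cdot>\<^bsub>C\<^esub> f = k \<cdot>\<^bsub>C\<^esub> g"
  obtains u where "u \<in> hom C (Cod C p) Y" "u \<cdot>\<^bsub>C\<^esub> p = h" "u \<cdot>\<^bsub>C\<^esub> q = k"
  using assms unfolding is_pushout_def by blast

locale cfunctor =
  fixes C :: "('o, 'a) cat" and D :: "('p, 'b) cat" and F :: "('o, 'a, 'p, 'b) funct"
  assumes is_functor: "cat_functor C D F"
begin

sublocale src: category C
  using is_functor unfolding cat_functor_def by blast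

sublocale tgt: category D
  using is_functor unfolding cat_functor_def by blast

lemma omap_Obj [simp]: "A \<in> Obj C \<Longrightarrow> omap F A \<in> Obj D"
  using is_functor unfolding cat_functor_def by auto

lemma amap_arr [simp]:
  assumes "f \<in> Arr C"
  shows "amap F f \<in> Arr D" "Dom D (amap F f) = omap F (Dom C f)"
    "Cod D (amap F f) = omap F (Cod C f)"
  using is_functor assms unfolding cat_functor_def by auto

lemma amap_Idn [simp]: "A \<in> Obj C \<Longrightarrow> amap F (Idn C A) = Idn D (omap F A)"
  using is_functor unfolding cat_functor_def by auto

lemma amap_Cmp [simp]:
  "\<lbrakk>f \<in> Arr C; g \<in> Arr C; Dom C g = Cod C f\<rbrakk>
    \<Longrightarrow> amap F (g \<cdot>\<^bsub>C\<^esub> f) = amap F g \<cdot>\<^bsub>D\<^esub> amap F f"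
  using is_functor unfolding cat_functor_def by auto

lemma amap_eq:
  "\<lbrakk>g \<cdot>\<^bsub>C\<^esub> f = k; f \<in> Arr C; g \<in> Arr C; Dom C g = Cod C f\<rbrakk>
    \<Longrightarrow> amap F g \<cdot>\<^bsub>D\<^esub> amap F f = amap F k"
  using amap_Cmp by metis

lemma amap_square:
  "\<lbrakk>g \<cdot>\<^bsub>C\<^esub> f = k \<cdot>\<^bsub>C\<^esub> h; f \<in> Arr C; g \<in> Arr C; Dom C g = Cod C f;
    h \<in> Arr C; k \<in> Arr C; Dom C k = Cod C h\<rbrakk>
    \<Longrightarrow> amap F g \<cdot>\<^bsub>D\<^esub> amap F f = amap F k \<cdot>\<^bsub>D\<^esub> amap F h"
  using amap_Cmp by metis

lemma extensional: "omap F \<in> extensional (Obj C)" "amap F \<in> extensional (Arr C)"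
  using is_functor unfolding cat_functor_def by (auto simp: PiE_def)

end

lemma cat_functorI:
  assumes "category C" "category D"
    and "\<And>A. A \<in> Obj C \<Longrightarrow> omap F A \<in> Obj D"
    and "omap F \<in> extensional (Obj C)" "amap F \<in> extensional (Arr C)"
    and "\<And>f. f \<in> Arr C \<Longrightarrow> amap F f \<in> hom D (omap F (Dom C f)) (omap F (Cod C f))"
    and "\<And>A. A \<in> Obj C \<Longrightarrow> amap F (Idn C A) = Idn D (omap F A)"
    and "\<And>f g. \<lbrakk>f \<in> Arr C; g \<in> Arr C; Dom C g = Cod C f\<rbrakk>
        \<Longrightarrow> amap F (g \<cdot>\<^bsub>C\<^esub> f) = amap F g \<cdot>\<^bsub>D\<^esub> amap F f"
  shows "cat_functor C D F"
  using assms unfolding cat_functor_def by (auto simp: PiE_def)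

lemma id_functor_apply [simp]:
  "A \<in> Obj C \<Longrightarrow> omap (id_functor C) A = A" "f \<in> Arr C \<Longrightarrow> amap (id_functor C) f = f"
  by (simp_all add: id_functor_def)

lemma comp_functor_apply [simp]:
  "A \<in> Obj C \<Longrightarrow> omap (comp_functor C G F) A = omap G (omap F A)"
  "f \<in> Arr C \<Longrightarrow> amap (comp_functor C G F) f = amap G (amap F f)"
  by (simp_all add: comp_functor_def)

lemma cat_functor_id: "category C \<Longrightarrow> cat_functor C C (id_functor C)"
proof -
  assume "category C"
  then interpret category C .
  show ?thesis by (rule cat_functorI) (use \<open>category C\<close> in \<open>auto simp: id_functor_def\<close>)
qed

lemma cat_functor_comp:
  assumes "cat_functor C D F" "cat_functor D E G"
  shows "cat_functor C E (comp_functor C G F)"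
proof -
  interpret F: cfunctor C D F by standard fact
  interpret G: cfunctor D E G by standard fact
  show ?thesis
    by (rule cat_functorI)
      (auto simp: comp_functor_def F.src.category_axioms G.tgt.category_axioms)
qed

lemma funct_eqI: "\<lbrakk>omap F = omap G; amap F = amap G\<rbrakk> \<Longrightarrow> F = (G :: ('o, 'a, 'p, 'b) funct)"
  by simp

lemma comp_functor_id:
  assumes "cat_functor C D F"
  shows "comp_functor C F (id_functor C) = F" "comp_functor C (id_functor D) F = F"
proof -
  interpret cfunctor C D F by standard fact
  show "comp_functor C F (id_functor C) = F" "comp_functor C (id_functor D) F = F"
    using extensional
    by (auto intro!: funct_eqI extensionalityI[where A = "Obj C"] extensionalityI[where A = "Arr C"]
        simp: comp_functor_def)
qed

lemma comp_functor_assoc: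
  assumes "cat_functor C D F"
  shows "comp_functor C (comp_functor D H G) F = comp_functor C H (comp_functor C G F)"
proof -
  interpret cfunctor C D F by standard fact
  show ?thesis by (auto intro!: funct_eqI simp: comp_functor_def restrict_def fun_eq_iff)
qed

section \<open>Categories of structured objects and functors between them\<close>

lemma concrete_cat_simps:
  "Obj (concrete_cat X H idt cmp) = X"
  "t \<in> Arr (concrete_cat X H idt cmp) \<longleftrightarrow>
     source t \<in> X \<and> target t \<in> X \<and> body t \<in> H (source t) (target t)"
  "Dom (concrete_cat X H idt cmp) = source"
  "Cod (concrete_cat X H idt cmp) = target"
  "Idn (concrete_cat X H idt cmp) x = Tagged x x (idt x)"
  "Cmp (concrete_cat X H idt cmp) g f =
     Tagged (source f) (target g) (cmp (source f) (target f) (target g) (body g) (body f))"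
  unfolding concrete_cat_def by (cases t; auto)+

lemma category_concrete_cat:
  assumes idt: "\<And>x. x \<in> X \<Longrightarrow> idt x \<in> H x x"
    and cmp: "\<And>x y z f g. \<lbrakk>x \<in> X; y \<in> X; z \<in> X; f \<in> H x y; g \<in> H y z\<rbrakk>
      \<Longrightarrow> cmp x y z g f \<in> H x z"
    and right_unit: "\<And>x y f. \<lbrakk>x \<in> X; y \<in> X; f \<in> H x y\<rbrakk> \<Longrightarrow> cmp x x y f (idt x) = f"
    and left_unit: "\<And>x y f. \<lbrakk>x \<in> X; y \<in> X; f \<in> H x y\<rbrakk> \<Longrightarrow> cmp x y y (idt y) f = f"
    and assoc: "\<And>w x y z f g h.
      \<lbrakk>w \<in> X; x \<in> X; y \<in> X; z \<in> X; f \<in> H w x; g \<in> H x y; h \<in> H y z\<rbrakk>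
      \<Longrightarrow> cmp w x z (cmp x y z h g) f = cmp w y z h (cmp w x y g f)"
  shows "category (concrete_cat X H idt cmp)"
  by standard (auto simp: concrete_cat_simps idt cmp right_unit left_unit assoc tagged.expand)

text \<open>Yields the three functors needed between such categories: restriction of algebras along
  the generators, its inverse, and the lift of the theorem. The action \<open>\<psi>\<close> on
  arrows sees source and target, since the comparison of free monads depends on both.\<close>

lemma concrete_functor:
  assumes "category (concrete_cat X H idt cmp)" "category (concrete_cat X' H' idt' cmp')"
    and obj: "\<And>x. x \<in> X \<Longrightarrow> \<phi> x \<in> X'"
    and arr: "\<And>x y f. \<lbrakk>x \<in> X; y \<in> X; f \<in> H x y\<rbrakk> \<Longrightarrow> \<psi> x y f \<in> H' (\<phi> x) (\<phi> y)"
    and idt: "\<And>x. x \<in> X \<Longrightarrow> \<psi> x x (idt x) = idt' (\<phi> x)"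
    and cmp: "\<And>x y z f g. \<lbrakk>x \<in> X; y \<in> X; z \<in> X; f \<in> H x y; g \<in> H y z\<rbrakk>
      \<Longrightarrow> \<psi> x z (cmp x y z g f) = cmp' (\<phi> x) (\<phi> y) (\<phi> z) (\<psi> y z g) (\<psi> x y f)"
  shows "cat_functor (concrete_cat X H idt cmp) (concrete_cat X' H' idt' cmp')
    \<lparr>omap = (\<lambda>x \<in> X. \<phi> x),
     amap = (\<lambda>t \<in> Arr (concrete_cat X H idt cmp).
       Tagged (\<phi> (source t)) (\<phi> (target t)) (\<psi> (source t) (target t) (body t)))\<rparr>"
proof -
  interpret category "concrete_cat X H idt cmp" by fact
  \<comment> \<open>Closure of \<open>H\<close> under identities and composition is extracted from
    the assumption that the source is a category.\<close>
  have 1: "idt x \<in> H x x" if "x \<in> X" for x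
    using Idn_arr(1)[of x] that by (simp add: concrete_cat_simps)
  have 2: "cmp x y z g f \<in> H x z"
    if "x \<in> X" "y \<in> X" "z \<in> X" "f \<in> H x y" "g \<in> H y z" for x y z f g
    using Cmp_arr(1)[of "Tagged x y f" "Tagged y z g"] that by (simp add: concrete_cat_simps)
  show ?thesis
    by (rule cat_functorI[OF assms(1,2)])
      (auto simp: concrete_cat_simps obj arr idt cmp 1 2)
qed


section \<open>Chains as families of maps\<close>

text \<open>A chain is given by its maps for strict inequalities only, and identities are put on the
  diagonal. Recursive constructions then never have to produce the identities.\<close>

definition family_functor ::
  "'i rel \<Rightarrow> ('o, 'a) cat \<Rightarrow> ('i \<Rightarrow> 'o) \<Rightarrow> ('i \<Rightarrow> 'i \<Rightarrow> 'a) \<Rightarrow> ('i, 'i \<times> 'i, 'o, 'a) funct" where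
  "family_functor r C D d =
     \<lparr>omap = (\<lambda>j \<in> Field r. D j),
      amap = (\<lambda>u \<in> r. if fst u = snd u then Idn C (D (fst u)) else d (fst u) (snd u))\<rparr>"

text \<open>The universal half of being a colimit, with existence and uniqueness separated; that
  \<open>\<iota>\<close> is a cocone is recorded apart. The objects of the chain are read off as the
  domains of the legs, so the predicate also fits the image of a chain under a functor.\<close>

definition family_colimit ::
  "'i rel \<Rightarrow> ('o, 'a) cat \<Rightarrow> ('i \<Rightarrow> 'i \<Rightarrow> 'a) \<Rightarrow> 'o \<Rightarrow> ('i \<Rightarrow> 'a) \<Rightarrow> bool" where
  "family_colimit r C d X \<iota> \<longleftrightarrow>
     (\<forall>B \<in> Obj C. \<forall>g. (\<forall>j \<in> Field r. g j \<in> hom C (Dom C (\<iota> j)) B \<and>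
          (\<forall>i \<in> underS r j. g j \<cdot>\<^bsub>C\<^esub> d i j = g i)) \<longrightarrow>
        (\<exists>u \<in> hom C X B. \<forall>j \<in> Field r. u \<cdot>\<^bsub>C\<^esub> \<iota> j = g j)) \<and>
     (\<forall>B. \<forall>u \<in> hom C X B. \<forall>v \<in> hom C X B.
        (\<forall>j \<in> Field r. u \<cdot>\<^bsub>C\<^esub> \<iota> j = v \<cdot>\<^bsub>C\<^esub> \<iota> j) \<longrightarrow> u = v)"

locale family =
  fixes r :: "'i rel" and C :: "('o, 'a) cat" and D :: "'i \<Rightarrow> 'o" and d :: "'i \<Rightarrow> 'i \<Rightarrow> 'a"
  assumes order: "Partial_order r"
    and cat: "category C"
    and D: "\<And>j. j \<in> Field r \<Longrightarrow> D j \<in> Obj C"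
    and d: "\<And>i j. i \<in> underS r j \<Longrightarrow> d i j \<in> hom C (D i) (D j)"
    and d_d: "\<And>i j k. \<lbrakk>i \<in> underS r j; j \<in> underS r k\<rbrakk> \<Longrightarrow> d j k \<cdot>\<^bsub>C\<^esub> d i j = d i k"
begin

sublocale category C by (rule cat)

lemma refl_r: "j \<in> Field r \<Longrightarrow> (j, j) \<in> r"
  using order by (auto simp: order_on_defs refl_on_def)

lemma trans_r: "(i, j) \<in> r \<Longrightarrow> (j, k) \<in> r \<Longrightarrow> (i, k) \<in> r"
  using order by (auto simp: order_on_defs trans_def)

lemma antisym_r: "(i, j) \<in> r \<Longrightarrow> (j, i) \<in> r \<Longrightarrow> i = j"
  using order by (auto simp: order_on_defs antisym_def)

lemma d_arr [simp]:
  assumes "i \<in> underS r j"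
  shows "d i j \<in> Arr C" "Dom C (d i j) = D i" "Cod C (d i j) = D j"
  using d[OF assms] by simp_all

lemma category_poset: "category (poset_cat r)"
  by standard (auto simp: poset_cat_def hom_def refl_r Field_def dest: refl_r trans_r)

lemma cat_functor_family: "cat_functor (poset_cat r) C (family_functor r C D d)"
proof (rule cat_functorI[OF category_poset cat])
  fix f g
  assume f: "f \<in> Arr (poset_cat r)" and g: "g \<in> Arr (poset_cat r)"
    and gf: "Dom (poset_cat r) g = Cod (poset_cat r) f"
  obtain i j k where ij: "f = (i, j)" "g = (j, k)"
    using gf by (cases f; cases g) (auto simp: poset_cat_def)
  have r: "(i, j) \<in> r" "(j, k) \<in> r" using f g ij by (auto simp: poset_cat_def)
  have F: "i \<in> Field r" "j \<in> Field r" "k \<in> Field r" using r by (auto simp: Field_def)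
  \<comment> \<open>On the diagonal the functor is an identity by definition; antisymmetry excludes
    that two strict steps compose to a diagonal pair.\<close>
  have "i = j" if "i = k" using r antisym_r that by blast
  then show "amap (family_functor r C D d) (g \<cdot>\<^bsub>poset_cat r\<^esub> f) =
      amap (family_functor r C D d) g \<cdot>\<^bsub>C\<^esub> amap (family_functor r C D d) f"
    using r trans_r[OF r] F D d_d[of i j k] d[of i j] d[of j k] unfolding ij
    by (auto simp: poset_cat_def family_functor_def underS_def)
next
  fix f assume f: "f \<in> Arr (poset_cat r)"
  obtain i j where ij: "f = (i, j)" by (cases f)
  then show "amap (family_functor r C D d) f \<in> hom C
      (omap (family_functor r C D d) (Dom (poset_cat r) f))
      (omap (family_functor r C D d) (Cod (poset_cat r) f))"
    using f D d[of i j]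
    by (auto simp: poset_cat_def family_functor_def underS_def Field_def)
qed (auto simp: poset_cat_def family_functor_def D refl_r)

lemma is_cocone_family:
  "is_cocone (poset_cat r) C (family_functor r C D d) X \<iota> \<longleftrightarrow> X \<in> Obj C \<and>
     (\<forall>j \<in> Field r. \<iota> j \<in> hom C (D j) X \<and> (\<forall>i \<in> underS r j. \<iota> j \<cdot>\<^bsub>C\<^esub> d i j = \<iota> i))"
    (is "?l \<longleftrightarrow> ?r")
proof
  assume ?l
  then have 1: "X \<in> Obj C" "\<And>j. j \<in> Field r \<Longrightarrow> \<iota> j \<in> hom C (D j) X"
    and 2: "\<And>u. u \<in> r \<Longrightarrow> \<iota> (snd u) \<cdot>\<^bsub>C\<^esub> amap (family_functor r C D d) u = \<iota> (fst u)"
    by (auto simp: is_cocone_def poset_cat_def family_functor_def)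
  have "\<iota> j \<cdot>\<^bsub>C\<^esub> d i j = \<iota> i" if "i \<in> underS r j" for i j
    using 2[of "(i, j)"] that by (auto simp: family_functor_def underS_def)
  then show ?r using 1 by auto
next
  assume r: ?r
  have "\<iota> (snd u) \<cdot>\<^bsub>C\<^esub> amap (family_functor r C D d) u = \<iota> (fst u)" if "u \<in> r" for u
  proof (cases "fst u = snd u")
    case True
    then obtain a where a: "u = (a, a)" by (cases u) auto
    then have "a \<in> Field r" using that by (auto simp: Field_def)
    then show ?thesis using that r a by (auto simp: family_functor_def)
  next
    case False
    then have "fst u \<in> underS r (snd u)" "snd u \<in> Field r"
      using that by (cases u; auto simp: underS_def Field_def)+
    then show ?thesis using that r False by (auto simp: family_functor_def)
  qed
  then show ?l using r by (auto simp: is_cocone_def poset_cat_def family_functor_def)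
qed

lemma is_colimit_family:
  assumes "is_colimit (poset_cat r) C (family_functor r C D d) X \<iota>"
  shows "X \<in> Obj C" "\<And>j. j \<in> Field r \<Longrightarrow> \<iota> j \<in> hom C (D j) X"
    "\<And>i j. i \<in> underS r j \<Longrightarrow> \<iota> j \<cdot>\<^bsub>C\<^esub> d i j = \<iota> i"
    "family_colimit r C d X \<iota>"
proof -
  have X: "X \<in> Obj C" and \<iota>: "\<And>j. j \<in> Field r \<Longrightarrow> \<iota> j \<in> hom C (D j) X"
    and \<iota>d: "\<And>i j. j \<in> Field r \<Longrightarrow> i \<in> underS r j \<Longrightarrow> \<iota> j \<cdot>\<^bsub>C\<^esub> d i j = \<iota> i"
    and univ: "\<And>Y c. is_cocone (poset_cat r) C (family_functor r C D d) Y c \<Longrightarrow>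
        \<exists>!f. f \<in> hom C X Y \<and> (\<forall>j \<in> Field r. f \<cdot>\<^bsub>C\<^esub> \<iota> j = c j)"
    using assms unfolding is_colimit_def is_cocone_family by (auto simp: poset_cat_def)
  have Dom: "Dom C (\<iota> j) = D j" if "j \<in> Field r" for j using \<iota>[OF that] by simp
  show "X \<in> Obj C" "\<And>j. j \<in> Field r \<Longrightarrow> \<iota> j \<in> hom C (D j) X" by fact+
  show \<iota>d': "\<iota> j \<cdot>\<^bsub>C\<^esub> d i j = \<iota> i" if "i \<in> underS r j" for i j
    using \<iota>d[of j i] that by (auto simp: underS_def Field_def)
  show "family_colimit r C d X \<iota>"
    unfolding family_colimit_def
  proof (intro conjI allI ballI impI)
    fix B g
    assume "B \<in> Obj C" "\<forall>j \<in> Field r. g j \<in> hom C (Dom C (\<iota> j)) B \<and>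
          (\<forall>i \<in> underS r j. g j \<cdot>\<^bsub>C\<^esub> d i j = g i)"
    then have "is_cocone (poset_cat r) C (family_functor r C D d) B g"
      unfolding is_cocone_family using Dom by auto
    from univ[OF this] show "\<exists>u \<in> hom C X B. \<forall>j \<in> Field r. u \<cdot>\<^bsub>C\<^esub> \<iota> j = g j" by blast
  next
    fix B u v
    assume u: "u \<in> hom C X B" and v: "v \<in> hom C X B"
      and uv: "\<forall>j \<in> Field r. u \<cdot>\<^bsub>C\<^esub> \<iota> j = v \<cdot>\<^bsub>C\<^esub> \<iota> j"
    have "is_cocone (poset_cat r) C (family_functor r C D d) B (\<lambda>j. v \<cdot>\<^bsub>C\<^esub> \<iota> j)"
      unfolding is_cocone_family
    proof (intro conjI ballI)
      show "B \<in> Obj C" using v Cod_in_Obj by auto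
      show "v \<cdot>\<^bsub>C\<^esub> \<iota> j \<in> hom C (D j) B" if "j \<in> Field r" for j
        using v \<iota>[OF that] by simp
      show "(v \<cdot>\<^bsub>C\<^esub> \<iota> j) \<cdot>\<^bsub>C\<^esub> d i j = v \<cdot>\<^bsub>C\<^esub> \<iota> i" if "j \<in> Field r" "i \<in> underS r j" for i j
        using v \<iota>[OF that(1)] \<iota>d'[OF that(2)] that by simp
    qed
    from univ[OF this] show "u = v" using u v uv by blast
  qed
qed

end

lemma comp_functor_family:
  assumes "family r C D d" "cat_functor C C' F"
  shows "comp_functor (poset_cat r) F (family_functor r C D d) =
      family_functor r C' (\<lambda>j. omap F (D j)) (\<lambda>i j. amap F (d i j))"
    "family r C' (\<lambda>j. omap F (D j)) (\<lambda>i j. amap F (d i j))"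
proof -
  interpret family r C D d by fact
  interpret F: cfunctor C C' F by standard fact
  have "D i \<in> Obj C" "D j \<in> Obj C" "i \<in> Field r" "j \<in> Field r" if "(i, j) \<in> r" for i j
    using that D by (auto simp: Field_def)
  then show "comp_functor (poset_cat r) F (family_functor r C D d) =
      family_functor r C' (\<lambda>j. omap F (D j)) (\<lambda>i j. amap F (d i j))"
    by (auto simp: comp_functor_def family_functor_def poset_cat_def intro!: restrict_ext)
  show "family r C' (\<lambda>j. omap F (D j)) (\<lambda>i j. amap F (d i j))"
  proof (unfold_locales)
    show "amap F (d j k) \<cdot>\<^bsub>C'\<^esub> amap F (d i j) = amap F (d i k)"
      if "i \<in> underS r j" "j \<in> underS r k" for i j k
      using F.amap_eq[OF d_d[OF that]] that by simp
  qed (use order D in auto)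
qed

lemma preserves_family_colimit:
  assumes "family r C D d" "cat_functor C C' F"
    and "is_colimit (poset_cat r) C (family_functor r C D d) X \<iota>"
    and "preserves_colimit (poset_cat r) C C' F (family_functor r C D d)"
  shows "family_colimit r C' (\<lambda>i j. amap F (d i j)) (omap F X) (\<lambda>j. amap F (\<iota> j))"
proof -
  interpret F: family r C' "\<lambda>j. omap F (D j)" "\<lambda>i j. amap F (d i j)"
    by (rule comp_functor_family(2)) fact+
  show ?thesis
    using assms(3,4) unfolding preserves_colimit_def comp_functor_family(1)[OF assms(1,2)]
    by (intro F.is_colimit_family(4)) blast
qed


section \<open>Chains below an ordinal\<close>

locale well_order =
  fixes r :: "'k rel"
  assumes WELL: "Well_order r"
begin

lemma REFL: "Refl r" and TRANS: "trans r" and ANTISYM: "antisym r" and TOTAL: "Total r"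
  using WELL by (auto simp: order_on_defs)

lemma underS_trans: "c \<in> underS r b \<Longrightarrow> b \<in> underS r a \<Longrightarrow> c \<in> underS r a"
  using TRANS ANTISYM by (auto simp: underS_def trans_def antisym_def)

lemma underS_in_Field: "b \<in> underS r a \<Longrightarrow> b \<in> Field r \<and> a \<in> Field r"
  by (auto simp: underS_def Field_def)

lemma wf_underS: "wf {(b, a). b \<in> underS r a}"
proof -
  have "{(b, a). b \<in> underS r a} = r - Id" by (auto simp: underS_def)
  then show ?thesis using WELL by (simp add: well_order_on_def)
qed

lemma underS_linear: "\<lbrakk>a \<in> Field r; b \<in> Field r\<rbrakk> \<Longrightarrow> a = b \<or> a \<in> underS r b \<or> b \<in> underS r a"
  using TOTAL by (auto simp: underS_def total_on_def)

lemma Field_seg: "Field (seg r a) = underS r a"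
  using REFL by (auto simp: seg_def underS_def Field_def refl_on_def)

lemma underS_seg:
  assumes "b \<in> underS r a"
  shows "underS (seg r a) b = underS r b"
proof -
  have "c \<in> underS (seg r a) b \<longleftrightarrow> c \<in> underS r b" for c
    using underS_trans[of c b a] assms by (auto simp: seg_def underS_def)
  then show ?thesis by blast
qed

lemma Partial_order_seg: "Partial_order (seg r a)"
proof -
  have "Partial_order R" if "Well_order R" for R :: "'k rel"
    using that by (simp add: order_on_defs)
  then show ?thesis unfolding seg_def using Well_order_Restr[OF WELL] .
qed

lemma Partial_order: "Partial_order r"
  using WELL by (simp add: order_on_defs)

end

lemma Field_one_plus: "Field (one_plus r) = insert None (Some ` Field r)"
  by (auto simp: one_plus_def Field_def Domain_iff Range_iff)

lemma underS_one_plus: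
  "underS (one_plus r) None = {}"
  "b \<in> Field r \<Longrightarrow> underS (one_plus r) (Some b) = insert None (Some ` underS r b)"
  by (auto simp: one_plus_def underS_def)

lemma Partial_order_one_plus:
  assumes "Partial_order r"
  shows "Partial_order (one_plus r)"
proof -
  have r: "\<And>i. i \<in> Field r \<Longrightarrow> (i, i) \<in> r" "\<And>i j k. (i, j) \<in> r \<Longrightarrow> (j, k) \<in> r \<Longrightarrow> (i, k) \<in> r"
    "\<And>i j. (i, j) \<in> r \<Longrightarrow> (j, i) \<in> r \<Longrightarrow> i = j"
    "\<And>i j. (i, j) \<in> r \<Longrightarrow> i \<in> Field r \<and> j \<in> Field r"
    using assms by (auto simp: order_on_defs refl_on_def trans_def antisym_def Field_def)
  have iff: "(None, None) \<in> one_plus r" "(Some x, None) \<notin> one_plus r"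
    "(None, Some y) \<in> one_plus r \<longleftrightarrow> y \<in> Field r" "(Some x, Some y) \<in> one_plus r \<longleftrightarrow> (x, y) \<in> r" for x y
    by (auto simp: one_plus_def)
  have 1: "(i, k) \<in> one_plus r" if "(i, j) \<in> one_plus r" "(j, k) \<in> one_plus r" for i j k
    using that r(2)[of "the i" "the j" "the k"] r(4)[of "the j" "the k"]
    by (cases i; cases j; cases k; simp add: iff)
  have 2: "i = j" if "(i, j) \<in> one_plus r" "(j, i) \<in> one_plus r" for i j
    using that r(3)[of "the i" "the j"] by (cases i; cases j; simp add: iff)
  have 3: "(i, i) \<in> one_plus r" if "i \<in> Field (one_plus r)" for i
    using that r(1) unfolding Field_one_plus by (cases i) (auto simp: iff)
  have 4: "one_plus r \<subseteq> Field (one_plus r) \<times> Field (one_plus r)"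
    by (auto intro: FieldI1 FieldI2)
  show ?thesis
    unfolding order_on_defs refl_on_def trans_def antisym_def
    by (intro conjI allI impI ballI) (rule 4, erule 3, erule (1) 1, erule (1) 2)
qed

text \<open>The universal property of the colimit of the chain \<open>Z \<rightarrow> D b\<close> (\<open>b \<in> I\<close>) with maps
  \<open>z b\<close> out of \<open>Z = Dom i\<close> and \<open>d c b\<close> between the objects \<open>D b = Dom (\<iota> b)\<close>.\<close>

definition cone_colimit ::
  "'k rel \<Rightarrow> 'k set \<Rightarrow> ('o, 'a) cat \<Rightarrow> ('k \<Rightarrow> 'a) \<Rightarrow> ('k \<Rightarrow> 'k \<Rightarrow> 'a) \<Rightarrow> 'a \<Rightarrow> ('k \<Rightarrow> 'a) \<Rightarrow> bool" where
  "cone_colimit \<kappa> I C z d i \<iota> \<longleftrightarrow>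
     (\<forall>B f g. f \<in> hom C (Dom C i) B \<and>
        (\<forall>b \<in> I. g b \<in> hom C (Dom C (\<iota> b)) B \<and> g b \<cdot>\<^bsub>C\<^esub> z b = f \<and>
          (\<forall>c \<in> underS \<kappa> b. g b \<cdot>\<^bsub>C\<^esub> d c b = g c)) \<longrightarrow>
        (\<exists>u \<in> hom C (Cod C i) B. u \<cdot>\<^bsub>C\<^esub> i = f \<and> (\<forall>b \<in> I. u \<cdot>\<^bsub>C\<^esub> \<iota> b = g b))) \<and>
     (\<forall>B. \<forall>u \<in> hom C (Cod C i) B. \<forall>v \<in> hom C (Cod C i) B.
        u \<cdot>\<^bsub>C\<^esub> i = v \<cdot>\<^bsub>C\<^esub> i \<and> (\<forall>b \<in> I. u \<cdot>\<^bsub>C\<^esub> \<iota> b = v \<cdot>\<^bsub>C\<^esub> \<iota> b) \<longrightarrow> u = v)"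

lemma cone_colimit_ex:
  assumes "cone_colimit \<kappa> I C z d i \<iota>" "f \<in> hom C (Dom C i) B"
    and "\<And>b. b \<in> I \<Longrightarrow> g b \<in> hom C (Dom C (\<iota> b)) B"
    and "\<And>b. b \<in> I \<Longrightarrow> g b \<cdot>\<^bsub>C\<^esub> z b = f"
    and "\<And>b c. b \<in> I \<Longrightarrow> c \<in> underS \<kappa> b \<Longrightarrow> g b \<cdot>\<^bsub>C\<^esub> d c b = g c"
  obtains u where "u \<in> hom C (Cod C i) B" "u \<cdot>\<^bsub>C\<^esub> i = f" "\<And>b. b \<in> I \<Longrightarrow> u \<cdot>\<^bsub>C\<^esub> \<iota> b = g b"
proof -
  have "\<exists>u \<in> hom C (Cod C i) B. u \<cdot>\<^bsub>C\<^esub> i = f \<and> (\<forall>b \<in> I. u \<cdot>\<^bsub>C\<^esub> \<iota> b = g b)"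
    using assms unfolding cone_colimit_def by blast
  then show ?thesis using that by blast
qed

lemma cone_colimit_eq:
  assumes "cone_colimit \<kappa> I C z d i \<iota>" "u \<in> hom C (Cod C i) B" "v \<in> hom C (Cod C i) B"
    and "u \<cdot>\<^bsub>C\<^esub> i = v \<cdot>\<^bsub>C\<^esub> i" "\<And>b. b \<in> I \<Longrightarrow> u \<cdot>\<^bsub>C\<^esub> \<iota> b = v \<cdot>\<^bsub>C\<^esub> \<iota> b"
  shows "u = v"
  using assms unfolding cone_colimit_def by blast

lemma cone_colimit_cong:
  assumes "\<And>b. b \<in> I \<Longrightarrow> underS \<kappa> b \<subseteq> I" "i = i'" "\<And>b. b \<in> I \<Longrightarrow> \<iota> b = \<iota>' b"
    and "\<And>b. b \<in> I \<Longrightarrow> z b = z' b"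
    and "\<And>b c. b \<in> I \<Longrightarrow> c \<in> underS \<kappa> b \<Longrightarrow> d c b = d' c b"
  shows "cone_colimit \<kappa> I C z d i \<iota> = cone_colimit \<kappa> I C z' d' i' \<iota>'"
  using assms by (simp add: cone_colimit_def)

section \<open>Colimits supplied by a backdrop\<close>

lemma (in category) subcat_simps [simp]:
  "Obj (subcat C M) = Obj C" "Arr (subcat C M) = M" "Dom (subcat C M) = Dom C"
  "Cod (subcat C M) = Cod C" "Idn (subcat C M) = Idn C" "Cmp (subcat C M) = Cmp C"
  by (simp_all add: subcat_def)

lemma (in category) category_subcat:
  assumes "wide_subcat C M"
  shows "category (subcat C M)"
proof -
  have "M \<subseteq> Arr C" "\<And>A. A \<in> Obj C \<Longrightarrow> Idn C A \<in> M"
    "\<And>f g. \<lbrakk>f \<in> M; g \<in> M; Dom C g = Cod C f\<rbrakk> \<Longrightarrow> g \<cdot> f \<in> M"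
    using assms unfolding wide_subcat_def by auto
  then show ?thesis by unfold_locales (auto simp: subset_iff)
qed

locale backdrop_cat = well_order \<kappa> + category E
  for \<kappa> :: "'k rel" and E :: "('o, 'a) cat" (structure) +
  fixes M :: "'a set"
  assumes backdrop: "backdrop \<kappa> E M"
begin

lemma wide: "wide_subcat E M"
  using backdrop unfolding backdrop_def by blast

lemma M_arr [simp]: "f \<in> M \<Longrightarrow> f \<in> Arr E"
  using wide unfolding wide_subcat_def by auto

lemma M_Idn [simp]: "A \<in> Obj E \<Longrightarrow> Idn E A \<in> M"
  using wide unfolding wide_subcat_def by auto

lemma M_Cmp [simp]: "\<lbrakk>f \<in> M; g \<in> M; Dom E g = Cod E f\<rbrakk> \<Longrightarrow> g \<cdot> f \<in> M"
  using wide unfolding wide_subcat_def by auto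

lemma cobase_change:
  assumes "f \<in> M" "g \<in> Arr E" "Dom E g = Dom E f"
  obtains p q where "is_pushout E f g p q" "q \<in> M"
  using backdrop assms unfolding backdrop_def closed_cobase_change_def by blast

text \<open>The subcategory takes its identities from \<open>E\<close>, so a chain in
  \<open>M\<close> is literally the same record as a diagram in \<open>M\<close> and in
  \<open>E\<close>. Colimits can thus be compared in both categories without transport.\<close>

lemma family_subcatI:
  assumes "Partial_order r"
    and "\<And>j. j \<in> Field r \<Longrightarrow> D j \<in> Obj E"
    and "\<And>i j. i \<in> underS r j \<Longrightarrow> d i j \<in> M \<and> Dom E (d i j) = D i \<and> Cod E (d i j) = D j"
    and "\<And>i j k. \<lbrakk>i \<in> underS r j; j \<in> underS r k\<rbrakk> \<Longrightarrow> d j k \<cdot> d i j = d i k"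
  shows "family r (subcat E M) D d" "family r E D d"
    and "family_functor r (subcat E M) D d = family_functor r E D d"
proof -
  show "family r (subcat E M) D d"
    by (rule family.intro) (use assms wide in \<open>auto intro: category_subcat\<close>)
  show "family r E D d"
    by (rule family.intro) (use assms category_axioms in \<open>auto\<close>)
  show "family_functor r (subcat E M) D d = family_functor r E D d"
    by (simp add: family_functor_def cong: if_cong)
qed

text \<open>One colimit serves three purposes. Taken in the category \<open>M\<close>, it has its
  legs in \<open>M\<close> and induces maps in \<open>M\<close> from cocones in \<open>M\<close>.
  The inclusion preserves it, so it is a colimit in \<open>E\<close>. Hence it is carried to a
  colimit by every backdrop-preserving functor; stating this for all of them at once keeps the
  choice of \<open>i\<close> and \<open>\<iota>\<close> independent of the functor.\<close>

lemma cone_colimit_exists: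
  assumes a: "a \<in> Field \<kappa>" and Z: "Z \<in> Obj E"
    and z: "\<And>b. b \<in> underS \<kappa> a \<Longrightarrow> z b \<in> M \<and> Dom E (z b) = Z \<and> Cod E (z b) = D b"
    and d: "\<And>b c. b \<in> underS \<kappa> a \<Longrightarrow> c \<in> underS \<kappa> b
      \<Longrightarrow> d c b \<in> M \<and> Dom E (d c b) = D c \<and> Cod E (d c b) = D b"
    and dz: "\<And>b c. b \<in> underS \<kappa> a \<Longrightarrow> c \<in> underS \<kappa> b \<Longrightarrow> d c b \<cdot> z c = z b"
    and dd: "\<And>b c e. b \<in> underS \<kappa> a \<Longrightarrow> c \<in> underS \<kappa> b \<Longrightarrow> e \<in> underS \<kappa> c
      \<Longrightarrow> d c b \<cdot> d e c = d e b"
  obtains i \<iota> where "i \<in> M" "Dom E i = Z"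
    and "\<And>b. b \<in> underS \<kappa> a \<Longrightarrow> \<iota> b \<in> M \<and> Dom E (\<iota> b) = D b \<and> Cod E (\<iota> b) = Cod E i"
    and "\<And>b. b \<in> underS \<kappa> a \<Longrightarrow> \<iota> b \<cdot> z b = i"
    and "\<And>b c. b \<in> underS \<kappa> a \<Longrightarrow> c \<in> underS \<kappa> b \<Longrightarrow> \<iota> b \<cdot> d c b = \<iota> c"
    and "\<And>f g B. f \<in> M \<Longrightarrow> f \<in> hom E Z B \<Longrightarrow>
      (\<And>b. b \<in> underS \<kappa> a \<Longrightarrow> g b \<in> M \<and> g b \<in> hom E (D b) B \<and> g b \<cdot> z b = f \<and>
          (\<forall>c \<in> underS \<kappa> b. g b \<cdot> d c b = g c)) \<Longrightarrow>
      \<exists>u \<in> M. u \<in> hom E (Cod E i) B \<and> u \<cdot> i = f \<and> (\<forall>b \<in> underS \<kappa> a. u \<cdot> \<iota> b = g b)"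
    and "\<And>E' M' F. backdrop_preserving \<kappa> E M E' M' F \<Longrightarrow>
      cone_colimit \<kappa> (underS \<kappa> a) E' (\<lambda>b. amap F (z b)) (\<lambda>c b. amap F (d c b)) (amap F i)
        (\<lambda>b. amap F (\<iota> b))"
proof -
  define r where "r = one_plus (seg \<kappa> a)"
  \<comment> \<open>The new least element \<open>None\<close> of \<open>1 + \<alpha>\<close> carries
    \<open>Z\<close>, and the maps \<open>z b\<close> become chain maps out of it. The chain is
    therefore inhabited even when nothing lies below \<open>a\<close>.\<close>
  define D' where "D' j = (case j of None \<Rightarrow> Z | Some b \<Rightarrow> D b)" for j
  define d' where "d' j k = (case (j, k) of (Some c, Some b) \<Rightarrow> d c b | (None, Some b) \<Rightarrow> z b)" for j k
  have Field_r: "Field r = insert None (Some ` underS \<kappa> a)"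
    unfolding r_def Field_one_plus Field_seg ..
  have underS_r: "underS r None = {}"
    "b \<in> underS \<kappa> a \<Longrightarrow> underS r (Some b) = insert None (Some ` underS \<kappa> b)" for b
    unfolding r_def using underS_one_plus[where r = "seg \<kappa> a"] underS_seg[of b a]
    by (auto simp: Field_seg)
  have ZD: "D' None = Z" "D' (Some b) = D b" for b by (simp_all add: D'_def)
  have zd: "d' None (Some b) = z b" "d' (Some c) (Some b) = d c b" for b c
    by (simp_all add: d'_def)
  have D: "b \<in> underS \<kappa> a \<Longrightarrow> D b \<in> Obj E" for b using z[of b] Cod_in_Obj[of "z b"] by auto
  have r': "Partial_order r" unfolding r_def by (intro Partial_order_one_plus Partial_order_seg)
  have U: "\<exists>b \<in> underS \<kappa> a. k = Some b \<and> (j = None \<or> (\<exists>c \<in> underS \<kappa> b. j = Some c))"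
    if jk: "j \<in> underS r k" for j k
  proof -
    have "k \<in> Field r" using jk by (auto simp: underS_def Field_def)
    moreover have "k \<noteq> None" using jk underS_r(1) by (metis empty_iff)
    ultimately obtain b where "b \<in> underS \<kappa> a" "k = Some b" using Field_r by blast
    then show ?thesis using jk underS_r(2)[of b] by auto
  qed
  have obj: "D' j \<in> Obj E" if "j \<in> Field r" for j
    using that D Z unfolding Field_r by (auto simp: ZD)
  have arr: "d' j k \<in> M \<and> Dom E (d' j k) = D' j \<and> Cod E (d' j k) = D' k"
    if "j \<in> underS r k" for j k
    using U[OF that] z d by (auto simp: ZD zd)
  have comp: "d' k l \<cdot> d' j k = d' j l" if jk: "j \<in> underS r k" and kl: "k \<in> underS r l" for j k l
  proof -
    obtain b where b: "b \<in> underS \<kappa> a" "l = Some b" "k = None \<or> (\<exists>c \<in> underS \<kappa> b. k = Some c)"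
      using U[OF kl] by auto
    then obtain c where c: "c \<in> underS \<kappa> b" "k = Some c" using U[OF jk] by auto
    have "j = None \<or> (\<exists>e \<in> underS \<kappa> c. j = Some e)" using U[OF jk] c by auto
    then show ?thesis using b c dz dd by (auto simp: zd)
  qed
  have fam: "family r (subcat E M) D' d'" "family r E D' d'"
    "family_functor r (subcat E M) D' d' = family_functor r E D' d'"
    by (intro family_subcatI r' obj arr comp; assumption)+
  interpret S: family r "subcat E M" D' d' by (rule fam)
  have has: "has_colimits_in (poset_cat r) E M"
    using backdrop a unfolding backdrop_def r_def by blast
  then obtain X \<iota> where colim: "is_colimit (poset_cat r) (subcat E M) (family_functor r E D' d') X \<iota>"
    unfolding has_colimits_in_def using S.cat_functor_family unfolding fam(3) by blast
  have id: "comp_functor (poset_cat r) (id_functor (subcat E M)) (family_functor r E D' d')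
      = family_functor r E D' d'"
    using comp_functor_id(2)[OF S.cat_functor_family] unfolding fam(3) .
  have M: "X \<in> Obj E" "\<And>j. j \<in> Field r \<Longrightarrow> \<iota> j \<in> hom (subcat E M) (D' j) X"
    "\<And>i j. i \<in> underS r j \<Longrightarrow> \<iota> j \<cdot> d' i j = \<iota> i"
    "family_colimit r (subcat E M) d' X \<iota>"
    using S.is_colimit_family[of X \<iota>] colim unfolding fam(3) by auto
  \<comment> \<open>Preservation by the inclusion speaks of legs and vertex wrapped in the identity
    functor. The mediating property survives the unwrapping, since legs matter only on objects of
    the chain; the cocone property is checked directly.\<close>
  have colimE: "is_colimit (poset_cat r) E (family_functor r E D' d') X \<iota>"
  proof -
    have "is_colimit (poset_cat r) E (family_functor r E D' d')
        (omap (id_functor (subcat E M)) X) (\<lambda>j. amap (id_functor (subcat E M)) (\<iota> j))"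
      using has S.cat_functor_family colim
      unfolding has_colimits_in_def fam(3) preserves_colimit_def id by (metis id)
    moreover have "is_cocone (poset_cat r) E (family_functor r E D' d') X \<iota>"
      using M fam(2) by (subst family.is_cocone_family) auto
    ultimately show ?thesis
      using M unfolding is_colimit_def by (simp add: poset_cat_def)
  qed
  have Some_r: "None \<in> Field r" "\<And>b. b \<in> underS \<kappa> a \<Longrightarrow> Some b \<in> Field r"
    "\<And>b. b \<in> underS \<kappa> a \<Longrightarrow> None \<in> underS r (Some b)"
    "\<And>b c. b \<in> underS \<kappa> a \<Longrightarrow> c \<in> underS \<kappa> b \<Longrightarrow> Some c \<in> underS r (Some b)"
    using Field_r underS_r(2) by auto
  have \<iota>: "\<iota> None \<in> M" "Dom E (\<iota> None) = Z" "Cod E (\<iota> None) = X"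
    "b \<in> underS \<kappa> a \<Longrightarrow> \<iota> (Some b) \<in> M"
    "b \<in> underS \<kappa> a \<Longrightarrow> Dom E (\<iota> (Some b)) = D b"
    "b \<in> underS \<kappa> a \<Longrightarrow> Cod E (\<iota> (Some b)) = X" for b
    using M(2)[OF Some_r(1)] M(2)[OF Some_r(2)] by (auto simp: ZD)
  \<comment> \<open>The mediating map is taken inside \<open>subcat E M\<close>, which is what
    places it in \<open>M\<close>; the ambient colimit would only give a map of
    \<open>E\<close>.\<close>
  have lift: "\<exists>u \<in> M. u \<in> hom E X B \<and> u \<cdot> \<iota> None = f \<and> (\<forall>b \<in> underS \<kappa> a. u \<cdot> \<iota> (Some b) = g b)"
    if f: "f \<in> M" "f \<in> hom E Z B"
      and g: "\<And>b. b \<in> underS \<kappa> a \<Longrightarrow> g b \<in> M \<and> g b \<in> hom E (D b) B \<and> g b \<cdot> z b = f \<and>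
          (\<forall>c \<in> underS \<kappa> b. g b \<cdot> d c b = g c)" for f g B
  proof -
    define g' where "g' j = (case j of None \<Rightarrow> f | Some b \<Rightarrow> g b)" for j
    have "\<forall>j \<in> Field r. g' j \<in> hom (subcat E M) (Dom (subcat E M) (\<iota> j)) B \<and>
        (\<forall>i \<in> underS r j. g' j \<cdot>\<^bsub>subcat E M\<^esub> d' i j = g' i)"
      using f g \<iota> underS_r unfolding Field_r by (auto simp: g'_def zd)
    moreover have "B \<in> Obj (subcat E M)" using f Cod_in_Obj by auto
    ultimately have "\<exists>u \<in> hom (subcat E M) X B. \<forall>j \<in> Field r. u \<cdot>\<^bsub>subcat E M\<^esub> \<iota> j = g' j"
      using M(4) unfolding family_colimit_def by blast
    then obtain u where "u \<in> hom (subcat E M) X B" "\<forall>j \<in> Field r. u \<cdot> \<iota> j = g' j"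
      unfolding subcat_simps by blast
    then show ?thesis unfolding Field_r by (auto simp: g'_def)
  qed
  have univ: "cone_colimit \<kappa> (underS \<kappa> a) E' (\<lambda>b. amap F (z b)) (\<lambda>c b. amap F (d c b))
      (amap F (\<iota> None)) (\<lambda>b. amap F (\<iota> (Some b)))"
    if F: "backdrop_preserving \<kappa> E M E' M' F" for E' M' F
  proof -
    have FF: "cat_functor E E' F" and
      pres: "preserves_chain_colimits r E M E' F"
      using F a unfolding backdrop_preserving_def r_def by auto
    interpret F: cfunctor E E' F by standard fact
    \<comment> \<open>Preservation by \<open>F\<close> is assumed for chains in \<open>M\<close>
      only, so the diagram has to be presented as a functor into \<open>subcat E M\<close>.\<close>
    have pres': "preserves_colimit (poset_cat r) E E' F (family_functor r E D' d')"
      using pres S.cat_functor_family unfolding preserves_chain_colimits_def fam(3) by blast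
    have colimF: "family_colimit r E' (\<lambda>i j. amap F (d' i j)) (omap F X) (\<lambda>j. amap F (\<iota> j))"
      by (rule preserves_family_colimit[OF fam(2) FF colimE pres'])
    show ?thesis
      unfolding cone_colimit_def
    proof (intro conjI allI ballI impI)
      fix B f g
      assume fg: "f \<in> hom E' (Dom E' (amap F (\<iota> None))) B \<and>
        (\<forall>b \<in> underS \<kappa> a. g b \<in> hom E' (Dom E' (amap F (\<iota> (Some b)))) B \<and>
          g b \<cdot>\<^bsub>E'\<^esub> amap F (z b) = f \<and> (\<forall>c \<in> underS \<kappa> b. g b \<cdot>\<^bsub>E'\<^esub> amap F (d c b) = g c))"
      define g' where "g' j = (case j of None \<Rightarrow> f | Some b \<Rightarrow> g b)" for j
      have "\<forall>j \<in> Field r. g' j \<in> hom E' (Dom E' (amap F (\<iota> j))) B \<and>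
          (\<forall>i \<in> underS r j. g' j \<cdot>\<^bsub>E'\<^esub> amap F (d' i j) = g' i)"
        using fg underS_r unfolding Field_r by (auto simp: g'_def zd)
      moreover have "B \<in> Obj E'" using fg F.tgt.Cod_in_Obj by auto
      ultimately obtain u where u: "u \<in> hom E' (omap F X) B" "\<forall>j \<in> Field r. u \<cdot>\<^bsub>E'\<^esub> amap F (\<iota> j) = g' j"
        using colimF unfolding family_colimit_def by blast
      have "u \<cdot>\<^bsub>E'\<^esub> amap F (\<iota> None) = f" "\<forall>b\<in>underS \<kappa> a. u \<cdot>\<^bsub>E'\<^esub> amap F (\<iota> (Some b)) = g b"
        using u(2) unfolding Field_r by (auto simp: g'_def)
      moreover have "Cod E' (amap F (\<iota> None)) = omap F X" using \<iota> by simp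
      ultimately show "\<exists>u \<in> hom E' (Cod E' (amap F (\<iota> None))) B. u \<cdot>\<^bsub>E'\<^esub> amap F (\<iota> None) = f \<and>
          (\<forall>b\<in>underS \<kappa> a. u \<cdot>\<^bsub>E'\<^esub> amap F (\<iota> (Some b)) = g b)"
        using u(1) by metis
    next
      fix B u v
      assume "u \<in> hom E' (Cod E' (amap F (\<iota> None))) B" "v \<in> hom E' (Cod E' (amap F (\<iota> None))) B"
        "u \<cdot>\<^bsub>E'\<^esub> amap F (\<iota> None) = v \<cdot>\<^bsub>E'\<^esub> amap F (\<iota> None) \<and>
         (\<forall>b\<in>underS \<kappa> a. u \<cdot>\<^bsub>E'\<^esub> amap F (\<iota> (Some b)) = v \<cdot>\<^bsub>E'\<^esub> amap F (\<iota> (Some b)))"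
      moreover have "Cod E' (amap F (\<iota> None)) = omap F X" using \<iota> by simp
      ultimately have "u \<in> hom E' (omap F X) B" "v \<in> hom E' (omap F X) B"
        "\<forall>j \<in> Field r. u \<cdot>\<^bsub>E'\<^esub> amap F (\<iota> j) = v \<cdot>\<^bsub>E'\<^esub> amap F (\<iota> j)"
        unfolding Field_r by auto
      then show "u = v" using colimF unfolding family_colimit_def by blast
    qed
  qed
  have "\<iota> (Some b) \<cdot> z b = \<iota> None" if "b \<in> underS \<kappa> a" for b
    using M(3)[OF Some_r(3)[OF that]] by (simp add: zd)
  moreover have "\<iota> (Some b) \<cdot> d c b = \<iota> (Some c)" if "b \<in> underS \<kappa> a" "c \<in> underS \<kappa> b" for b c
    using M(3)[OF Some_r(4)[OF that]] by (simp add: zd)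
  ultimately show thesis
    using lift univ \<iota> by (intro that[of "\<iota> None" "\<lambda>b. \<iota> (Some b)"]) simp_all
qed

text \<open>For chains of full length a backdrop gives colimits in \<open>E\<close> only, so nothing
  is claimed about the legs lying in \<open>M\<close>. The property is stated for any functor
  preserving such colimits, because it is applied to the identity, to \<open>T\<close>, to a strong
  morphism \<open>F\<close>, and to \<open>F\<close> after \<open>T\<close>.\<close>

lemma long_colimit_exists:
  assumes D: "\<And>b. b \<in> Field \<kappa> \<Longrightarrow> D b \<in> Obj E"
    and d: "\<And>b c. c \<in> underS \<kappa> b \<Longrightarrow> d c b \<in> M \<and> Dom E (d c b) = D c \<and> Cod E (d c b) = D b"
    and dd: "\<And>b c e. c \<in> underS \<kappa> b \<Longrightarrow> e \<in> underS \<kappa> c \<Longrightarrow> d c b \<cdot> d e c = d e b"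
  obtains X \<iota> where "X \<in> Obj E" "\<And>b. b \<in> Field \<kappa> \<Longrightarrow> \<iota> b \<in> hom E (D b) X"
    and "\<And>b c. c \<in> underS \<kappa> b \<Longrightarrow> \<iota> b \<cdot> d c b = \<iota> c"
    and "\<And>(E' :: ('p, 'b) cat) F. cat_functor E E' F \<Longrightarrow> preserves_chain_colimits \<kappa> E M E' F \<Longrightarrow>
      family_colimit \<kappa> E' (\<lambda>c b. amap F (d c b)) (omap F X) (\<lambda>b. amap F (\<iota> b))"
proof -
  have fam: "family \<kappa> (subcat E M) D d" "family \<kappa> E D d"
    "family_functor \<kappa> (subcat E M) D d = family_functor \<kappa> E D d"
    by (intro family_subcatI Partial_order D d dd; assumption)+
  interpret S: family \<kappa> "subcat E M" D d by (rule fam)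
  interpret D: family \<kappa> E D d by (rule fam)
  obtain X \<iota> where colim: "is_colimit (poset_cat \<kappa>) E (family_functor \<kappa> E D d) X \<iota>"
    using backdrop S.cat_functor_family unfolding backdrop_def fam(3) by blast
  have "family_colimit \<kappa> E' (\<lambda>c b. amap F (d c b)) (omap F X) (\<lambda>b. amap F (\<iota> b))"
    if F: "cat_functor E E' F" "preserves_chain_colimits \<kappa> E M E' F" for E' :: "('p, 'b) cat" and F
    by (rule preserves_family_colimit[OF fam(2) F(1) colim])
      (use F(2) S.cat_functor_family in \<open>auto simp: preserves_chain_colimits_def fam(3)\<close>)
  then show thesis
    using D.is_colimit_family[OF colim] by (intro that)
qed

end


section \<open>Backdrop-preserving functors\<close>

text \<open>Maps of composite functors are restricted to actual arrows, so families of legs that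
  arise in two ways agree only on the objects of \<open>J\<close>.\<close>

lemma is_colimit_cong:
  assumes "category J" "\<And>j. j \<in> Obj J \<Longrightarrow> \<iota> j = \<iota>' j"
  shows "is_colimit J C D X \<iota> = is_colimit J C D X \<iota>'"
  using assms category.Dom_Obj[OF assms(1)] category.Cod_Obj[OF assms(1)]
  by (simp add: is_colimit_def is_cocone_def)

lemma (in category) cat_functor_subcat:
  assumes "cat_functor J (subcat C M) D" "wide_subcat C M"
  shows "cat_functor J C D"
proof -
  interpret D: cfunctor J "subcat C M" D by standard fact
  have "M \<subseteq> Arr C" using assms(2) unfolding wide_subcat_def by blast
  show ?thesis
    by (rule cat_functorI)
      (use D.extensional D.omap_Obj D.amap_arr D.amap_Idn D.amap_Cmp \<open>M \<subseteq> Arr C\<close> in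
        \<open>auto intro: D.src.category_axioms category_axioms\<close>)
qed

lemma preserves_colimit_id:
  assumes "cat_functor J C D"
  shows "preserves_colimit J C C (id_functor C) D"
  unfolding preserves_colimit_def comp_functor_id(2)[OF assms]
proof (intro allI impI)
  interpret D: cfunctor J C D by standard fact
  fix X \<iota> assume colim: "is_colimit J C D X \<iota>"
  then have "X \<in> Obj C" "\<And>j. j \<in> Obj J \<Longrightarrow> \<iota> j \<in> Arr C"
    unfolding is_colimit_def is_cocone_def by auto
  then show "is_colimit J C D (omap (id_functor C) X) (\<lambda>j. amap (id_functor C) (\<iota> j))"
    using colim is_colimit_cong[OF D.src.category_axioms, of \<iota> "\<lambda>j. amap (id_functor C) (\<iota> j)" C D X]
    by simp
qed

lemma preserves_colimit_comp:
  assumes "cat_functor J C D" "preserves_colimit J C C' F D"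
    and "preserves_colimit J C' C'' G (comp_functor J F D)" "cat_functor C C' F"
  shows "preserves_colimit J C C'' (comp_functor C G F) D"
  unfolding preserves_colimit_def
proof (intro allI impI)
  interpret D: cfunctor J C D by standard fact
  fix X \<iota> assume colim: "is_colimit J C D X \<iota>"
  then have 1: "X \<in> Obj C" "\<And>j. j \<in> Obj J \<Longrightarrow> \<iota> j \<in> Arr C"
    unfolding is_colimit_def is_cocone_def by auto
  have "is_colimit J C'' (comp_functor J G (comp_functor J F D)) (omap G (omap F X))
      (\<lambda>j. amap G (amap F (\<iota> j)))"
    using assms colim unfolding preserves_colimit_def by blast
  also have "?this \<longleftrightarrow> is_colimit J C'' (comp_functor J G (comp_functor J F D)) (omap G (omap F X))
      (\<lambda>j. amap (comp_functor C G F) (\<iota> j))"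
    by (rule is_colimit_cong[OF D.src.category_axioms]) (simp add: 1)
  finally show "is_colimit J C'' (comp_functor J (comp_functor C G F) D) (omap (comp_functor C G F) X)
      (\<lambda>j. amap (comp_functor C G F) (\<iota> j))"
    using 1 unfolding comp_functor_assoc[OF assms(1)] by simp
qed

lemma comp_functor_subcat:
  assumes "cat_functor J (subcat C M) D" "cat_functor C C' F"
    and "wide_subcat C M" "wide_subcat C' M'" "\<And>f. f \<in> M \<Longrightarrow> amap F f \<in> M'"
  shows "cat_functor J (subcat C' M') (comp_functor J F D)"
proof -
  interpret F: cfunctor C C' F by standard fact
  interpret D: cfunctor J "subcat C M" D by standard fact
  have M: "M \<subseteq> Arr C" using assms(3) unfolding wide_subcat_def by blast
  show ?thesis
  proof (rule cat_functorI)
    show "category J" by (rule D.src.category_axioms)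
    show "category (subcat C' M')" using F.tgt.category_subcat assms(4) .
  qed (use D.omap_Obj D.amap_arr D.amap_Idn D.amap_Cmp M assms(5) in
      \<open>auto simp: comp_functor_def subset_iff\<close>)
qed

text \<open>As \<open>F\<close> sends \<open>M\<close> into \<open>M'\<close>, the image of a chain
  is a chain in \<open>M'\<close>, to which the hypothesis on \<open>G\<close> applies. Besides
  composition of morphisms, this covers a strong morphism precomposed with \<open>T\<close>.\<close>

lemma preserves_chain_colimits_comp:
  assumes "preserves_chain_colimits r C M C' F" "preserves_chain_colimits r C' M' C'' G"
    and "cat_functor C C' F" "wide_subcat C M" "wide_subcat C' M'"
    and "\<And>f. f \<in> M \<Longrightarrow> amap F f \<in> M'"
  shows "preserves_chain_colimits r C M C'' (comp_functor C G F)"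
  unfolding preserves_chain_colimits_def
proof (intro allI impI)
  interpret F: cfunctor C C' F by standard fact
  fix D assume D: "cat_functor (poset_cat r) (subcat C M) D"
  show "preserves_colimit (poset_cat r) C C'' (comp_functor C G F) D"
  proof (rule preserves_colimit_comp)
    show "cat_functor (poset_cat r) C D" by (rule F.src.cat_functor_subcat) fact+
    show "preserves_colimit (poset_cat r) C C' F D"
      using assms(1) D unfolding preserves_chain_colimits_def by blast
    show "preserves_colimit (poset_cat r) C' C'' G (comp_functor (poset_cat r) F D)"
      using assms(2) comp_functor_subcat[OF D assms(3-6)]
      unfolding preserves_chain_colimits_def by blast
  qed fact
qed

lemma (in backdrop_cat) preserves_chain_colimits_id:
  "preserves_chain_colimits r E M E (id_functor E)"
  unfolding preserves_chain_colimits_def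
  using preserves_colimit_id cat_functor_subcat wide by blast

text \<open>Instantiates every universal property that is quantified over functors out of
  \<open>(E, M)\<close>, so that none has to be recorded separately for \<open>E\<close>. It is also
  the identity law of the category of configurations.\<close>

lemma (in backdrop_cat) backdrop_preserving_id: "backdrop_preserving \<kappa> E M E M (id_functor E)"
proof -
  have po: "is_pushout E (amap (id_functor E) f) (amap (id_functor E) g)
      (amap (id_functor E) p) (amap (id_functor E) q)" if "is_pushout E f g p q" for f g p q
    using that pushoutD(1-4)[OF that] by simp
  show ?thesis
    unfolding backdrop_preserving_def
    by (intro conjI ballI allI impI preserves_chain_colimits_id cat_functor_id category_axioms po)
      simp_all
qed

lemma backdrop_preserving_comp:
  assumes "backdrop_preserving \<kappa> E M E' M' F" "backdrop_preserving \<kappa> E' M' E'' M'' G"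
    and "wide_subcat E M" "wide_subcat E' M'"
  shows "backdrop_preserving \<kappa> E M E'' M'' (comp_functor E G F)"
proof -
  have F: "cat_functor E E' F" "\<And>f. f \<in> M \<Longrightarrow> amap F f \<in> M'"
    and G: "cat_functor E' E'' G" "\<And>f. f \<in> M' \<Longrightarrow> amap G f \<in> M''"
    using assms unfolding backdrop_preserving_def by blast+
  have M: "M \<subseteq> Arr E" using assms(3) unfolding wide_subcat_def by blast
  have "is_pushout E'' (amap (comp_functor E G F) f) (amap (comp_functor E G F) g)
      (amap (comp_functor E G F) p) (amap (comp_functor E G F) q)"
    if f: "f \<in> M" and po: "is_pushout E f g p q" for f g p q
  proof -
    have "is_pushout E' (amap F f) (amap F g) (amap F p) (amap F q)"
      using assms(1) f po unfolding backdrop_preserving_def by blast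
    then have "is_pushout E'' (amap G (amap F f)) (amap G (amap F g)) (amap G (amap F p))
        (amap G (amap F q))"
      using assms(2) F(2)[OF f] unfolding backdrop_preserving_def by blast
    then show ?thesis using pushoutD(1-4)[OF po] by simp
  qed
  moreover have "amap (comp_functor E G F) f \<in> M''" if "f \<in> M" for f
    using that F(2) G(2) M by (auto simp: subset_iff)
  ultimately show ?thesis
    using assms(1,2) cat_functor_comp[OF F(1) G(1)] unfolding backdrop_preserving_def
    by (intro conjI ballI allI impI preserves_chain_colimits_comp[OF _ _ F(1) assms(3,4) F(2)])
      blast+
qed


section \<open>Corners\<close>

text \<open>The universal property of \<open>X \<squnion> colim T X\<^sub>b\<close>, glued along \<open>colim X\<^sub>b\<close>: the maps
  \<open>j b : X\<^sub>b \<rightarrow> X\<close> and \<open>t b : X\<^sub>b \<rightarrow> T X\<^sub>b\<close> are glued, and \<open>d c b : T X\<^sub>c \<rightarrow> T X\<^sub>b\<close>.\<close>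

definition corner_colimit ::
  "'k rel \<Rightarrow> 'k set \<Rightarrow> ('o, 'a) cat \<Rightarrow> ('k \<Rightarrow> 'k \<Rightarrow> 'a) \<Rightarrow> ('k \<Rightarrow> 'a) \<Rightarrow> ('k \<Rightarrow> 'a) \<Rightarrow> 'a \<Rightarrow> ('k \<Rightarrow> 'a)
     \<Rightarrow> bool" where
  "corner_colimit \<kappa> I C d j t \<pi> \<rho> \<longleftrightarrow>
     (\<forall>B h k. h \<in> hom C (Dom C \<pi>) B \<and>
        (\<forall>b \<in> I. k b \<in> hom C (Dom C (\<rho> b)) B \<and> k b \<cdot>\<^bsub>C\<^esub> t b = h \<cdot>\<^bsub>C\<^esub> j b \<and>
          (\<forall>c \<in> underS \<kappa> b. k b \<cdot>\<^bsub>C\<^esub> d c b = k c)) \<longrightarrow>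
        (\<exists>u \<in> hom C (Cod C \<pi>) B. u \<cdot>\<^bsub>C\<^esub> \<pi> = h \<and> (\<forall>b \<in> I. u \<cdot>\<^bsub>C\<^esub> \<rho> b = k b))) \<and>
     (\<forall>B. \<forall>u \<in> hom C (Cod C \<pi>) B. \<forall>v \<in> hom C (Cod C \<pi>) B.
        u \<cdot>\<^bsub>C\<^esub> \<pi> = v \<cdot>\<^bsub>C\<^esub> \<pi> \<and> (\<forall>b \<in> I. u \<cdot>\<^bsub>C\<^esub> \<rho> b = v \<cdot>\<^bsub>C\<^esub> \<rho> b) \<longrightarrow> u = v)"

lemma corner_colimit_ex:
  assumes "corner_colimit \<kappa> I C d j t \<pi> \<rho>" "h \<in> hom C (Dom C \<pi>) B"
    and "\<And>b. b \<in> I \<Longrightarrow> k b \<in> hom C (Dom C (\<rho> b)) B"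
    and "\<And>b. b \<in> I \<Longrightarrow> k b \<cdot>\<^bsub>C\<^esub> t b = h \<cdot>\<^bsub>C\<^esub> j b"
    and "\<And>b c. b \<in> I \<Longrightarrow> c \<in> underS \<kappa> b \<Longrightarrow> k b \<cdot>\<^bsub>C\<^esub> d c b = k c"
  obtains u where "u \<in> hom C (Cod C \<pi>) B" "u \<cdot>\<^bsub>C\<^esub> \<pi> = h" "\<And>b. b \<in> I \<Longrightarrow> u \<cdot>\<^bsub>C\<^esub> \<rho> b = k b"
proof -
  have "\<exists>u \<in> hom C (Cod C \<pi>) B. u \<cdot>\<^bsub>C\<^esub> \<pi> = h \<and> (\<forall>b \<in> I. u \<cdot>\<^bsub>C\<^esub> \<rho> b = k b)"
    using assms unfolding corner_colimit_def by blast
  then show ?thesis using that by blast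
qed

lemma corner_colimit_eq:
  assumes "corner_colimit \<kappa> I C d j t \<pi> \<rho>" "u \<in> hom C (Cod C \<pi>) B" "v \<in> hom C (Cod C \<pi>) B"
    and "u \<cdot>\<^bsub>C\<^esub> \<pi> = v \<cdot>\<^bsub>C\<^esub> \<pi>" "\<And>b. b \<in> I \<Longrightarrow> u \<cdot>\<^bsub>C\<^esub> \<rho> b = v \<cdot>\<^bsub>C\<^esub> \<rho> b"
  shows "u = v"
  using assms unfolding corner_colimit_def by blast

lemma corner_colimit_cong:
  assumes "\<And>b c. b \<in> I \<Longrightarrow> c \<in> underS \<kappa> b \<Longrightarrow> d c b = d' c b" "\<And>b. b \<in> I \<Longrightarrow> j b = j' b"
    and "\<And>b. b \<in> I \<Longrightarrow> t b = t' b" "\<pi> = \<pi>'" "\<And>b. b \<in> I \<Longrightarrow> \<rho> b = \<rho>' b"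
  shows "corner_colimit \<kappa> I C d j t \<pi> \<rho> = corner_colimit \<kappa> I C d' j' t' \<pi>' \<rho>'"
  using assms by (simp add: corner_colimit_def)

text \<open>Colimits commute with colimits: by the pushouts, a map out of \<open>Cod (p b)\<close>
  is a pair of \<open>h\<close> and \<open>k b\<close>, and a compatible family of such pairs is a
  map out of their colimit. The category is arbitrary because the lemma is applied to the images of
  all these squares under a functor.\<close>

lemma (in category) corner_colimit_pushouts:
  assumes cone: "cone_colimit \<kappa> I C p n \<pi> \<iota>"
    and \<pi>: "\<pi> \<in> Arr C" and down: "\<And>b c. b \<in> I \<Longrightarrow> c \<in> underS \<kappa> b \<Longrightarrow> c \<in> I"
    and \<iota>: "\<And>b. b \<in> I \<Longrightarrow> \<iota> b \<in> hom C (Cod C (p b)) (Cod C \<pi>)"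
    and po: "\<And>b. b \<in> I \<Longrightarrow> is_pushout C (t b) (j b) (q b) (p b)"
    and Dom_p: "\<And>b. b \<in> I \<Longrightarrow> Dom C (p b) = Dom C \<pi>"
    and n: "\<And>b c. b \<in> I \<Longrightarrow> c \<in> underS \<kappa> b \<Longrightarrow> n c b \<in> hom C (Cod C (p c)) (Cod C (p b))"
    and d: "\<And>b c. b \<in> I \<Longrightarrow> c \<in> underS \<kappa> b \<Longrightarrow> d c b \<in> hom C (Cod C (t c)) (Cod C (t b))"
    and np: "\<And>b c. b \<in> I \<Longrightarrow> c \<in> underS \<kappa> b \<Longrightarrow> n c b \<cdot> p c = p b"
    and nq: "\<And>b c. b \<in> I \<Longrightarrow> c \<in> underS \<kappa> b \<Longrightarrow> n c b \<cdot> q c = q b \<cdot> d c b"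
    and \<iota>p: "\<And>b. b \<in> I \<Longrightarrow> \<iota> b \<cdot> p b = \<pi>"
  shows "corner_colimit \<kappa> I C d j t \<pi> (\<lambda>b. \<iota> b \<cdot> q b)"
  unfolding corner_colimit_def
proof (intro conjI allI ballI impI)
  note ty = \<pi> \<iota>[unfolded in_hom] n[unfolded in_hom] d[unfolded in_hom] Dom_p
  have pty: "t b \<in> Arr C" "j b \<in> Arr C" "q b \<in> Arr C" "p b \<in> Arr C" "Dom C (j b) = Dom C (t b)"
    "Dom C (q b) = Cod C (t b)" "Cod C (j b) = Dom C \<pi>" "Cod C (q b) = Cod C (p b)" if "b \<in> I" for b
    using pushoutD[OF po[OF that]] Dom_p[OF that] by auto
  {
    fix B h k
    assume asm: "h \<in> hom C (Dom C \<pi>) B \<and>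
      (\<forall>b \<in> I. k b \<in> hom C (Dom C (\<iota> b \<cdot> q b)) B \<and> k b \<cdot> t b = h \<cdot> j b \<and>
        (\<forall>c \<in> underS \<kappa> b. k b \<cdot> d c b = k c))"
    have h: "h \<in> Arr C" "Dom C h = Dom C \<pi>" "Cod C h = B" using asm by auto
    have k: "k b \<in> Arr C" "Dom C (k b) = Cod C (t b)" "Cod C (k b) = B" "k b \<cdot> t b = h \<cdot> j b"
      if "b \<in> I" for b using asm that ty pty by auto
    have kd: "k b \<cdot> d c b = k c" if "b \<in> I" "c \<in> underS \<kappa> b" for b c using asm that by auto
    have "\<exists>g \<in> hom C (Cod C (q b)) B. g \<cdot> q b = k b \<and> g \<cdot> p b = h" if b: "b \<in> I" for b
      by (rule pushout_ex[OF po[OF b], of "k b" B h]) (use k[OF b] h pty[OF b] in auto)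
    then obtain g where g: "\<And>b. b \<in> I \<Longrightarrow> g b \<in> Arr C" "\<And>b. b \<in> I \<Longrightarrow> Dom C (g b) = Cod C (p b)"
      "\<And>b. b \<in> I \<Longrightarrow> Cod C (g b) = B"
      and gq: "\<And>b. b \<in> I \<Longrightarrow> g b \<cdot> q b = k b" and gp: "\<And>b. b \<in> I \<Longrightarrow> g b \<cdot> p b = h"
      using pty by (simp add: hom_def) metis
    \<comment> \<open>Compared on the two legs of the pushout at \<open>c\<close>: along
      \<open>q c\<close> this is the compatibility of \<open>k\<close>, and along \<open>p c\<close>
      both sides are \<open>h\<close>.\<close>
    have gn: "g b \<cdot> n c b = g c" if b: "b \<in> I" and c: "c \<in> underS \<kappa> b" for b c
    proof (rule pushout_eq[OF po[OF down[OF b c]]])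
      note cI = down[OF b c]
      note ty' = ty(1) ty(2-4)[OF b] ty(2-4)[OF cI] n[OF b c, simplified] d[OF b c, simplified]
        pty[OF b] pty[OF cI] g[OF b] g[OF cI] Dom_p[OF b] Dom_p[OF cI]
      show "g b \<cdot> n c b \<in> hom C (Cod C (q c)) B" "g c \<in> hom C (Cod C (q c)) B"
        using ty' by simp_all
      have "(g b \<cdot> n c b) \<cdot> q c = g b \<cdot> (q b \<cdot> d c b)" using ty' nq[OF b c] by simp
      also have "\<dots> = k b \<cdot> d c b" using ty' by (simp add: reassoc[OF gq[OF b]])
      also have "\<dots> = g c \<cdot> q c" using kd[OF b c] gq[OF cI] by simp
      finally show "(g b \<cdot> n c b) \<cdot> q c = g c \<cdot> q c" .
      show "(g b \<cdot> n c b) \<cdot> p c = g c \<cdot> p c"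
        using ty' np[OF b c] gp[OF b] gp[OF cI] by simp
    qed
    obtain u where u: "u \<in> hom C (Cod C \<pi>) B" "u \<cdot> \<pi> = h" "\<And>b. b \<in> I \<Longrightarrow> u \<cdot> \<iota> b = g b"
    proof (rule cone_colimit_ex[OF cone, of h B g])
      show "h \<in> hom C (Dom C \<pi>) B" using h by simp
      show "g b \<in> hom C (Dom C (\<iota> b)) B" if "b \<in> I" for b using that g ty by simp
    qed (use gp gn in auto)
    have "u \<cdot> (\<iota> b \<cdot> q b) = k b" if "b \<in> I" for b
      using u(1) u(3)[OF that] gq[OF that] ty(2-4)[OF that] pty[OF that]
      by (simp add: reassoc[OF u(3)[OF that]] flip: assoc)
    then show "\<exists>u \<in> hom C (Cod C \<pi>) B. u \<cdot> \<pi> = h \<and> (\<forall>b \<in> I. u \<cdot> (\<iota> b \<cdot> q b) = k b)"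
      using u by blast
  }
  fix B u v
  assume u: "u \<in> hom C (Cod C \<pi>) B" and v: "v \<in> hom C (Cod C \<pi>) B"
    and uv: "u \<cdot> \<pi> = v \<cdot> \<pi> \<and> (\<forall>b \<in> I. u \<cdot> (\<iota> b \<cdot> q b) = v \<cdot> (\<iota> b \<cdot> q b))"
  show "u = v"
  proof (rule cone_colimit_eq[OF cone u v])
    show "u \<cdot> \<pi> = v \<cdot> \<pi>" using uv by blast
    fix b assume b: "b \<in> I"
    show "u \<cdot> \<iota> b = v \<cdot> \<iota> b"
    proof (rule pushout_eq[OF po[OF b], of _ B])
      show "u \<cdot> \<iota> b \<in> hom C (Cod C (q b)) B" "v \<cdot> \<iota> b \<in> hom C (Cod C (q b)) B"
        using u v ty(2-4)[OF b] pty[OF b] by simp_all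
      show "(u \<cdot> \<iota> b) \<cdot> q b = (v \<cdot> \<iota> b) \<cdot> q b" "(u \<cdot> \<iota> b) \<cdot> p b = (v \<cdot> \<iota> b) \<cdot> p b"
        using u v uv b ty(2-4)[OF b] pty[OF b] \<iota>p[OF b] by simp_all
    qed
  qed
qed

section \<open>Pointed endofunctors on a backdrop, and corners of chains\<close>

locale pointed_endo = category E for E :: "('o, 'a) cat" (structure) +
  fixes T :: "('o, 'a) ptd_endo"
  assumes ptd: "is_ptd_endo E T"
begin

abbreviation Tob ("T\<^sub>o") where "T\<^sub>o \<equiv> omap (endo T)"
abbreviation Tar ("T\<^sub>a") where "T\<^sub>a \<equiv> amap (endo T)"
abbreviation Tpt ("\<tau>") where "\<tau> \<equiv> point T"

sublocale T: cfunctor E E "endo T"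
  using ptd unfolding is_ptd_endo_def nat_trans_def by unfold_locales blast

lemma point_arr [simp]:
  assumes "A \<in> Obj E"
  shows "\<tau> A \<in> Arr E" "Dom E (\<tau> A) = A" "Cod E (\<tau> A) = T\<^sub>o A"
  using ptd assms unfolding is_ptd_endo_def nat_trans_def by auto

lemma point_nat: "\<lbrakk>f \<in> Arr E; Dom E f = A; Cod E f = B\<rbrakk> \<Longrightarrow> T\<^sub>a f \<cdot> \<tau> A = \<tau> B \<cdot> f"
  using ptd unfolding is_ptd_endo_def nat_trans_def by auto

end

locale configuration = backdrop_cat \<kappa> E M + pointed_endo E T
  for \<kappa> :: "'k rel" and E :: "('o, 'a) cat" (structure) and M :: "'a set"
    and T :: "('o, 'a) ptd_endo" +
  assumes point_M [simp]: "A \<in> Obj E \<Longrightarrow> point T A \<in> M"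
    and gap_M: "gap_maps_in E M T"
    and T_chains: "preserves_chain_colimits \<kappa> E M E (endo T)"
begin

text \<open>The condition on gap maps is phrased for pushouts with \<open>f\<close> first. Squares
  with the point first occur too, since corners are built from cobase changes of the point; a
  pushout may be read either way.\<close>

lemma gap_map_M:
  assumes "f \<in> M" "is_pushout E f (\<tau> (Dom E f)) p q \<or> is_pushout E (\<tau> (Dom E f)) f q p"
    and "u \<in> hom E (Cod E p) (T\<^sub>o (Cod E f))" "u \<cdot> p = \<tau> (Cod E f)" "u \<cdot> q = T\<^sub>a f"
  shows "u \<in> M"
proof -
  have "is_pushout E f (\<tau> (Dom E f)) p q"
  proof (cases "is_pushout E f (\<tau> (Dom E f)) p q")
    case False
    then have po: "is_pushout E (\<tau> (Dom E f)) f q p" using assms(2) by blast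
    have *: "Cod E q = Cod E p" using pushoutD[OF po] by simp
    have "\<exists>!w. w \<in> hom E (Cod E p) Y \<and> w \<cdot> p = h \<and> w \<cdot> q = k"
      if "h \<in> hom E (Cod E f) Y" "k \<in> hom E (Cod E (\<tau> (Dom E f))) Y" "h \<cdot> f = k \<cdot> \<tau> (Dom E f)"
      for Y h k
      using po that unfolding is_pushout_def * by metis
    then show ?thesis using pushoutD[OF po] unfolding is_pushout_def by metis
  qed
  then show ?thesis using gap_M assms unfolding gap_maps_in_def by blast
qed

text \<open>\<open>T f\<close> is the cobase change of \<open>f\<close> along the point, followed by
  the gap map of \<open>f\<close>; both are in \<open>M\<close>. Hence \<open>T\<close> maps chains
  in \<open>M\<close> to chains in \<open>M\<close>.\<close>

lemma Tar_M [simp]: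
  assumes "f \<in> M"
  shows "T\<^sub>a f \<in> M"
proof -
  have f: "f \<in> Arr E" using assms by simp
  then obtain p q where po: "is_pushout E f (\<tau> (Dom E f)) p q" "q \<in> M"
    using cobase_change[OF assms, of "\<tau> (Dom E f)"] by auto
  have "\<tau> (Cod E f) \<cdot> f = T\<^sub>a f \<cdot> \<tau> (Dom E f)" using point_nat[OF f] by simp
  then obtain u where u: "u \<in> hom E (Cod E p) (T\<^sub>o (Cod E f))" "u \<cdot> p = \<tau> (Cod E f)" "u \<cdot> q = T\<^sub>a f"
    using pushout_ex[OF po(1), of "\<tau> (Cod E f)" "T\<^sub>o (Cod E f)" "T\<^sub>a f"] f by auto
  have "u \<in> M" using gap_map_M[OF assms _ u] po(1) by blast
  then have "u \<cdot> q \<in> M" using po(2) u(1) pushoutD[OF po(1)] by (intro M_Cmp) simp_all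
  then show ?thesis using u(3) by simp
qed

text \<open>The corner object is \<open>Cod E \<pi>\<close>, with legs \<open>\<pi>\<close> from
  \<open>X a\<close> and \<open>\<rho> b\<close> from \<open>T (X b)\<close>, and \<open>m\<close>
  is its comparison with \<open>T (X a)\<close>. The universal property is demanded of the image
  under every backdrop-preserving \<open>F\<close>, as \<open>F\<close> is unknown when the corner
  is chosen. Target categories share the types of \<open>E\<close>, as they do for the morphisms of
  the theorem.\<close>

definition corner ::
  "'k \<Rightarrow> ('k \<Rightarrow> 'o) \<Rightarrow> ('k \<Rightarrow> 'k \<Rightarrow> 'a) \<Rightarrow> 'a \<Rightarrow> ('k \<Rightarrow> 'a) \<Rightarrow> 'a \<Rightarrow> bool" where
  "corner a X j \<pi> \<rho> m \<longleftrightarrow>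
     \<pi> \<in> Arr E \<and> Dom E \<pi> = X a \<and>
     m \<in> M \<and> Dom E m = Cod E \<pi> \<and> Cod E m = T\<^sub>o (X a) \<and> m \<cdot> \<pi> = \<tau> (X a) \<and>
     (\<forall>b \<in> underS \<kappa> a. \<rho> b \<in> hom E (T\<^sub>o (X b)) (Cod E \<pi>) \<and> \<rho> b \<cdot> \<tau> (X b) = \<pi> \<cdot> j b a \<and>
        m \<cdot> \<rho> b = T\<^sub>a (j b a) \<and> (\<forall>c \<in> underS \<kappa> b. \<rho> b \<cdot> T\<^sub>a (j c b) = \<rho> c)) \<and>
     (\<forall>(E' :: ('o, 'a) cat) M' F. backdrop_preserving \<kappa> E M E' M' F \<longrightarrow>
        corner_colimit \<kappa> (underS \<kappa> a) E' (\<lambda>c b. amap F (T\<^sub>a (j c b))) (\<lambda>b. amap F (j b a))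
          (\<lambda>b. amap F (\<tau> (X b))) (amap F \<pi>) (\<lambda>b. amap F (\<rho> b)))"

text \<open>A corner at \<open>a\<close> looks at the chain up to \<open>a\<close> only. This
  locality lets corners survive when a recursion overwrites the stage at \<open>a\<close> or changes
  nothing but later stages.\<close>

lemma corner_cong:
  assumes "\<And>b. b \<in> insert a (underS \<kappa> a) \<Longrightarrow> X b = X' b"
    and "\<And>b c. b \<in> insert a (underS \<kappa> a) \<Longrightarrow> c \<in> underS \<kappa> b \<Longrightarrow> j c b = j' c b"
  shows "corner a X j \<pi> \<rho> m = corner a X' j' \<pi> \<rho> m"
  unfolding corner_def
  using assms
  by (simp cong: conj_cong corner_colimit_cong)

lemma cornerD:
  assumes "corner a X j \<pi> \<rho> m"
  shows "\<pi> \<in> Arr E" "Dom E \<pi> = X a" "m \<in> M" "Dom E m = Cod E \<pi>" "Cod E m = T\<^sub>o (X a)"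
    "m \<cdot> \<pi> = \<tau> (X a)"
    "\<And>b. b \<in> underS \<kappa> a \<Longrightarrow> \<rho> b \<in> Arr E"
    "\<And>b. b \<in> underS \<kappa> a \<Longrightarrow> Dom E (\<rho> b) = T\<^sub>o (X b)"
    "\<And>b. b \<in> underS \<kappa> a \<Longrightarrow> Cod E (\<rho> b) = Cod E \<pi>"
    "\<And>b. b \<in> underS \<kappa> a \<Longrightarrow> \<rho> b \<cdot> \<tau> (X b) = \<pi> \<cdot> j b a"
    "\<And>b. b \<in> underS \<kappa> a \<Longrightarrow> m \<cdot> \<rho> b = T\<^sub>a (j b a)"
    "\<And>b c. b \<in> underS \<kappa> a \<Longrightarrow> c \<in> underS \<kappa> b \<Longrightarrow> \<rho> b \<cdot> T\<^sub>a (j c b) = \<rho> c"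
    "\<And>(E' :: ('o, 'a) cat) M' F. backdrop_preserving \<kappa> E M E' M' F \<Longrightarrow>
        corner_colimit \<kappa> (underS \<kappa> a) E' (\<lambda>c b. amap F (T\<^sub>a (j c b))) (\<lambda>b. amap F (j b a))
          (\<lambda>b. amap F (\<tau> (X b))) (amap F \<pi>) (\<lambda>b. amap F (\<rho> b))"
  using assms unfolding corner_def by (simp_all)

end


text \<open>A map out of a pushout is fixed by its two restrictions. Connecting maps between chosen
  pushouts therefore compose as soon as the maps \<open>d1\<close>, \<open>d2\<close>,
  \<open>d3\<close> between the remaining corners do, and no functorial choice of pushouts has to be
  made.\<close>

lemma (in category) pushout_maps_comp:
  assumes po: "is_pushout C t j q p"
    and n1: "n1 \<in> hom C (Cod C p) (Cod C p')" "n1 \<cdot> p = p'" "n1 \<cdot> q = q' \<cdot> d1"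
    and n2: "n2 \<in> hom C (Cod C p') (Cod C p'')" "n2 \<cdot> p' = p''" "n2 \<cdot> q' = q'' \<cdot> d2"
    and n3: "n3 \<in> hom C (Cod C p) (Cod C p'')" "n3 \<cdot> p = p''" "n3 \<cdot> q = q'' \<cdot> d3"
    and d: "d1 \<in> hom C D1 D2" "d2 \<in> hom C D2 D3" "d2 \<cdot> d1 = d3"
    and q: "q' \<in> hom C D2 (Cod C p')" "q'' \<in> hom C D3 (Cod C p'')"
  shows "n2 \<cdot> n1 = n3"
proof (rule pushout_eq[OF po])
  have ty: "n1 \<in> Arr C" "Dom C n1 = Cod C p" "Cod C n1 = Cod C p'"
    "n2 \<in> Arr C" "Dom C n2 = Cod C p'" "Cod C n2 = Cod C p''"
    "n3 \<in> Arr C" "Dom C n3 = Cod C p" "Cod C n3 = Cod C p''"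
    "d1 \<in> Arr C" "Dom C d1 = D1" "Cod C d1 = D2" "d2 \<in> Arr C" "Dom C d2 = D2" "Cod C d2 = D3"
    "q' \<in> Arr C" "Dom C q' = D2" "Cod C q' = Cod C p'"
    "q'' \<in> Arr C" "Dom C q'' = D3" "Cod C q'' = Cod C p''"
    "p \<in> Arr C" "q \<in> Arr C" "Cod C q = Cod C p"
    using n1 n2 n3 d q pushoutD[OF po] by auto
  show "n2 \<cdot> n1 \<in> hom C (Cod C q) (Cod C p'')" "n3 \<in> hom C (Cod C q) (Cod C p'')" using ty by simp_all
  show "(n2 \<cdot> n1) \<cdot> p = n3 \<cdot> p" using ty n1(2) n2(2) n3(2) by simp
  have "(n2 \<cdot> n1) \<cdot> q = n2 \<cdot> (q' \<cdot> d1)" using ty n1(3) by simp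
  also have "\<dots> = q'' \<cdot> (d2 \<cdot> d1)" using reassoc[OF n2(3), of d1] ty by simp
  finally show "(n2 \<cdot> n1) \<cdot> q = n3 \<cdot> q" using n3(3) d(3) by simp
qed

context configuration
begin

lemma corner_colimit_E:
  assumes "corner a X j \<pi> \<rho> m"
    and X: "\<And>b. b \<in> underS \<kappa> a \<Longrightarrow> X b \<in> Obj E"
    and j: "\<And>b. b \<in> underS \<kappa> a \<Longrightarrow> j b a \<in> Arr E"
    and jj: "\<And>b c. b \<in> underS \<kappa> a \<Longrightarrow> c \<in> underS \<kappa> b \<Longrightarrow> j c b \<in> Arr E"
  shows "corner_colimit \<kappa> (underS \<kappa> a) E (\<lambda>c b. T\<^sub>a (j c b)) (\<lambda>b. j b a) (\<lambda>b. \<tau> (X b)) \<pi> \<rho>"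
proof -
  have "corner_colimit \<kappa> (underS \<kappa> a) E (\<lambda>c b. amap (id_functor E) (T\<^sub>a (j c b)))
      (\<lambda>b. amap (id_functor E) (j b a)) (\<lambda>b. amap (id_functor E) (\<tau> (X b)))
      (amap (id_functor E) \<pi>) (\<lambda>b. amap (id_functor E) (\<rho> b))"
    using cornerD(13)[OF assms(1) backdrop_preserving_id] .
  then show ?thesis
    by (subst (asm) corner_colimit_cong) (use cornerD(1,7)[OF assms(1)] X j jj in auto)
qed

text \<open>As \<open>M\<close> need not contain the isomorphisms, the pushouts \<open>Q b\<close> of \<open>\<tau>\<close> and \<open>j b a\<close> have to be
  chosen recursively for the induced maps between them to be in \<open>M\<close>: \<open>Q b\<close> is the cobase change
  of \<open>m : P b \<rightarrow> T (X b)\<close> to the colimit of \<open>X a\<close> and the \<open>Q c\<close> for \<open>c < b\<close>.\<close>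

lemma cobase_change_chain:
  assumes a: "a \<in> Field \<kappa>"
    and X: "\<And>b. b \<in> insert a (underS \<kappa> a) \<Longrightarrow> X b \<in> Obj E"
    and j: "\<And>b c. b \<in> insert a (underS \<kappa> a) \<Longrightarrow> c \<in> underS \<kappa> b
      \<Longrightarrow> j c b \<in> M \<and> Dom E (j c b) = X c \<and> Cod E (j c b) = X b"
    and jj: "\<And>b c e. b \<in> insert a (underS \<kappa> a) \<Longrightarrow> c \<in> underS \<kappa> b \<Longrightarrow> e \<in> underS \<kappa> c
      \<Longrightarrow> j c b \<cdot> j e c = j e b"
    and cor: "\<And>b. b \<in> underS \<kappa> a \<Longrightarrow> \<exists>\<pi> \<rho> m. corner b X j \<pi> \<rho> m"
  shows "\<exists>p q n. \<forall>b \<in> underS \<kappa> a. p b \<in> M \<and> Dom E (p b) = X a \<and>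
      is_pushout E (\<tau> (X b)) (j b a) (q b) (p b) \<and>
      (\<forall>c \<in> underS \<kappa> b. n c b \<in> M \<and> n c b \<in> hom E (Cod E (p c)) (Cod E (p b)) \<and>
        n c b \<cdot> p c = p b \<and> n c b \<cdot> q c = q b \<cdot> T\<^sub>a (j c b))"
proof -
  \<comment> \<open>The recursion stores just the two legs of \<open>Q b\<close>, as the pair
    \<open>(p b, q b)\<close>. The connecting maps from earlier pushouts are asserted to exist in
    \<open>M\<close> and picked afterwards; the legs determine them.\<close>
  define P where "P f b r \<longleftrightarrow> (b \<in> underS \<kappa> a \<longrightarrow>
      fst r \<in> M \<and> Dom E (fst r) = X a \<and> is_pushout E (\<tau> (X b)) (j b a) (snd r) (fst r) \<and>
      (\<forall>c \<in> underS \<kappa> b. \<exists>n \<in> M. n \<in> hom E (Cod E (fst (f c))) (Cod E (fst r)) \<and>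
        n \<cdot> fst (f c) = fst r \<and> n \<cdot> snd (f c) = snd r \<cdot> T\<^sub>a (j c b)))" for f :: "'k \<Rightarrow> 'a \<times> 'a" and b r
  have "\<exists>f. \<forall>b. P f b (f b)"
  proof (rule dependent_wf_choice[OF wf_underS])
    show "P f b r = P g b r" if "\<And>c. (c, b) \<in> {(b, a). b \<in> underS \<kappa> a} \<Longrightarrow> f c = g c" for f g b r
      using that by (simp add: P_def)
    fix b f
    assume IH: "\<And>c. (c, b) \<in> {(b, a). b \<in> underS \<kappa> a} \<Longrightarrow> P f c (f c)"
    show "\<exists>r. P f b r"
    proof (cases "b \<in> underS \<kappa> a")
      case False
      then show ?thesis by (simp add: P_def)
    next
      case b: True
      define p where "p c = fst (f c)" for c
      define q where "q c = snd (f c)" for c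
      have below: "c \<in> underS \<kappa> a" "c \<in> insert a (underS \<kappa> a)" if "c \<in> underS \<kappa> b" for c
        using underS_trans[OF that b] by auto
      have ba: "b \<in> insert a (underS \<kappa> a)" using b by simp
      have p: "p c \<in> M" "Dom E (p c) = X a" "is_pushout E (\<tau> (X c)) (j c a) (q c) (p c)"
        and ex: "\<And>e. e \<in> underS \<kappa> c \<Longrightarrow> \<exists>n \<in> M. n \<in> hom E (Cod E (p e)) (Cod E (p c)) \<and>
          n \<cdot> p e = p c \<and> n \<cdot> q e = q c \<cdot> T\<^sub>a (j e c)" if "c \<in> underS \<kappa> b" for c
        using IH[of c] that below[OF that] by (auto simp: P_def p_def q_def)
      have "\<exists>n. \<forall>c \<in> underS \<kappa> b. \<forall>e \<in> underS \<kappa> c. n e c \<in> M \<and>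
          n e c \<in> hom E (Cod E (p e)) (Cod E (p c)) \<and>
          n e c \<cdot> p e = p c \<and> n e c \<cdot> q e = q c \<cdot> T\<^sub>a (j e c)"
        by (rule exI[of _ "\<lambda>e c. SOME n. n \<in> M \<and> n \<in> hom E (Cod E (p e)) (Cod E (p c)) \<and>
          n \<cdot> p e = p c \<and> n \<cdot> q e = q c \<cdot> T\<^sub>a (j e c)"], intro ballI, rule someI_ex)
          (use ex in blast)
      then obtain n where n': "\<And>c e. c \<in> underS \<kappa> b \<Longrightarrow> e \<in> underS \<kappa> c \<Longrightarrow> n e c \<in> M \<and>
          n e c \<in> hom E (Cod E (p e)) (Cod E (p c)) \<and>
          n e c \<cdot> p e = p c \<and> n e c \<cdot> q e = q c \<cdot> T\<^sub>a (j e c)" by blast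
      have n: "n e c \<in> M" "n e c \<in> Arr E" "Dom E (n e c) = Cod E (p e)" "Cod E (n e c) = Cod E (p c)"
        "n e c \<cdot> p e = p c" "n e c \<cdot> q e = q c \<cdot> T\<^sub>a (j e c)"
        if "c \<in> underS \<kappa> b" "e \<in> underS \<kappa> c" for c e using n'[OF that] by auto
      have pty: "p c \<in> Arr E" "q c \<in> Arr E" "Dom E (q c) = T\<^sub>o (X c)" "Cod E (q c) = Cod E (p c)"
        "q c \<cdot> \<tau> (X c) = p c \<cdot> j c a" if "c \<in> underS \<kappa> b" for c
        using pushoutD[OF p(3)[OF that]] X[OF below(2)[OF that]] by auto
      have j': "j e c \<in> Arr E" "Dom E (j e c) = X e" "Cod E (j e c) = X c"
        if "c \<in> insert a (underS \<kappa> a)" "e \<in> underS \<kappa> c" for e c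
        using j[OF that] by auto
      note jc = j'[OF below(2)] and ja = j'[OF insertI1, OF below(1)] and jba = j'[OF insertI1 b]
        and jb = j'[OF ba]
      note Xc = X[OF below(2)]
      have nn: "n c b' \<cdot> n e c = n e b'"
        if b': "b' \<in> underS \<kappa> b" and c: "c \<in> underS \<kappa> b'" and e: "e \<in> underS \<kappa> c" for b' c e
      proof -
        have cb: "c \<in> underS \<kappa> b" and eb: "e \<in> underS \<kappa> b" and eb': "e \<in> underS \<kappa> b'"
          using underS_trans b' c e by blast+
        note ty = n(2-6)[OF b' c] n(2-6)[OF cb e] n(2-6)[OF b' eb'] pty[OF b'] pty[OF cb] pty[OF eb]
          jc[OF b' c] jc[OF cb e] jc[OF b' eb'] Xc[OF b'] Xc[OF cb] Xc[OF eb]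
        show ?thesis
          by (rule pushout_maps_comp[OF p(3)[OF eb], where q' = "q c" and q'' = "q b'"])
            (use ty jj[OF below(2)[OF b'] c e] T.amap_Cmp[of "j e c" "j c b'"] in auto)
      qed
      obtain i \<iota> where i: "i \<in> M" "Dom E i = X a"
        and \<iota>': "\<And>c. c \<in> underS \<kappa> b \<Longrightarrow> \<iota> c \<in> M \<and> Dom E (\<iota> c) = Cod E (p c) \<and> Cod E (\<iota> c) = Cod E i"
        and \<iota>p: "\<And>c. c \<in> underS \<kappa> b \<Longrightarrow> \<iota> c \<cdot> p c = i"
        and \<iota>n: "\<And>c e. c \<in> underS \<kappa> b \<Longrightarrow> e \<in> underS \<kappa> c \<Longrightarrow> \<iota> c \<cdot> n e c = \<iota> e"
        and univ: "\<And>(E' :: ('o, 'a) cat) M' F. backdrop_preserving \<kappa> E M E' M' F \<Longrightarrow>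
          cone_colimit \<kappa> (underS \<kappa> b) E' (\<lambda>b. amap F (p b)) (\<lambda>c b. amap F (n c b)) (amap F i)
            (\<lambda>b. amap F (\<iota> b))"
      proof (rule cone_colimit_exists[of b "X a" p "\<lambda>c. Cod E (p c)" n])
        show "b \<in> Field \<kappa>" using underS_in_Field[OF b] by simp
      qed (use p X n nn in auto)
      have \<iota>: "\<iota> c \<in> M" "\<iota> c \<in> Arr E" "Dom E (\<iota> c) = Cod E (p c)" "Cod E (\<iota> c) = Cod E i"
        if "c \<in> underS \<kappa> b" for c using \<iota>'[OF that] by auto
      have iarr: "i \<in> Arr E" using i by simp
      have "cone_colimit \<kappa> (underS \<kappa> b) E (\<lambda>b. amap (id_functor E) (p b))
          (\<lambda>c b. amap (id_functor E) (n c b)) (amap (id_functor E) i)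
          (\<lambda>b. amap (id_functor E) (\<iota> b))"
        using univ[OF backdrop_preserving_id] .
      then have colim: "cone_colimit \<kappa> (underS \<kappa> b) E p n i \<iota>"
        by (subst (asm) cone_colimit_cong) (use underS_trans p n \<iota> i in auto)
      obtain \<pi> \<rho> m where c: "corner b X j \<pi> \<rho> m" using cor[OF b] by blast
      note cD = cornerD[OF c]
      have ccolim: "corner_colimit \<kappa> (underS \<kappa> b) E (\<lambda>c b. T\<^sub>a (j c b)) (\<lambda>c. j c b) (\<lambda>b. \<tau> (X b)) \<pi> \<rho>"
        by (rule corner_colimit_E[OF c]) (use Xc jb jc in auto)
      \<comment> \<open>The attaching map from the corner at \<open>b\<close> to the colimit of
        \<open>X a\<close> and the earlier \<open>Q c\<close>: on \<open>X b\<close> it passes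
        through \<open>X a\<close>, and on \<open>T (X c)\<close> through
        \<open>Q c\<close>.\<close>
      obtain s where s: "s \<in> hom E (Cod E \<pi>) (Cod E i)" "s \<cdot> \<pi> = i \<cdot> j b a"
        "\<And>c. c \<in> underS \<kappa> b \<Longrightarrow> s \<cdot> \<rho> c = \<iota> c \<cdot> q c"
      proof (rule corner_colimit_ex[OF ccolim, of "i \<cdot> j b a" "Cod E i" "\<lambda>c. \<iota> c \<cdot> q c"])
        show "i \<cdot> j b a \<in> hom E (Dom E \<pi>) (Cod E i)" using i iarr jba cD(2) by simp
        fix c assume c: "c \<in> underS \<kappa> b"
        note ty = \<iota>[OF c] pty[OF c] jba ja[OF c] jb[OF c] Xc[OF c] i iarr p(2)[OF c]
        show "\<iota> c \<cdot> q c \<in> hom E (Dom E (\<rho> c)) (Cod E i)" using ty cD(8)[OF c] by simp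
        have "(\<iota> c \<cdot> q c) \<cdot> \<tau> (X c) = (\<iota> c \<cdot> p c) \<cdot> j c a" using ty by simp
        also have "\<dots> = (i \<cdot> j b a) \<cdot> j c b"
          using ty jj[OF insertI1 b c] \<iota>p[OF c] by simp
        finally show "(\<iota> c \<cdot> q c) \<cdot> \<tau> (X c) = (i \<cdot> j b a) \<cdot> j c b" .
        fix e assume e: "e \<in> underS \<kappa> c"
        have eb: "e \<in> underS \<kappa> b" using underS_trans[OF e c] .
        have "(\<iota> c \<cdot> q c) \<cdot> T\<^sub>a (j e c) = \<iota> c \<cdot> (n e c \<cdot> q e)"
          using ty n(6)[OF c e] jc[OF c e] by simp
        also have "\<dots> = \<iota> e \<cdot> q e"
          using ty n(2-4)[OF c e] pty[OF eb] by (simp add: reassoc[OF \<iota>n[OF c e]])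
        finally show "(\<iota> c \<cdot> q c) \<cdot> T\<^sub>a (j e c) = \<iota> e \<cdot> q e" .
      qed blast
      obtain qb w where w: "is_pushout E m s qb w" "w \<in> M"
        using cobase_change[of m s] cD(3,4) s(1) by auto
      have mD: "m \<in> Arr E" "Dom E m = Cod E \<pi>" "Cod E m = T\<^sub>o (X b)" "m \<cdot> \<pi> = \<tau> (X b)"
        using cD by auto
      have wD: "qb \<in> Arr E" "w \<in> Arr E" "Dom E qb = T\<^sub>o (X b)" "Dom E w = Cod E i" "Cod E qb = Cod E w"
        "qb \<cdot> m = w \<cdot> s" using pushoutD[OF w(1)] mD s(1) by auto
      have sD: "s \<in> Arr E" "Dom E s = Cod E \<pi>" "Cod E s = Cod E i" using s(1) by auto
      note tyb = cD(1,2) mD wD sD iarr i(2) jba X[OF ba]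
      have sq: "qb \<cdot> \<tau> (X b) = (w \<cdot> i) \<cdot> j b a"
      proof -
        have "qb \<cdot> (m \<cdot> \<pi>) = (w \<cdot> s) \<cdot> \<pi>"
          by (rule reassoc[OF wD(6)]) (use tyb in simp_all)
        then show ?thesis using tyb s(2) by simp
      qed
      \<comment> \<open>The connecting map is \<open>w \<cdot> \<iota> c\<close>, a colimit leg in
        \<open>M\<close> followed by a cobase change of \<open>m\<close>. Membership in
        \<open>M\<close> is thus immediate from how \<open>Q b\<close> was chosen.\<close>
      have nb: "w \<cdot> \<iota> c \<in> M" "w \<cdot> \<iota> c \<in> hom E (Cod E (p c)) (Cod E w)" "(w \<cdot> \<iota> c) \<cdot> p c = w \<cdot> i"
        "(w \<cdot> \<iota> c) \<cdot> q c = qb \<cdot> T\<^sub>a (j c b)" if c: "c \<in> underS \<kappa> b" for c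
      proof -
        note ty = \<iota>[OF c] pty[OF c] jb[OF c] Xc[OF c]
        show "w \<cdot> \<iota> c \<in> M" "w \<cdot> \<iota> c \<in> hom E (Cod E (p c)) (Cod E w)" "(w \<cdot> \<iota> c) \<cdot> p c = w \<cdot> i"
          using ty w(2) tyb \<iota>p[OF c] by simp_all
        have "(w \<cdot> \<iota> c) \<cdot> q c = (w \<cdot> s) \<cdot> \<rho> c"
          using ty tyb s(3)[OF c] cD(7-9)[OF c] by simp
        also have "\<dots> = qb \<cdot> (m \<cdot> \<rho> c)"
          using reassoc[OF wD(6), of "\<rho> c"] ty tyb cD(7-9)[OF c] by simp
        finally show "(w \<cdot> \<iota> c) \<cdot> q c = qb \<cdot> T\<^sub>a (j c b)" using cD(11)[OF c] by simp
      qed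
      have "is_pushout E (\<tau> (X b)) (j b a) qb (w \<cdot> i)"
        unfolding is_pushout_def
      proof (intro conjI allI ballI impI)
        fix B k h
        assume k: "k \<in> hom E (Cod E (\<tau> (X b))) B" and h: "h \<in> hom E (Cod E (j b a)) B"
          and kh: "k \<cdot> \<tau> (X b) = h \<cdot> j b a"
        have kD: "k \<in> Arr E" "Dom E k = T\<^sub>o (X b)" "Cod E k = B" using k X[OF ba] by auto
        have hD: "h \<in> Arr E" "Dom E h = X a" "Cod E h = B" using h jba by auto
        \<comment> \<open>It remains to see that the staged construction is a pushout of the point
          and \<open>j b a\<close>. A cocone on that span restricts along \<open>T (j c b)\<close>
          to one on each earlier span, giving maps out of the \<open>Q c\<close>, then out of their
          colimit, and finally out of \<open>Q b\<close>.\<close>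
        have "\<exists>g \<in> hom E (Cod E (p c)) B. g \<cdot> q c = k \<cdot> T\<^sub>a (j c b) \<and> g \<cdot> p c = h"
          if c: "c \<in> underS \<kappa> b" for c
        proof (rule pushout_ex[OF p(3)[OF c], of "k \<cdot> T\<^sub>a (j c b)" B h])
          note ty = pty[OF c] jb[OF c] Xc[OF c] ja[OF c] jba kD hD
          show "k \<cdot> T\<^sub>a (j c b) \<in> hom E (Cod E (\<tau> (X c))) B" "h \<in> hom E (Cod E (j c a)) B"
            using ty by simp_all
          have "(k \<cdot> T\<^sub>a (j c b)) \<cdot> \<tau> (X c) = (k \<cdot> \<tau> (X b)) \<cdot> j c b"
            using ty point_nat[OF jb[OF c]] X[OF ba] by simp
          also have "\<dots> = h \<cdot> (j b a \<cdot> j c b)" using ty unfolding kh by simp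
          finally show "(k \<cdot> T\<^sub>a (j c b)) \<cdot> \<tau> (X c) = h \<cdot> j c a"
            using jj[OF insertI1 b c] by simp
        qed (use pty[OF c] in auto)
        then obtain g where g': "\<And>c. c \<in> underS \<kappa> b \<Longrightarrow> g c \<in> hom E (Cod E (p c)) B \<and>
            g c \<cdot> q c = k \<cdot> T\<^sub>a (j c b) \<and> g c \<cdot> p c = h" by metis
        have g: "g c \<in> Arr E" "Dom E (g c) = Cod E (p c)" "Cod E (g c) = B"
          "g c \<cdot> q c = k \<cdot> T\<^sub>a (j c b)" "g c \<cdot> p c = h" if "c \<in> underS \<kappa> b" for c
          using g'[OF that] by auto
        have g_unique: "g' = g c" if c: "c \<in> underS \<kappa> b" and g': "g' \<in> hom E (Cod E (p c)) B"
            "g' \<cdot> q c = k \<cdot> T\<^sub>a (j c b)" "g' \<cdot> p c = h" for c g'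
          by (rule pushout_eq[OF p(3)[OF c], of _ B]) (use g[OF c] g' pty[OF c] in auto)
        obtain v where v: "v \<in> hom E (Cod E i) B" "v \<cdot> i = h"
          "\<And>c. c \<in> underS \<kappa> b \<Longrightarrow> v \<cdot> \<iota> c = g c"
        proof (rule cone_colimit_ex[OF colim, of h B g])
          show "h \<in> hom E (Dom E i) B" using hD i by simp
          fix c assume c: "c \<in> underS \<kappa> b"
          show "g c \<in> hom E (Dom E (\<iota> c)) B" "g c \<cdot> p c = h" using g[OF c] \<iota>[OF c] by simp_all
          fix e assume e: "e \<in> underS \<kappa> c"
          have eb: "e \<in> underS \<kappa> b" using underS_trans[OF e c] .
          note ty = g[OF c] pty[OF c] pty[OF eb] n(2-5)[OF c e] jc[OF c e] jb[OF c] jb[OF eb] kD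
          show "g c \<cdot> n e c = g e"
          proof (rule g_unique[OF eb])
            show "g c \<cdot> n e c \<in> hom E (Cod E (p e)) B" "(g c \<cdot> n e c) \<cdot> p e = h" using ty by simp_all
            have "(g c \<cdot> n e c) \<cdot> q e = (g c \<cdot> q c) \<cdot> T\<^sub>a (j e c)"
              using ty(1-3,5-) n(6)[OF c e] by simp
            also have "\<dots> = k \<cdot> T\<^sub>a (j c b \<cdot> j e c)" using ty by simp
            finally show "(g c \<cdot> n e c) \<cdot> q e = k \<cdot> T\<^sub>a (j e b)"
              using jj[OF ba c e] by simp
          qed
        qed blast
        have vD: "v \<in> Arr E" "Dom E v = Cod E i" "Cod E v = B" using v(1) by auto
        \<comment> \<open>This equation allows \<open>k\<close> and \<open>v\<close> to be glued
          along \<open>m\<close> and \<open>s\<close>. It is tested on the legs of the corner at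
          \<open>b\<close>, which is where the universal property of earlier corners enters.\<close>
        have vs: "v \<cdot> s = k \<cdot> m"
        proof (rule corner_colimit_eq[OF ccolim, of _ B])
          show "v \<cdot> s \<in> hom E (Cod E \<pi>) B" "k \<cdot> m \<in> hom E (Cod E \<pi>) B"
            using vD kD tyb by simp_all
          have "(v \<cdot> s) \<cdot> \<pi> = (v \<cdot> i) \<cdot> j b a" using vD tyb s(2) by simp
          then show "(v \<cdot> s) \<cdot> \<pi> = (k \<cdot> m) \<cdot> \<pi>" using vD kD tyb v(2) kh by simp
          fix c assume c: "c \<in> underS \<kappa> b"
          have "(v \<cdot> s) \<cdot> \<rho> c = (v \<cdot> \<iota> c) \<cdot> q c"
            using vD tyb s(3)[OF c] cD(7-9)[OF c] \<iota>[OF c] pty[OF c] by simp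
          also have "\<dots> = k \<cdot> (m \<cdot> \<rho> c)" using v(3)[OF c] g(4)[OF c] cD(11)[OF c] by simp
          finally show "(v \<cdot> s) \<cdot> \<rho> c = (k \<cdot> m) \<cdot> \<rho> c"
            using kD tyb cD(7-9)[OF c] by simp
        qed
        obtain u where u: "u \<in> hom E (Cod E qb) B" "u \<cdot> qb = k" "u \<cdot> w = v"
          using pushout_ex[OF w(1), of k B v] kD vD tyb vs by auto
        have uD: "u \<in> Arr E" "Dom E u = Cod E w" "Cod E u = B" using u(1) wD by auto
        show "\<exists>!u. u \<in> hom E (Cod E qb) B \<and> u \<cdot> qb = k \<and> u \<cdot> (w \<cdot> i) = h"
        proof (intro ex1I conjI)
          show "u \<in> hom E (Cod E qb) B" "u \<cdot> qb = k" by fact+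
          show "u \<cdot> (w \<cdot> i) = h" using u(3) v(2) uD tyb by (simp add: reassoc[OF u(3)])
          fix u' assume u': "u' \<in> hom E (Cod E qb) B \<and> u' \<cdot> qb = k \<and> u' \<cdot> (w \<cdot> i) = h"
          then have u'D: "u' \<in> Arr E" "Dom E u' = Cod E w" "Cod E u' = B" using wD by auto
          show "u' = u"
          proof (rule pushout_eq[OF w(1), of _ B])
            show "u' \<in> hom E (Cod E qb) B" "u \<in> hom E (Cod E qb) B" "u' \<cdot> qb = u \<cdot> qb"
              using u u' by auto
            show "u' \<cdot> w = u \<cdot> w"
              unfolding u(3)
            \<comment> \<open>A competing map is pinned down on each earlier \<open>Q c\<close> by
              its restrictions to \<open>X a\<close> and \<open>T (X c)\<close>, hence on their
              colimit.\<close>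
            proof (rule cone_colimit_eq[OF colim, of _ B])
              show "u' \<cdot> w \<in> hom E (Cod E i) B" "v \<in> hom E (Cod E i) B"
                using u'D wD vD by simp_all
              show "(u' \<cdot> w) \<cdot> i = v \<cdot> i" using u' u'D tyb v(2) by simp
              fix c assume c: "c \<in> underS \<kappa> b"
              note ty = \<iota>[OF c] pty[OF c] jb[OF c] Xc[OF c] u'D tyb
              have "u' \<cdot> (w \<cdot> \<iota> c) = g c"
              proof (rule g_unique[OF c])
                show "u' \<cdot> (w \<cdot> \<iota> c) \<in> hom E (Cod E (p c)) B" using ty by simp
                have "(u' \<cdot> (w \<cdot> \<iota> c)) \<cdot> q c = u' \<cdot> (qb \<cdot> T\<^sub>a (j c b))"
                  using ty nb(4)[OF c] by simp
                also have "\<dots> = (u' \<cdot> qb) \<cdot> T\<^sub>a (j c b)" using ty by simp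
                finally show "(u' \<cdot> (w \<cdot> \<iota> c)) \<cdot> q c = k \<cdot> T\<^sub>a (j c b)" using u' by simp
                show "(u' \<cdot> (w \<cdot> \<iota> c)) \<cdot> p c = h" using ty nb(3)[OF c] u' by simp
              qed
              then show "(u' \<cdot> w) \<cdot> \<iota> c = v \<cdot> \<iota> c" using ty v(3)[OF c] by simp
            qed
          qed
        qed
      qed (use tyb sq in simp_all)
      then have "P f b (w \<cdot> i, qb)"
        unfolding P_def using nb w(2) i tyb by (auto simp flip: p_def q_def intro!: bexI[of _ "w \<cdot> \<iota> _"])
      then show ?thesis by blast
    qed
  qed
  then obtain f where f: "\<And>b. P f b (f b)" by blast
  define n where "n c b = (SOME n. n \<in> M \<and> n \<in> hom E (Cod E (fst (f c))) (Cod E (fst (f b))) \<and>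
    n \<cdot> fst (f c) = fst (f b) \<and> n \<cdot> snd (f c) = snd (f b) \<cdot> T\<^sub>a (j c b))" for b c
  have "n c b \<in> M \<and> n c b \<in> hom E (Cod E (fst (f c))) (Cod E (fst (f b))) \<and>
      n c b \<cdot> fst (f c) = fst (f b) \<and> n c b \<cdot> snd (f c) = snd (f b) \<cdot> T\<^sub>a (j c b)"
    if "b \<in> underS \<kappa> a" "c \<in> underS \<kappa> b" for b c
    unfolding n_def by (rule someI_ex) (use f[of b] that in \<open>unfold P_def, blast\<close>)
  then show ?thesis
    using f unfolding P_def
    by (intro exI[of _ "\<lambda>b. fst (f b)"] exI[of _ "\<lambda>b. snd (f b)"] exI[of _ n]) blast
qed

lemma corner_exists:
  assumes a: "a \<in> Field \<kappa>"
    and X: "\<And>b. b \<in> insert a (underS \<kappa> a) \<Longrightarrow> X b \<in> Obj E"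
    and j: "\<And>b c. b \<in> insert a (underS \<kappa> a) \<Longrightarrow> c \<in> underS \<kappa> b
      \<Longrightarrow> j c b \<in> M \<and> Dom E (j c b) = X c \<and> Cod E (j c b) = X b"
    and jj: "\<And>b c e. b \<in> insert a (underS \<kappa> a) \<Longrightarrow> c \<in> underS \<kappa> b \<Longrightarrow> e \<in> underS \<kappa> c
      \<Longrightarrow> j c b \<cdot> j e c = j e b"
    and cor: "\<And>b. b \<in> underS \<kappa> a \<Longrightarrow> \<exists>\<pi> \<rho> m. corner b X j \<pi> \<rho> m"
  shows "\<exists>\<pi> \<rho> m. corner a X j \<pi> \<rho> m"
proof -
  have Xa: "X a \<in> Obj E" using X by simp
  have Xb: "X b \<in> Obj E" if "b \<in> underS \<kappa> a" for b using X that by simp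
  have below: "c \<in> underS \<kappa> a" if "b \<in> underS \<kappa> a" "c \<in> underS \<kappa> b" for b c
    using underS_trans that by blast
  have ja: "j b a \<in> M" "j b a \<in> Arr E" "Dom E (j b a) = X b" "Cod E (j b a) = X a"
    if "b \<in> underS \<kappa> a" for b using j[of a b] that by auto
  have jb: "j c b \<in> Arr E" "Dom E (j c b) = X c" "Cod E (j c b) = X b"
    if "b \<in> underS \<kappa> a" "c \<in> underS \<kappa> b" for b c using j[of b c] that by auto
  have "\<exists>p q n. \<forall>b \<in> underS \<kappa> a. p b \<in> M \<and> Dom E (p b) = X a \<and>
      is_pushout E (\<tau> (X b)) (j b a) (q b) (p b) \<and>
      (\<forall>c \<in> underS \<kappa> b. n c b \<in> M \<and> n c b \<in> hom E (Cod E (p c)) (Cod E (p b)) \<and>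
        n c b \<cdot> p c = p b \<and> n c b \<cdot> q c = q b \<cdot> T\<^sub>a (j c b))"
    by (rule cobase_change_chain[OF a X j jj cor])
  then obtain p q n where p': "\<And>b. b \<in> underS \<kappa> a \<Longrightarrow> p b \<in> M \<and> Dom E (p b) = X a"
    and po: "\<And>b. b \<in> underS \<kappa> a \<Longrightarrow> is_pushout E (\<tau> (X b)) (j b a) (q b) (p b)"
    and n': "\<And>b c. b \<in> underS \<kappa> a \<Longrightarrow> c \<in> underS \<kappa> b \<Longrightarrow>
      n c b \<in> M \<and> n c b \<in> hom E (Cod E (p c)) (Cod E (p b)) \<and>
      n c b \<cdot> p c = p b \<and> n c b \<cdot> q c = q b \<cdot> T\<^sub>a (j c b)" by blast
  have pty: "p b \<in> M" "p b \<in> Arr E" "Dom E (p b) = X a" "q b \<in> Arr E" "Dom E (q b) = T\<^sub>o (X b)"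
    "Cod E (q b) = Cod E (p b)" and sq: "q b \<cdot> \<tau> (X b) = p b \<cdot> j b a" if "b \<in> underS \<kappa> a" for b
    using p'[OF that] pushoutD[OF po[OF that]] Xb[OF that] by auto
  have n: "n c b \<in> M" "n c b \<in> Arr E" "Dom E (n c b) = Cod E (p c)" "Cod E (n c b) = Cod E (p b)"
    and np: "n c b \<cdot> p c = p b" and nq: "n c b \<cdot> q c = q b \<cdot> T\<^sub>a (j c b)"
    if "b \<in> underS \<kappa> a" "c \<in> underS \<kappa> b" for b c using n'[OF that] by auto
  have nn: "n c b \<cdot> n e c = n e b"
    if b: "b \<in> underS \<kappa> a" and c: "c \<in> underS \<kappa> b" and e: "e \<in> underS \<kappa> c" for b c e
  proof -
    note ca = below[OF b c]
    note ea = below[OF ca e] and eb = underS_trans[OF e c]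
    show ?thesis
      by (rule pushout_maps_comp[OF po[OF ea], where q' = "q c" and q'' = "q b"])
        (use jj[of b c e] b c e n[OF b c] n[OF ca e] n[OF b eb] np[OF b c] np[OF ca e] np[OF b eb]
          nq[OF b c] nq[OF ca e] nq[OF b eb] pty[OF b] pty[OF ca] jb[OF b c] jb[OF ca e]
          T.amap_Cmp[of "j e c" "j c b"] in auto)
  qed
  obtain i \<iota> where i: "i \<in> M" "Dom E i = X a"
    and \<iota>': "\<And>c. c \<in> underS \<kappa> a \<Longrightarrow> \<iota> c \<in> M \<and> Dom E (\<iota> c) = Cod E (p c) \<and> Cod E (\<iota> c) = Cod E i"
    and \<iota>p: "\<And>c. c \<in> underS \<kappa> a \<Longrightarrow> \<iota> c \<cdot> p c = i"
    and \<iota>n: "\<And>c e. c \<in> underS \<kappa> a \<Longrightarrow> e \<in> underS \<kappa> c \<Longrightarrow> \<iota> c \<cdot> n e c = \<iota> e"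
    and lift: "\<And>f g B. f \<in> M \<Longrightarrow> f \<in> hom E (X a) B \<Longrightarrow>
      (\<And>b. b \<in> underS \<kappa> a \<Longrightarrow> g b \<in> M \<and> g b \<in> hom E (Cod E (p b)) B \<and> g b \<cdot> p b = f \<and>
          (\<forall>c \<in> underS \<kappa> b. g b \<cdot> n c b = g c)) \<Longrightarrow>
      \<exists>u \<in> M. u \<in> hom E (Cod E i) B \<and> u \<cdot> i = f \<and> (\<forall>b \<in> underS \<kappa> a. u \<cdot> \<iota> b = g b)"
    and univ: "\<And>(E' :: ('o, 'a) cat) M' F. backdrop_preserving \<kappa> E M E' M' F \<Longrightarrow>
      cone_colimit \<kappa> (underS \<kappa> a) E' (\<lambda>b. amap F (p b)) (\<lambda>c b. amap F (n c b)) (amap F i)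
        (\<lambda>b. amap F (\<iota> b))"
    by (rule cone_colimit_exists[of a "X a" p "\<lambda>c. Cod E (p c)" n])
      (use a X pty n np nn in auto)
  have \<iota>: "\<iota> c \<in> Arr E" "Dom E (\<iota> c) = Cod E (p c)" "Cod E (\<iota> c) = Cod E i"
    if "c \<in> underS \<kappa> a" for c using \<iota>'[OF that] by auto
  have iarr: "i \<in> Arr E" using i by simp
  have "\<exists>u \<in> hom E (Cod E (q b)) (T\<^sub>o (X a)). u \<cdot> q b = T\<^sub>a (j b a) \<and> u \<cdot> p b = \<tau> (X a)"
    if b: "b \<in> underS \<kappa> a" for b
    by (rule pushout_ex[OF po[OF b], of "T\<^sub>a (j b a)" "T\<^sub>o (X a)" "\<tau> (X a)"])
      (use ja[OF b] Xa Xb[OF b] point_nat[OF ja(2-4)[OF b]] in auto)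
  then obtain g where g': "\<And>b. b \<in> underS \<kappa> a \<Longrightarrow> g b \<in> hom E (Cod E (q b)) (T\<^sub>o (X a)) \<and>
      g b \<cdot> q b = T\<^sub>a (j b a) \<and> g b \<cdot> p b = \<tau> (X a)" by metis
  have g: "g b \<in> Arr E" "Dom E (g b) = Cod E (p b)" "Cod E (g b) = T\<^sub>o (X a)"
    and gq: "g b \<cdot> q b = T\<^sub>a (j b a)" and gp: "g b \<cdot> p b = \<tau> (X a)"
    if "b \<in> underS \<kappa> a" for b using g'[OF that] pty[OF that] by auto
  have gM: "g b \<in> M" if b: "b \<in> underS \<kappa> a" for b
    by (rule gap_map_M[of "j b a" "p b" "q b"]) (use ja[OF b] po[OF b] g[OF b] gq[OF b] gp[OF b] in auto)
  have gn: "g b \<cdot> n c b = g c" if b: "b \<in> underS \<kappa> a" and c: "c \<in> underS \<kappa> b" for b c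
  proof (rule pushout_eq[OF po[OF below[OF b c]]])
    note ca = below[OF b c]
    note ty = g[OF b] g[OF ca] n[OF b c] pty[OF b] pty[OF ca] jb[OF b c] ja[OF b] ja[OF ca]
    show "g b \<cdot> n c b \<in> hom E (Cod E (q c)) (T\<^sub>o (X a))" "g c \<in> hom E (Cod E (q c)) (T\<^sub>o (X a))"
      using ty by simp_all
    show "(g b \<cdot> n c b) \<cdot> p c = g c \<cdot> p c" using ty np[OF b c] gp[OF b] gp[OF ca] by simp
    have "(g b \<cdot> n c b) \<cdot> q c = g b \<cdot> (q b \<cdot> T\<^sub>a (j c b))" using ty nq[OF b c] by simp
    also have "\<dots> = T\<^sub>a (j b a \<cdot> j c b)" using ty reassoc[OF gq[OF b], of "T\<^sub>a (j c b)"] by simp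
    also have "\<dots> = g c \<cdot> q c" using jj[of a b c] b c gq[OF ca] by simp
    finally show "(g b \<cdot> n c b) \<cdot> q c = g c \<cdot> q c" .
  qed
  have "\<exists>u \<in> M. u \<in> hom E (Cod E i) (T\<^sub>o (X a)) \<and> u \<cdot> i = \<tau> (X a) \<and> (\<forall>b \<in> underS \<kappa> a. u \<cdot> \<iota> b = g b)"
    by (rule lift) (use Xa g gM gp gn in auto)
  then obtain m where m: "m \<in> M" "m \<in> hom E (Cod E i) (T\<^sub>o (X a))" "m \<cdot> i = \<tau> (X a)"
    and m\<iota>: "\<And>b. b \<in> underS \<kappa> a \<Longrightarrow> m \<cdot> \<iota> b = g b" by blast
  have mty: "m \<in> Arr E" "Dom E m = Cod E i" "Cod E m = T\<^sub>o (X a)" using m(2) by auto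
  have "corner_colimit \<kappa> (underS \<kappa> a) E' (\<lambda>c b. amap F (T\<^sub>a (j c b))) (\<lambda>b. amap F (j b a))
      (\<lambda>b. amap F (\<tau> (X b))) (amap F i) (\<lambda>b. amap F (\<iota> b \<cdot> q b))"
    if F: "backdrop_preserving \<kappa> E M E' M' F" for E' :: "('o, 'a) cat" and M' F
  proof -
    interpret F: cfunctor E E' F
      using F unfolding backdrop_preserving_def by unfold_locales blast
    have "corner_colimit \<kappa> (underS \<kappa> a) E' (\<lambda>c b. amap F (T\<^sub>a (j c b))) (\<lambda>b. amap F (j b a))
        (\<lambda>b. amap F (\<tau> (X b))) (amap F i) (\<lambda>b. amap F (\<iota> b) \<cdot>\<^bsub>E'\<^esub> amap F (q b))"
    proof (rule F.tgt.corner_colimit_pushouts[OF univ[OF F]])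
      fix b assume b: "b \<in> underS \<kappa> a"
      \<comment> \<open>Functors preserve cobase changes of maps in \<open>M\<close> with that map
        listed first; here it is the point, so the square keeps this orientation throughout.\<close>
      show "is_pushout E' (amap F (\<tau> (X b))) (amap F (j b a)) (amap F (q b)) (amap F (p b))"
        using F po[OF b] point_M[OF Xb[OF b]] unfolding backdrop_preserving_def by blast
      show "amap F (\<iota> b) \<in> hom E' (Cod E' (amap F (p b))) (Cod E' (amap F i))"
        "Dom E' (amap F (p b)) = Dom E' (amap F i)"
        using \<iota>[OF b] pty[OF b] i iarr by simp_all
      show "amap F (\<iota> b) \<cdot>\<^bsub>E'\<^esub> amap F (p b) = amap F i"
        using F.amap_eq[OF \<iota>p[OF b]] \<iota>[OF b] pty[OF b] by simp
      fix c assume c: "c \<in> underS \<kappa> b"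
      note ca = below[OF b c]
      note ty = n[OF b c] pty[OF b] pty[OF ca] jb[OF b c] Xb[OF b] Xb[OF ca]
      show "c \<in> underS \<kappa> a" by (rule ca)
      show "amap F (n c b) \<in> hom E' (Cod E' (amap F (p c))) (Cod E' (amap F (p b)))"
        "amap F (T\<^sub>a (j c b)) \<in> hom E' (Cod E' (amap F (\<tau> (X c)))) (Cod E' (amap F (\<tau> (X b))))"
        using ty by simp_all
      show "amap F (n c b) \<cdot>\<^bsub>E'\<^esub> amap F (p c) = amap F (p b)"
        using F.amap_eq[OF np[OF b c]] ty by simp
      show "amap F (n c b) \<cdot>\<^bsub>E'\<^esub> amap F (q c) = amap F (q b) \<cdot>\<^bsub>E'\<^esub> amap F (T\<^sub>a (j c b))"
        using F.amap_square[OF nq[OF b c]] ty by simp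
    qed (use iarr in simp)
    then show ?thesis
      by (subst (asm) corner_colimit_cong) (use \<iota> pty in auto)
  qed
  moreover have "\<iota> b \<cdot> q b \<in> hom E (T\<^sub>o (X b)) (Cod E i) \<and> (\<iota> b \<cdot> q b) \<cdot> \<tau> (X b) = i \<cdot> j b a \<and>
      m \<cdot> (\<iota> b \<cdot> q b) = T\<^sub>a (j b a) \<and> (\<forall>c \<in> underS \<kappa> b. (\<iota> b \<cdot> q b) \<cdot> T\<^sub>a (j c b) = \<iota> c \<cdot> q c)"
    if b: "b \<in> underS \<kappa> a" for b
  proof (intro conjI ballI)
    note ty = \<iota>[OF b] pty[OF b] Xb[OF b] ja[OF b]
    show "\<iota> b \<cdot> q b \<in> hom E (T\<^sub>o (X b)) (Cod E i)" using ty by simp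
    show "(\<iota> b \<cdot> q b) \<cdot> \<tau> (X b) = i \<cdot> j b a"
      using ty sq[OF b] reassoc[OF \<iota>p[OF b], of "j b a"] by simp
    show "m \<cdot> (\<iota> b \<cdot> q b) = T\<^sub>a (j b a)"
      using ty mty reassoc[OF m\<iota>[OF b], of "q b"] gq[OF b] by simp
    fix c assume c: "c \<in> underS \<kappa> b"
    note ca = below[OF b c]
    have "(\<iota> b \<cdot> q b) \<cdot> T\<^sub>a (j c b) = \<iota> b \<cdot> (n c b \<cdot> q c)" using ty jb[OF b c] nq[OF b c] by simp
    also have "\<dots> = \<iota> c \<cdot> q c" using ty n[OF b c] pty[OF ca] reassoc[OF \<iota>n[OF b c], of "q c"] by simp
    finally show "(\<iota> b \<cdot> q b) \<cdot> T\<^sub>a (j c b) = \<iota> c \<cdot> q c" .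
  qed
  ultimately have "corner a X j i (\<lambda>b. \<iota> b \<cdot> q b) m"
    unfolding corner_def using iarr i m(1,3) mty by blast
  then show ?thesis by blast
qed

end


section \<open>The free algebra chain\<close>

text \<open>Applied to the image of the chain under a functor: a map out of the colimit of \<open>A\<close> and the
  \<open>Y b\<close> is determined by its restrictions to \<open>A\<close> and, along \<open>y b\<close>, to the objects \<open>T (X b)\<close>.\<close>

lemma (in category) attach_univ:
  assumes cone: "cone_colimit \<kappa> I C z dd i0 \<iota>"
    and down: "\<And>b c. b \<in> I \<Longrightarrow> c \<in> underS \<kappa> b \<Longrightarrow> c \<in> I"
    and i0: "i0 \<in> Arr C"
    and \<iota>: "\<And>b. b \<in> I \<Longrightarrow> \<iota> b \<in> hom C (Cod C (e b)) (Cod C i0)"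
    and z: "\<And>b. b \<in> I \<Longrightarrow> z b = e b \<cdot> i b"
    and dd: "\<And>b c. b \<in> I \<Longrightarrow> c \<in> underS \<kappa> b \<Longrightarrow> dd c b = e b \<cdot> l b c"
    and i: "\<And>b. b \<in> I \<Longrightarrow> i b \<in> hom C (Dom C i0) (Dom C (e b))"
    and l: "\<And>b c. b \<in> I \<Longrightarrow> c \<in> underS \<kappa> b \<Longrightarrow> l b c \<in> hom C (Cod C (e c)) (Dom C (e b))"
    and po: "\<And>b. b \<in> I \<Longrightarrow> is_pushout C (m b) (s b) (y b) (e b)"
    and co: "\<And>b. b \<in> I \<Longrightarrow>
      corner_colimit \<kappa> (underS \<kappa> b) C d (\<lambda>c. j c b) t (\<pi> b) (\<rho> b)"
    and \<pi>: "\<And>b. b \<in> I \<Longrightarrow> \<pi> b \<in> hom C (Dom C (e b)) (Dom C (m b))"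
    and \<rho>: "\<And>b c. b \<in> I \<Longrightarrow> c \<in> underS \<kappa> b \<Longrightarrow> \<rho> b c \<in> hom C (Dom C (y c)) (Dom C (m b))"
    and t: "\<And>b. b \<in> I \<Longrightarrow> t b \<in> hom C (Dom C (e b)) (Dom C (y b))"
    and m\<pi>: "\<And>b. b \<in> I \<Longrightarrow> m b \<cdot> \<pi> b = t b"
    and m\<rho>: "\<And>b c. b \<in> I \<Longrightarrow> c \<in> underS \<kappa> b \<Longrightarrow> m b \<cdot> \<rho> b c = d c b"
    and s\<pi>: "\<And>b. b \<in> I \<Longrightarrow> s b \<cdot> \<pi> b = Idn C (Dom C (e b))"
    and s\<rho>: "\<And>b c. b \<in> I \<Longrightarrow> c \<in> underS \<kappa> b \<Longrightarrow> s b \<cdot> \<rho> b c = l b c \<cdot> y c"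
    and yt: "\<And>b. b \<in> I \<Longrightarrow> y b \<cdot> t b = e b"
    and d: "\<And>b c. b \<in> I \<Longrightarrow> c \<in> underS \<kappa> b \<Longrightarrow> d c b \<in> hom C (Dom C (y c)) (Dom C (y b))"
  shows "\<And>B f k. \<lbrakk>f \<in> hom C (Dom C i0) B; \<And>b. b \<in> I \<Longrightarrow> k b \<in> hom C (Dom C (y b)) B;
      \<And>b. b \<in> I \<Longrightarrow> k b \<cdot> (t b \<cdot> i b) = f;
      \<And>b c. b \<in> I \<Longrightarrow> c \<in> underS \<kappa> b \<Longrightarrow> k b \<cdot> d c b = k c;
      \<And>b c. b \<in> I \<Longrightarrow> c \<in> underS \<kappa> b \<Longrightarrow> k b \<cdot> (t b \<cdot> (l b c \<cdot> y c)) = k c\<rbrakk> \<Longrightarrow>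
      \<exists>u \<in> hom C (Cod C i0) B. u \<cdot> i0 = f \<and> (\<forall>b \<in> I. u \<cdot> (\<iota> b \<cdot> y b) = k b)"
    and "\<And>B u v. \<lbrakk>u \<in> hom C (Cod C i0) B; v \<in> hom C (Cod C i0) B; u \<cdot> i0 = v \<cdot> i0;
      \<And>b. b \<in> I \<Longrightarrow> u \<cdot> (\<iota> b \<cdot> y b) = v \<cdot> (\<iota> b \<cdot> y b)\<rbrakk> \<Longrightarrow> u = v"
proof -
  have ity: "i b \<in> Arr C" "Dom C (i b) = Dom C i0" "Cod C (i b) = Dom C (e b)"
    "\<iota> b \<in> Arr C" "Dom C (\<iota> b) = Cod C (e b)" "Cod C (\<iota> b) = Cod C i0"
    "t b \<in> Arr C" "Dom C (t b) = Dom C (e b)" "Cod C (t b) = Dom C (y b)"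
    "\<pi> b \<in> Arr C" "Dom C (\<pi> b) = Dom C (e b)" "Cod C (\<pi> b) = Dom C (m b)"
    if "b \<in> I" for b
    using i[OF that] \<iota>[OF that] t[OF that] \<pi>[OF that] by auto
  have lty: "l b c \<in> Arr C" "Dom C (l b c) = Cod C (e c)" "Cod C (l b c) = Dom C (e b)"
    "\<rho> b c \<in> Arr C" "Dom C (\<rho> b c) = Dom C (y c)" "Cod C (\<rho> b c) = Dom C (m b)"
    "d c b \<in> Arr C" "Dom C (d c b) = Dom C (y c)" "Cod C (d c b) = Dom C (y b)"
    if "b \<in> I" "c \<in> underS \<kappa> b" for b c
    using l[OF that] \<rho>[OF that] d[OF that] by auto
  have pty: "m b \<in> Arr C" "s b \<in> Arr C" "y b \<in> Arr C" "e b \<in> Arr C" "Dom C (s b) = Dom C (m b)"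
    "Cod C (m b) = Dom C (y b)" "Cod C (s b) = Dom C (e b)" "Cod C (y b) = Cod C (e b)"
    if "b \<in> I" for b
    using pushoutD[OF po[OF that]] by auto
  {
    fix B f k
    assume f: "f \<in> hom C (Dom C i0) B" and k: "\<And>b. b \<in> I \<Longrightarrow> k b \<in> hom C (Dom C (y b)) B"
      and kti: "\<And>b. b \<in> I \<Longrightarrow> k b \<cdot> (t b \<cdot> i b) = f"
      and kd: "\<And>b c. b \<in> I \<Longrightarrow> c \<in> underS \<kappa> b \<Longrightarrow> k b \<cdot> d c b = k c"
      and ktx: "\<And>b c. b \<in> I \<Longrightarrow> c \<in> underS \<kappa> b \<Longrightarrow> k b \<cdot> (t b \<cdot> (l b c \<cdot> y c)) = k c"
    have kty: "k b \<in> Arr C" "Dom C (k b) = Dom C (y b)" "Cod C (k b) = B" if "b \<in> I" for b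
      using k[OF that] by auto
    \<comment> \<open>The two candidates on the corner at \<open>b\<close> agree on its legs: on the
      leg from \<open>Dom (e b)\<close> both give \<open>k b \<cdot> t b\<close>, and on the earlier
      legs both give \<open>k c\<close> by the two compatibility assumptions. So \<open>k b\<close>
      and \<open>k b \<cdot> t b\<close> glue to a map out of \<open>Cod (e b)\<close>.\<close>
    have sm: "k b \<cdot> m b = (k b \<cdot> t b) \<cdot> s b" if b: "b \<in> I" for b
    proof (rule corner_colimit_eq[OF co[OF b], of _ B])
      note ty = kty[OF b] pty[OF b] ity[OF b]
      show "k b \<cdot> m b \<in> hom C (Cod C (\<pi> b)) B" "(k b \<cdot> t b) \<cdot> s b \<in> hom C (Cod C (\<pi> b)) B"
        using ty by simp_all
      show "(k b \<cdot> m b) \<cdot> \<pi> b = ((k b \<cdot> t b) \<cdot> s b) \<cdot> \<pi> b"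
        using ty m\<pi>[OF b] s\<pi>[OF b] by simp
      fix c assume c: "c \<in> underS \<kappa> b"
      note cI = down[OF b c]
      show "(k b \<cdot> m b) \<cdot> \<rho> b c = ((k b \<cdot> t b) \<cdot> s b) \<cdot> \<rho> b c"
        using ty lty[OF b c] m\<rho>[OF b c] s\<rho>[OF b c] kd[OF b c] ktx[OF b c] by simp
    qed
    have "\<exists>g \<in> hom C (Cod C (y b)) B. g \<cdot> y b = k b \<and> g \<cdot> e b = k b \<cdot> t b" if b: "b \<in> I" for b
      by (rule pushout_ex[OF po[OF b], of "k b" B "k b \<cdot> t b"])
        (use kty[OF b] pty[OF b] ity[OF b] sm[OF b] in auto)
    then obtain g where g': "\<And>b. b \<in> I \<Longrightarrow> g b \<in> hom C (Cod C (y b)) B \<and>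
        g b \<cdot> y b = k b \<and> g b \<cdot> e b = k b \<cdot> t b" by metis
    have g: "g b \<in> Arr C" "Dom C (g b) = Cod C (e b)" "Cod C (g b) = B"
      and gy: "g b \<cdot> y b = k b" and ge: "g b \<cdot> e b = k b \<cdot> t b" if "b \<in> I" for b
      using g'[OF that] pty[OF that] by auto
    obtain u where u: "u \<in> hom C (Cod C i0) B" "u \<cdot> i0 = f" "\<And>b. b \<in> I \<Longrightarrow> u \<cdot> \<iota> b = g b"
    proof (rule cone_colimit_ex[OF cone, of f B g])
      show "f \<in> hom C (Dom C i0) B" by (rule f)
      fix b assume b: "b \<in> I"
      note ty = kty[OF b] pty[OF b] ity[OF b] g[OF b]
      show "g b \<in> hom C (Dom C (\<iota> b)) B" using ty by simp
      have "g b \<cdot> (e b \<cdot> i b) = (k b \<cdot> t b) \<cdot> i b"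
        by (rule reassoc[OF ge[OF b]]) (use ty in simp_all)
      then show "g b \<cdot> z b = f" using z[OF b] kti[OF b] ty by simp
      fix c assume c: "c \<in> underS \<kappa> b"
      note cI = down[OF b c]
      note ty = ty lty[OF b c] pty[OF cI] g[OF cI] ity[OF cI]
      have 1: "g b \<cdot> (e b \<cdot> l b c) = (k b \<cdot> t b) \<cdot> l b c"
        by (rule reassoc[OF ge[OF b]]) (use ty in simp_all)
      have 2: "((k b \<cdot> t b) \<cdot> l b c) \<cdot> y c = k c" using ktx[OF b c] ty by simp
      \<comment> \<open>Compared on the pushout at \<open>c\<close>. Along \<open>y c\<close> this
        is the last assumption on \<open>k\<close>; along \<open>e c\<close> it follows, as
        \<open>e c\<close> factors through \<open>y c\<close>.\<close>
      have "(k b \<cdot> t b) \<cdot> l b c = g c"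
      proof (rule pushout_eq[OF po[OF cI], of _ B])
        show "(k b \<cdot> t b) \<cdot> l b c \<in> hom C (Cod C (y c)) B" "g c \<in> hom C (Cod C (y c)) B"
          using ty by simp_all
        show "((k b \<cdot> t b) \<cdot> l b c) \<cdot> y c = g c \<cdot> y c" using 2 gy[OF cI] by simp
        have "((k b \<cdot> t b) \<cdot> l b c) \<cdot> (y c \<cdot> t c) = k c \<cdot> t c"
          by (rule reassoc[OF 2]) (use ty in simp_all)
        then show "((k b \<cdot> t b) \<cdot> l b c) \<cdot> e c = g c \<cdot> e c" using yt[OF cI] ge[OF cI] by simp
      qed
      then show "g b \<cdot> dd c b = g c" using 1 dd[OF b c] by simp
    qed blast
    have "u \<cdot> (\<iota> b \<cdot> y b) = k b" if b: "b \<in> I" for b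
      using reassoc[OF u(3)[OF b], of "y b"] u(1) pty[OF b] ity[OF b] gy[OF b] by simp
    then show "\<exists>u \<in> hom C (Cod C i0) B. u \<cdot> i0 = f \<and> (\<forall>b \<in> I. u \<cdot> (\<iota> b \<cdot> y b) = k b)"
      using u by blast
  }
  fix B u v
  assume u: "u \<in> hom C (Cod C i0) B" and v: "v \<in> hom C (Cod C i0) B" and uv0: "u \<cdot> i0 = v \<cdot> i0"
    and uv: "\<And>b. b \<in> I \<Longrightarrow> u \<cdot> (\<iota> b \<cdot> y b) = v \<cdot> (\<iota> b \<cdot> y b)"
  have uty: "u \<in> Arr C" "Dom C u = Cod C i0" "v \<in> Arr C" "Dom C v = Cod C i0"
    "Cod C u = B" "Cod C v = B" using u v by auto
  show "u = v"
  proof (rule cone_colimit_eq[OF cone u v uv0])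
    fix b assume b: "b \<in> I"
    note ty = uty pty[OF b] ity[OF b]
    show "u \<cdot> \<iota> b = v \<cdot> \<iota> b"
    proof (rule pushout_eq[OF po[OF b], of _ B])
      show "u \<cdot> \<iota> b \<in> hom C (Cod C (y b)) B" "v \<cdot> \<iota> b \<in> hom C (Cod C (y b)) B" using ty by simp_all
      show 1: "(u \<cdot> \<iota> b) \<cdot> y b = (v \<cdot> \<iota> b) \<cdot> y b" using uv[OF b] ty by simp
      \<comment> \<open>Since \<open>e b = y b \<cdot> t b\<close>, agreement along
        \<open>y b\<close> already gives agreement along the other leg of the pushout.\<close>
      have "(u \<cdot> \<iota> b) \<cdot> (y b \<cdot> t b) = ((v \<cdot> \<iota> b) \<cdot> y b) \<cdot> t b"
        by (rule reassoc[OF 1]) (use ty in simp_all)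
      then show "(u \<cdot> \<iota> b) \<cdot> e b = (v \<cdot> \<iota> b) \<cdot> e b" using yt[OF b] ty by simp
    qed
  qed
qed

text \<open>Stage \<open>a\<close> of the free algebra on \<open>A\<close>: the object \<open>X a = Cod (incl (f a))\<close>, the colimit of
  \<open>A\<close> and the \<open>Y b\<close> for \<open>b < a\<close>, and the maps \<open>step : X a \<rightarrow> Y a\<close> and \<open>act : T (X a) \<rightarrow> Y a\<close>.\<close>

record ('k, 'a) stage =
  incl :: "'a"
  leg :: "'k \<Rightarrow> 'a"
  step :: "'a"
  act :: "'a"

context configuration
begin

definition stage_obj :: "('k \<Rightarrow> ('k, 'a) stage) \<Rightarrow> 'k \<Rightarrow> 'o" where
  "stage_obj f b = Cod E (incl (f b))"

definition stage_map :: "('k \<Rightarrow> ('k, 'a) stage) \<Rightarrow> 'k \<Rightarrow> 'k \<Rightarrow> 'a" where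
  "stage_map f c b = leg (f b) c \<cdot> step (f c)"

text \<open>The map \<open>s\<close> folds the corner onto \<open>X a\<close>: identity on
  \<open>X a\<close>, and on \<open>T (X b)\<close> the action constructed before. Pushing out
  \<open>m\<close> along it is the universal way to act by \<open>T (X a)\<close> in agreement with
  the point and with all earlier actions. The whole function \<open>f\<close> is an argument because
  a stage refers to the stages below it.\<close>

definition is_stage :: "'o \<Rightarrow> ('k \<Rightarrow> ('k, 'a) stage) \<Rightarrow> 'k \<Rightarrow> bool" where
  "is_stage A f a \<longleftrightarrow>
     incl (f a) \<in> M \<and> Dom E (incl (f a)) = A \<and>
     (\<forall>b \<in> underS \<kappa> a. leg (f a) b \<in> M \<and> Dom E (leg (f a) b) = Cod E (step (f b)) \<and>
        Cod E (leg (f a) b) = Cod E (incl (f a)) \<and>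
        leg (f a) b \<cdot> (step (f b) \<cdot> incl (f b)) = incl (f a) \<and>
        (\<forall>c \<in> underS \<kappa> b. leg (f a) b \<cdot> (step (f b) \<cdot> leg (f b) c) = leg (f a) c)) \<and>
     (\<forall>(E' :: ('o, 'a) cat) M' F. backdrop_preserving \<kappa> E M E' M' F \<longrightarrow>
        cone_colimit \<kappa> (underS \<kappa> a) E' (\<lambda>b. amap F (step (f b) \<cdot> incl (f b)))
          (\<lambda>c b. amap F (step (f b) \<cdot> leg (f b) c)) (amap F (incl (f a)))
          (\<lambda>b. amap F (leg (f a) b))) \<and>
     step (f a) \<in> M \<and>
     (\<exists>\<pi> \<rho> m s. corner a (stage_obj f) (stage_map f) \<pi> \<rho> m \<and>
        s \<in> hom E (Cod E \<pi>) (stage_obj f a) \<and> s \<cdot> \<pi> = Idn E (stage_obj f a) \<and>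
        (\<forall>b \<in> underS \<kappa> a. s \<cdot> \<rho> b = leg (f a) b \<cdot> act (f b)) \<and>
        is_pushout E m s (act (f a)) (step (f a)))"

text \<open>Being a stage at \<open>a\<close> depends on \<open>f\<close> up to \<open>a\<close>
  only, which is the locality that well-founded recursion asks for.\<close>

lemma is_stage_cong:
  assumes "\<And>b. b \<in> insert a (underS \<kappa> a) \<Longrightarrow> f b = g b"
  shows "is_stage A f a = is_stage A g a"
proof -
  have fa: "f a = g a" and fb: "\<And>b. b \<in> underS \<kappa> a \<Longrightarrow> f b = g b" using assms by auto
  have cor: "corner a (stage_obj f) (stage_map f) \<pi> \<rho> m = corner a (stage_obj g) (stage_map g) \<pi> \<rho> m"
    for \<pi> \<rho> m
  proof (rule corner_cong)
    show "stage_obj f b = stage_obj g b" if "b \<in> insert a (underS \<kappa> a)" for b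
      using assms[OF that] by (simp add: stage_obj_def)
    show "stage_map f c b = stage_map g c b" if "b \<in> insert a (underS \<kappa> a)" "c \<in> underS \<kappa> b" for b c
      using assms[OF that(1)] fb[of c] that underS_trans[of c b a] by (auto simp: stage_map_def)
  qed
  have colim: "cone_colimit \<kappa> (underS \<kappa> a) E' (\<lambda>b. amap F (step (f b) \<cdot> incl (f b)))
          (\<lambda>c b. amap F (step (f b) \<cdot> leg (f b) c)) (amap F (incl (f a)))
          (\<lambda>b. amap F (leg (f a) b)) =
      cone_colimit \<kappa> (underS \<kappa> a) E' (\<lambda>b. amap F (step (g b) \<cdot> incl (g b)))
          (\<lambda>c b. amap F (step (g b) \<cdot> leg (g b) c)) (amap F (incl (g a)))
          (\<lambda>b. amap F (leg (g a) b))" for E' :: "('o, 'a) cat" and F :: "('o, 'a, 'o, 'a) funct"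
    by (rule cone_colimit_cong) (use fa fb underS_trans in auto)
  show ?thesis
    unfolding is_stage_def cor colim
    using fa fb by (simp add: stage_obj_def cong: conj_cong)
qed

lemma is_stageD:
  assumes "is_stage A f a"
  shows "incl (f a) \<in> M" "Dom E (incl (f a)) = A" "step (f a) \<in> M"
    "act (f a) \<in> Arr E" "Dom E (step (f a)) = stage_obj f a"
    "Dom E (act (f a)) = T\<^sub>o (stage_obj f a)" "Cod E (act (f a)) = Cod E (step (f a))"
    "Cod E (incl (f a)) = stage_obj f a"
    "\<And>b. b \<in> underS \<kappa> a \<Longrightarrow> leg (f a) b \<in> M"
    "\<And>b. b \<in> underS \<kappa> a \<Longrightarrow> Dom E (leg (f a) b) = Cod E (step (f b))"
    "\<And>b. b \<in> underS \<kappa> a \<Longrightarrow> Cod E (leg (f a) b) = stage_obj f a"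
    "\<And>b. b \<in> underS \<kappa> a \<Longrightarrow> leg (f a) b \<cdot> (step (f b) \<cdot> incl (f b)) = incl (f a)"
    "\<And>b c. b \<in> underS \<kappa> a \<Longrightarrow> c \<in> underS \<kappa> b \<Longrightarrow>
      leg (f a) b \<cdot> (step (f b) \<cdot> leg (f b) c) = leg (f a) c"
    "\<And>(E' :: ('o, 'a) cat) M' F. backdrop_preserving \<kappa> E M E' M' F \<Longrightarrow>
        cone_colimit \<kappa> (underS \<kappa> a) E' (\<lambda>b. amap F (step (f b) \<cdot> incl (f b)))
          (\<lambda>c b. amap F (step (f b) \<cdot> leg (f b) c)) (amap F (incl (f a)))
          (\<lambda>b. amap F (leg (f a) b))"
    "stage_obj f a \<in> Obj E"
proof -
  obtain \<pi> \<rho> m s where c: "corner a (stage_obj f) (stage_map f) \<pi> \<rho> m"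
    and s: "s \<in> hom E (Cod E \<pi>) (stage_obj f a)" and po: "is_pushout E m s (act (f a)) (step (f a))"
    using assms unfolding is_stage_def by blast
  show "incl (f a) \<in> M" "Dom E (incl (f a)) = A" "step (f a) \<in> M"
    "Cod E (incl (f a)) = stage_obj f a" "stage_obj f a \<in> Obj E"
    "\<And>b. b \<in> underS \<kappa> a \<Longrightarrow> leg (f a) b \<in> M"
    "\<And>b. b \<in> underS \<kappa> a \<Longrightarrow> Dom E (leg (f a) b) = Cod E (step (f b))"
    "\<And>b. b \<in> underS \<kappa> a \<Longrightarrow> Cod E (leg (f a) b) = stage_obj f a"
    "\<And>b. b \<in> underS \<kappa> a \<Longrightarrow> leg (f a) b \<cdot> (step (f b) \<cdot> incl (f b)) = incl (f a)"
    "\<And>b c. b \<in> underS \<kappa> a \<Longrightarrow> c \<in> underS \<kappa> b \<Longrightarrow>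
      leg (f a) b \<cdot> (step (f b) \<cdot> leg (f b) c) = leg (f a) c"
    "\<And>(E' :: ('o, 'a) cat) M' F. backdrop_preserving \<kappa> E M E' M' F \<Longrightarrow>
        cone_colimit \<kappa> (underS \<kappa> a) E' (\<lambda>b. amap F (step (f b) \<cdot> incl (f b)))
          (\<lambda>c b. amap F (step (f b) \<cdot> leg (f b) c)) (amap F (incl (f a)))
          (\<lambda>b. amap F (leg (f a) b))"
    using assms unfolding is_stage_def by (simp_all add: stage_obj_def)
  show "act (f a) \<in> Arr E" "Dom E (step (f a)) = stage_obj f a"
    "Dom E (act (f a)) = T\<^sub>o (stage_obj f a)" "Cod E (act (f a)) = Cod E (step (f a))"
    using pushoutD[OF po] s cornerD(3-5)[OF c] by auto
qed

text \<open>The square \<open>act (f a) \<cdot> m = step (f a) \<cdot> s\<close>, restricted along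
  the two kinds of legs of the corner.\<close>

lemma
  assumes "is_stage A f a"
  shows act_point: "act (f a) \<cdot> \<tau> (stage_obj f a) = step (f a)"
    and act_T: "\<And>b. b \<in> underS \<kappa> a \<Longrightarrow>
      act (f a) \<cdot> T\<^sub>a (stage_map f b a) = step (f a) \<cdot> (leg (f a) b \<cdot> act (f b))"
proof -
  obtain \<pi> \<rho> m s where c: "corner a (stage_obj f) (stage_map f) \<pi> \<rho> m"
    and s: "s \<in> hom E (Cod E \<pi>) (stage_obj f a)" "s \<cdot> \<pi> = Idn E (stage_obj f a)"
      "\<And>b. b \<in> underS \<kappa> a \<Longrightarrow> s \<cdot> \<rho> b = leg (f a) b \<cdot> act (f b)"
    and po: "is_pushout E m s (act (f a)) (step (f a))"
    using assms unfolding is_stage_def by blast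
  note ty = is_stageD(1-8)[OF assms] s(1)[unfolded in_hom] cornerD(1-5,7-9)[OF c]
  have "act (f a) \<cdot> (m \<cdot> \<pi>) = (step (f a) \<cdot> s) \<cdot> \<pi>"
    by (rule reassoc[OF pushoutD(9)[OF po]]) (use ty in simp_all)
  then show "act (f a) \<cdot> \<tau> (stage_obj f a) = step (f a)"
    using ty s(2) cornerD(6)[OF c] by simp
  fix b assume b: "b \<in> underS \<kappa> a"
  have "act (f a) \<cdot> (m \<cdot> \<rho> b) = (step (f a) \<cdot> s) \<cdot> \<rho> b"
    by (rule reassoc[OF pushoutD(9)[OF po]]) (use ty b in simp_all)
  then show "act (f a) \<cdot> T\<^sub>a (stage_map f b a) = step (f a) \<cdot> (leg (f a) b \<cdot> act (f b))"
    using ty b s(3)[OF b] cornerD(11)[OF c b] by simp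
qed

lemma stage_map_arr:
  assumes "is_stage A f a" "is_stage A f b" "b \<in> underS \<kappa> a"
  shows "stage_map f b a \<in> M" "stage_map f b a \<in> Arr E"
    "Dom E (stage_map f b a) = stage_obj f b" "Cod E (stage_map f b a) = stage_obj f a"
  using is_stageD[OF assms(1)] is_stageD[OF assms(2)] assms(3) unfolding stage_map_def by simp_all

lemma stage_map_comp:
  assumes a: "is_stage A f a" and b: "is_stage A f b" and c: "is_stage A f c"
    and "b \<in> underS \<kappa> a" "c \<in> underS \<kappa> b"
  shows "stage_map f b a \<cdot> stage_map f c b = stage_map f c a"
proof -
  note ty = is_stageD(1-11)[OF a] is_stageD(1-11)[OF b] is_stageD(1-11)[OF c]
  have ca: "c \<in> underS \<kappa> a" using underS_trans[OF assms(5,4)] .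
  have 1: "step (f b) \<cdot> leg (f b) c \<in> Arr E" "Dom E (step (f b) \<cdot> leg (f b) c) = Cod E (step (f c))"
    "Cod E (step (f b) \<cdot> leg (f b) c) = Cod E (step (f b))"
    using ty assms(4,5) by simp_all
  have "leg (f a) b \<cdot> ((step (f b) \<cdot> leg (f b) c) \<cdot> step (f c)) = leg (f a) c \<cdot> step (f c)"
    by (rule reassoc[OF is_stageD(13)[OF a assms(4,5)]]) (use ty assms(4,5) 1 in simp_all)
  then show ?thesis using ty assms(4,5) ca unfolding stage_map_def by simp
qed

lemma stage_exists:
  assumes a: "a \<in> Field \<kappa>" and A: "A \<in> Obj E"
    and st: "\<And>b. b \<in> underS \<kappa> a \<Longrightarrow> is_stage A f b"
  shows "\<exists>r. is_stage A (f(a := r)) a"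
proof -
  have below: "c \<in> underS \<kappa> a" if "b \<in> underS \<kappa> a" "c \<in> underS \<kappa> b" for b c
    using underS_trans that by blast
  have notin: "b \<noteq> a" if "b \<in> underS \<kappa> a" for b using that by (simp add: underS_def)
  note D = is_stageD[OF st]
  have arr: "incl (f b) \<in> Arr E" "step (f b) \<in> Arr E" if "b \<in> underS \<kappa> a" for b
    using D(1,3)[OF that] by auto
  obtain i \<iota> where i: "i \<in> M" "Dom E i = A"
    and \<iota>': "\<And>c. c \<in> underS \<kappa> a \<Longrightarrow> \<iota> c \<in> M \<and> Dom E (\<iota> c) = Cod E (step (f c)) \<and> Cod E (\<iota> c) = Cod E i"
    and \<iota>z: "\<And>c. c \<in> underS \<kappa> a \<Longrightarrow> \<iota> c \<cdot> (step (f c) \<cdot> incl (f c)) = i"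
    and \<iota>d: "\<And>c e. c \<in> underS \<kappa> a \<Longrightarrow> e \<in> underS \<kappa> c \<Longrightarrow> \<iota> c \<cdot> (step (f c) \<cdot> leg (f c) e) = \<iota> e"
    and univ: "\<And>(E' :: ('o, 'a) cat) M' F. backdrop_preserving \<kappa> E M E' M' F \<Longrightarrow>
      cone_colimit \<kappa> (underS \<kappa> a) E' (\<lambda>b. amap F (step (f b) \<cdot> incl (f b)))
        (\<lambda>c b. amap F (step (f b) \<cdot> leg (f b) c)) (amap F i) (\<lambda>b. amap F (\<iota> b))"
  proof (rule cone_colimit_exists[of a A "\<lambda>b. step (f b) \<cdot> incl (f b)" "\<lambda>c. Cod E (step (f c))"
        "\<lambda>c b. step (f b) \<cdot> leg (f b) c"])
    show "a \<in> Field \<kappa>" "A \<in> Obj E" by fact+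
    fix b assume b: "b \<in> underS \<kappa> a"
    note ty = D(1-11)[OF b]
    show "step (f b) \<cdot> incl (f b) \<in> M \<and> Dom E (step (f b) \<cdot> incl (f b)) = A \<and>
        Cod E (step (f b) \<cdot> incl (f b)) = Cod E (step (f b))" using ty by simp
    fix c assume c: "c \<in> underS \<kappa> b"
    note ty = ty D(1-11)[OF below[OF b c]]
    show "step (f b) \<cdot> leg (f b) c \<in> M \<and> Dom E (step (f b) \<cdot> leg (f b) c) = Cod E (step (f c)) \<and>
        Cod E (step (f b) \<cdot> leg (f b) c) = Cod E (step (f b))" using ty c by simp
    have "(step (f b) \<cdot> leg (f b) c) \<cdot> (step (f c) \<cdot> incl (f c)) =
        step (f b) \<cdot> (leg (f b) c \<cdot> (step (f c) \<cdot> incl (f c)))"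
      using ty c by simp
    then show "(step (f b) \<cdot> leg (f b) c) \<cdot> (step (f c) \<cdot> incl (f c)) = step (f b) \<cdot> incl (f b)"
      using D(12)[OF b c] by simp
    fix e assume e: "e \<in> underS \<kappa> c"
    note ty = ty D(1-11)[OF below[OF below[OF b c] e]]
    have "(step (f b) \<cdot> leg (f b) c) \<cdot> (step (f c) \<cdot> leg (f c) e) =
        step (f b) \<cdot> (leg (f b) c \<cdot> (step (f c) \<cdot> leg (f c) e))"
      using ty c e by simp
    then show "(step (f b) \<cdot> leg (f b) c) \<cdot> (step (f c) \<cdot> leg (f c) e) = step (f b) \<cdot> leg (f b) e"
      using D(13)[OF b c e] by simp
  qed blast
  have \<iota>: "\<iota> c \<in> M" "\<iota> c \<in> Arr E" "Dom E (\<iota> c) = Cod E (step (f c))" "Cod E (\<iota> c) = Cod E i"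
    if "c \<in> underS \<kappa> a" for c using \<iota>'[OF that] by auto
  have iarr: "i \<in> Arr E" using i by simp
  \<comment> \<open>The corner at \<open>a\<close> refers to \<open>incl\<close> and
    \<open>leg\<close> of this stage and to \<open>step\<close> of earlier ones. It can therefore be
    formed while \<open>step\<close> and \<open>act\<close> still hold the placeholder
    \<open>i\<close>.\<close>
  define g where "g = f(a := \<lparr>incl = i, leg = \<iota>, step = i, act = i\<rparr>)"
  have gb: "g b = f b" if "b \<in> underS \<kappa> a" for b using notin[OF that] by (simp add: g_def)
  have ga: "incl (g a) = i" "leg (g a) = \<iota>" by (simp_all add: g_def)
  define X where "X = stage_obj g"
  define j where "j = stage_map g"
  have Xa: "X a = Cod E i" "X a \<in> Obj E" by (simp_all add: X_def stage_obj_def ga iarr)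
  have Xb: "X b = stage_obj f b" if "b \<in> underS \<kappa> a" for b
    using gb[OF that] by (simp add: X_def stage_obj_def)
  have jb: "j c b = stage_map f c b" if "b \<in> underS \<kappa> a" "c \<in> underS \<kappa> b" for b c
    using gb[OF that(1)] gb[OF below[OF that]] by (simp add: j_def stage_map_def)
  have ja: "j c a = \<iota> c \<cdot> step (f c)" if "c \<in> underS \<kappa> a" for c
    using gb[OF that] ga by (simp add: j_def stage_map_def)
  have jja: "j b a \<cdot> j c b = j c a" if b: "b \<in> underS \<kappa> a" and c: "c \<in> underS \<kappa> b" for b c
  proof -
    note ty = D(1-11)[OF b] D(1-11)[OF below[OF b c]] \<iota>[OF b] \<iota>[OF below[OF b c]] c
    have "\<iota> b \<cdot> ((step (f b) \<cdot> leg (f b) c) \<cdot> step (f c)) = \<iota> c \<cdot> step (f c)"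
      by (rule reassoc[OF \<iota>d[OF b c]]) (use ty in simp_all)
    then show ?thesis
      using ty by (simp add: ja[OF b] ja[OF below[OF b c]] jb[OF b c] stage_map_def)
  qed
  have Xobj: "X b \<in> Obj E" if "b \<in> insert a (underS \<kappa> a)" for b
    using that Xa(2) Xb[of b] D(15)[of b] by auto
  have jM: "j c b \<in> M \<and> Dom E (j c b) = X c \<and> Cod E (j c b) = X b"
    if b: "b \<in> insert a (underS \<kappa> a)" and c: "c \<in> underS \<kappa> b" for b c
  proof (cases "b = a")
    case True
    then show ?thesis using c \<iota>[of c] D(1-11)[of c] ja[of c] Xa Xb[of c] by simp
  next
    case False
    then have b: "b \<in> underS \<kappa> a" using b by simp
    show ?thesis
      using stage_map_arr[OF st[OF b] st[OF below[OF b c]] c] jb[OF b c] Xb[OF b] Xb[OF below[OF b c]]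
      by simp
  qed
  have jj: "j c b \<cdot> j e c = j e b"
    if b: "b \<in> insert a (underS \<kappa> a)" and c: "c \<in> underS \<kappa> b" and e: "e \<in> underS \<kappa> c" for b c e
  proof (cases "b = a")
    case True
    then show ?thesis using jja c e by simp
  next
    case False
    then have b: "b \<in> underS \<kappa> a" using b by simp
    note ca = below[OF b c]
    show ?thesis
      using stage_map_comp[OF st[OF b] st[OF ca] st[OF below[OF ca e]] c e] jb[OF b c] jb[OF ca e]
        jb[OF b underS_trans[OF e c]] by simp
  qed
  have cor: "\<exists>\<pi> \<rho> m. corner b X j \<pi> \<rho> m" if b: "b \<in> underS \<kappa> a" for b
  proof -
    obtain \<pi> \<rho> m where "corner b (stage_obj f) (stage_map f) \<pi> \<rho> m"
      using st[OF b] unfolding is_stage_def by blast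
    moreover have "corner b X j \<pi> \<rho> m = corner b (stage_obj f) (stage_map f) \<pi> \<rho> m"
      by (rule corner_cong) (use Xb jb b below in auto)
    ultimately show ?thesis by blast
  qed
  have "\<exists>\<pi> \<rho> m. corner a X j \<pi> \<rho> m"
    by (rule corner_exists[OF a Xobj jM jj cor])
  then obtain \<pi> \<rho> m where c: "corner a X j \<pi> \<rho> m" by blast
  note cD = cornerD[OF c]
  have co: "corner_colimit \<kappa> (underS \<kappa> a) E (\<lambda>c b. T\<^sub>a (j c b)) (\<lambda>b. j b a) (\<lambda>b. \<tau> (X b)) \<pi> \<rho>"
    by (rule corner_colimit_E[OF c]) (use Xobj jM in auto)
  have yt: "act (f b) \<cdot> \<tau> (stage_obj f b) = step (f b)" if b: "b \<in> underS \<kappa> a" for b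
    using st[OF b] act_point by blast
  have yT: "act (f b) \<cdot> T\<^sub>a (stage_map f c b) = step (f b) \<cdot> (leg (f b) c \<cdot> act (f c))"
    if b: "b \<in> underS \<kappa> a" and c: "c \<in> underS \<kappa> b" for b c
    using act_T[OF st[OF b] c] by blast
  \<comment> \<open>The folding map exists because the earlier actions agree with the point
    (\<open>yt\<close>) and with each other (\<open>yT\<close> and \<open>\<iota>d\<close>).\<close>
  obtain s where s: "s \<in> hom E (Cod E \<pi>) (X a)" "s \<cdot> \<pi> = Idn E (X a)"
    "\<And>b. b \<in> underS \<kappa> a \<Longrightarrow> s \<cdot> \<rho> b = \<iota> b \<cdot> act (f b)"
  proof (rule corner_colimit_ex[OF co, of "Idn E (X a)" "X a" "\<lambda>b. \<iota> b \<cdot> act (f b)"])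
    show "Idn E (X a) \<in> hom E (Dom E \<pi>) (X a)" using Xa cD(2) by simp
    fix b assume b: "b \<in> underS \<kappa> a"
    note ty = \<iota>[OF b] D(1-11)[OF b] D(15)[OF b]
    show "\<iota> b \<cdot> act (f b) \<in> hom E (Dom E (\<rho> b)) (X a)"
      using ty cD(8)[OF b] Xb[OF b] Xa by simp
    show "(\<iota> b \<cdot> act (f b)) \<cdot> \<tau> (X b) = Idn E (X a) \<cdot> j b a"
      using ty Xb[OF b] Xa yt[OF b] ja[OF b] by simp
    fix c assume c: "c \<in> underS \<kappa> b"
    note ca = below[OF b c]
    note ty = ty \<iota>[OF ca] D(1-11)[OF ca] D(15)[OF ca]
    have "(\<iota> b \<cdot> act (f b)) \<cdot> T\<^sub>a (j c b) = \<iota> b \<cdot> (step (f b) \<cdot> (leg (f b) c \<cdot> act (f c)))"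
      using ty jb[OF b c] yT[OF b c] stage_map_arr[OF st[OF b] st[OF ca] c] by simp
    also have "\<dots> = \<iota> b \<cdot> ((step (f b) \<cdot> leg (f b) c) \<cdot> act (f c))" using ty c by simp
    also have "\<dots> = \<iota> c \<cdot> act (f c)"
      by (rule reassoc[OF \<iota>d[OF b c]]) (use ty c in simp_all)
    finally show "(\<iota> b \<cdot> act (f b)) \<cdot> T\<^sub>a (j c b) = \<iota> c \<cdot> act (f c)" .
  qed blast
  obtain y e where ye: "is_pushout E m s y e" "e \<in> M"
    using cobase_change[of m s] cD(3,4) s(1) by auto
  \<comment> \<open>The definitive stage. Objects and maps of the chain up to \<open>a\<close> are
    those of the provisional \<open>g\<close>, so the corner carries over by locality.\<close>
  define h where "h = f(a := \<lparr>incl = i, leg = \<iota>, step = e, act = y\<rparr>)"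
  have hb: "h b = f b" if "b \<in> underS \<kappa> a" for b using notin[OF that] by (simp add: h_def)
  have ha: "h a = \<lparr>incl = i, leg = \<iota>, step = e, act = y\<rparr>" by (simp add: h_def)
  have ha': "incl (h a) = i" "leg (h a) = \<iota>" "step (h a) = e" "act (h a) = y" by (simp_all add: ha)
  have hX: "stage_obj h a = X a" using ha Xa by (simp add: stage_obj_def)
  have hc: "corner a (stage_obj h) (stage_map h) \<pi> \<rho> m"
  proof -
    have "corner a (stage_obj h) (stage_map h) \<pi> \<rho> m = corner a X j \<pi> \<rho> m"
    proof (rule corner_cong)
      show "stage_obj h b = X b" if "b \<in> insert a (underS \<kappa> a)" for b
        using that hb[of b] gb[of b] hX by (auto simp: stage_obj_def X_def)
      show "stage_map h c b = j c b" if "b \<in> insert a (underS \<kappa> a)" "c \<in> underS \<kappa> b" for b c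
        using that hb[of b] gb[of b] hb[of c] gb[of c] below[of b c] ga ha'
        by (auto simp: stage_map_def j_def)
    qed
    then show ?thesis using c by simp
  qed
  have colim: "cone_colimit \<kappa> (underS \<kappa> a) E' (\<lambda>b. amap F (step (h b) \<cdot> incl (h b)))
      (\<lambda>c b. amap F (step (h b) \<cdot> leg (h b) c)) (amap F i) (\<lambda>b. amap F (\<iota> b))"
    if "backdrop_preserving \<kappa> E M E' M' F" for E' :: "('o, 'a) cat" and M' F
    using univ[OF that] by (subst cone_colimit_cong) (use hb underS_trans in auto)
  have "is_stage A h a"
    unfolding is_stage_def ha' hX
    using i \<iota> \<iota>z \<iota>d ye s hc colim hb
    by (intro conjI ballI allI impI exI[of _ \<pi>] exI[of _ \<rho>] exI[of _ m] exI[of _ s]) simp_all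
  then show ?thesis unfolding h_def by blast
qed

end


text \<open>For invertible \<open>\<gamma>\<close> the last equation says that \<open>h\<close> is an algebra map from \<open>F X\<close> with the
  structure map \<open>F x \<cdot> \<gamma>\<^sup>-\<^sup>1\<close>.\<close>

definition is_free_along ::
  "('o, 'a) cat \<Rightarrow> ('o, 'a) ptd_endo \<Rightarrow> ('o, 'a, 'o, 'a) funct \<Rightarrow> ('o \<Rightarrow> 'a) \<Rightarrow> 'o \<Rightarrow> 'o \<Rightarrow> 'a \<Rightarrow> 'a \<Rightarrow> bool"
  where
  "is_free_along E T F \<gamma> A X x \<eta> \<longleftrightarrow>
     (\<forall>B \<in> Obj E. \<forall>b \<in> hom E (omap (endo T) B) B. \<forall>f \<in> hom E (omap F A) B.
        b \<cdot>\<^bsub>E\<^esub> point T B = Idn E B \<longrightarrow>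
        (\<exists>!h. h \<in> hom E (omap F X) B \<and> h \<cdot>\<^bsub>E\<^esub> amap F \<eta> = f \<and>
           h \<cdot>\<^bsub>E\<^esub> amap F x = b \<cdot>\<^bsub>E\<^esub> (amap (endo T) h \<cdot>\<^bsub>E\<^esub> \<gamma> X)))"

text \<open>The quantification over \<open>F\<close> lets a single choice of free algebra serve all
  morphisms out of the configuration. Freeness in \<open>E\<close> is the instance at the
  identity.\<close>

definition is_strongly_free ::
  "'k rel \<Rightarrow> ('o, 'a) cat \<Rightarrow> 'a set \<Rightarrow> ('o, 'a) ptd_endo \<Rightarrow> 'o \<Rightarrow> 'o \<Rightarrow> 'a \<Rightarrow> 'a \<Rightarrow> bool" where
  "is_strongly_free \<kappa> E M T A X x \<eta> \<longleftrightarrow>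
     X \<in> Obj E \<and> x \<in> hom E (omap (endo T) X) X \<and> x \<cdot>\<^bsub>E\<^esub> point T X = Idn E X \<and> \<eta> \<in> hom E A X \<and>
     (\<forall>E' M' T' F \<gamma>. is_ptd_endo E' T' \<and> (F, \<gamma>) \<in> ptd_strong_hom E T E' T' \<and>
        backdrop_preserving \<kappa> E M E' M' F \<longrightarrow> is_free_along E' T' F \<gamma> A X x \<eta>)"

lemma family_colimit_ex:
  assumes "family_colimit r C d X \<iota>" "B \<in> Obj C"
    and "\<And>j. j \<in> Field r \<Longrightarrow> g j \<in> hom C (Dom C (\<iota> j)) B"
    and "\<And>i j. j \<in> Field r \<Longrightarrow> i \<in> underS r j \<Longrightarrow> g j \<cdot>\<^bsub>C\<^esub> d i j = g i"
  obtains u where "u \<in> hom C X B" "\<And>j. j \<in> Field r \<Longrightarrow> u \<cdot>\<^bsub>C\<^esub> \<iota> j = g j"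
proof -
  have "\<exists>u \<in> hom C X B. \<forall>j \<in> Field r. u \<cdot>\<^bsub>C\<^esub> \<iota> j = g j"
    using assms unfolding family_colimit_def by blast
  then show ?thesis using that by blast
qed

lemma family_colimit_eq:
  assumes "family_colimit r C d X \<iota>" "u \<in> hom C X B" "v \<in> hom C X B"
    and "\<And>j. j \<in> Field r \<Longrightarrow> u \<cdot>\<^bsub>C\<^esub> \<iota> j = v \<cdot>\<^bsub>C\<^esub> \<iota> j"
  shows "u = v"
  using assms unfolding family_colimit_def by blast

context configuration
begin

lemma stages_exist:
  assumes "A \<in> Obj E"
  shows "\<exists>f. \<forall>a \<in> Field \<kappa>. is_stage A f a"
proof -
  \<comment> \<open>The trivial update separates the value chosen at \<open>a\<close> from the
    values below, which is the shape that dependent choice along a well-founded relation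
    expects.\<close>
  have "\<exists>f. \<forall>a. a \<in> Field \<kappa> \<longrightarrow> is_stage A (f(a := f a)) a"
  proof (rule dependent_wf_choice[OF wf_underS])
    fix f g :: "'k \<Rightarrow> ('k, 'a) stage" and a r
    assume "\<And>b. (b, a) \<in> {(b, a). b \<in> underS \<kappa> a} \<Longrightarrow> f b = g b"
    then have "is_stage A (f(a := r)) a = is_stage A (g(a := r)) a"
      by (intro is_stage_cong) auto
    then show "(a \<in> Field \<kappa> \<longrightarrow> is_stage A (f(a := r)) a) = (a \<in> Field \<kappa> \<longrightarrow> is_stage A (g(a := r)) a)"
      by simp
  next
    fix a and f :: "'k \<Rightarrow> ('k, 'a) stage"
    assume "\<And>b. (b, a) \<in> {(b, a). b \<in> underS \<kappa> a} \<Longrightarrow> b \<in> Field \<kappa> \<longrightarrow> is_stage A (f(b := f b)) b"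
    then have "is_stage A f b" if "b \<in> underS \<kappa> a" for b
      using that underS_in_Field[OF that] by auto
    then show "\<exists>r. a \<in> Field \<kappa> \<longrightarrow> is_stage A (f(a := r)) a"
      using stage_exists[OF _ assms] by blast
  qed
  then show ?thesis unfolding fun_upd_triv by blast
qed

end

section \<open>The colimit of the stages is a free algebra, also after applying a strong
  morphism\<close>

locale staged = configuration \<kappa> E M T
  for \<kappa> :: "'k rel" and E :: "('o, 'a) cat" (structure) and M T +
  fixes A :: 'o and f :: "'k \<Rightarrow> ('k, 'a) stage"
  assumes stages: "a \<in> Field \<kappa> \<Longrightarrow> is_stage A f a"
begin

abbreviation X where "X \<equiv> stage_obj f"
abbreviation j where "j \<equiv> stage_map f"
definition x :: "'k \<Rightarrow> 'k \<Rightarrow> 'a" where "x b a = leg (f a) b \<cdot> act (f b)"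

lemma stage_arr [simp]:
  assumes "a \<in> Field \<kappa>"
  shows "X a \<in> Obj E" "incl (f a) \<in> Arr E" "Dom E (incl (f a)) = A" "Cod E (incl (f a)) = X a"
    "step (f a) \<in> Arr E" "Dom E (step (f a)) = X a" "act (f a) \<in> Arr E"
    "Dom E (act (f a)) = T\<^sub>o (X a)" "Cod E (act (f a)) = Cod E (step (f a))"
  using is_stageD[OF stages[OF assms]] by simp_all

lemma chain_arr [simp]:
  assumes "b \<in> underS \<kappa> a"
  shows "leg (f a) b \<in> Arr E" "Dom E (leg (f a) b) = Cod E (step (f b))" "Cod E (leg (f a) b) = X a"
    "j b a \<in> M" "Dom E (j b a) = X b" "Cod E (j b a) = X a"
    "x b a \<in> Arr E" "Dom E (x b a) = T\<^sub>o (X b)" "Cod E (x b a) = X a"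
proof -
  have "a \<in> Field \<kappa>" "b \<in> Field \<kappa>" using underS_in_Field[OF assms] by auto
  then show "leg (f a) b \<in> Arr E" "Dom E (leg (f a) b) = Cod E (step (f b))" "Cod E (leg (f a) b) = X a"
    "j b a \<in> M" "Dom E (j b a) = X b" "Cod E (j b a) = X a"
    "x b a \<in> Arr E" "Dom E (x b a) = T\<^sub>o (X b)" "Cod E (x b a) = X a"
    using is_stageD[OF stages] stage_map_arr[OF stages stages assms] assms by (simp_all add: x_def)
qed

text \<open>The laws of the chain: under \<open>A\<close>, functorial in the stage, with actions of
  \<open>T (X b)\<close> on later stages that extend the chain maps along the point and are natural
  in both indices. Both \<open>j_x\<close> and \<open>x_T\<close> come down to equation
  \<open>1\<close>: acting at stage \<open>c\<close>, passing to \<open>b\<close>, stepping on and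
  entering \<open>a\<close> is acting from \<open>c\<close> into \<open>a\<close> directly.\<close>

lemma
  assumes ba: "b \<in> underS \<kappa> a"
  shows x_point: "x b a \<cdot> \<tau> (X b) = j b a"
    and j_incl: "j b a \<cdot> incl (f b) = incl (f a)"
    and j_j: "c \<in> underS \<kappa> b \<Longrightarrow> j b a \<cdot> j c b = j c a"
    and j_x: "c \<in> underS \<kappa> b \<Longrightarrow> j b a \<cdot> x c b = x c a"
    and x_T: "c \<in> underS \<kappa> b \<Longrightarrow> x b a \<cdot> T\<^sub>a (j c b) = x c a"
proof -
  have F: "a \<in> Field \<kappa>" "b \<in> Field \<kappa>" using underS_in_Field[OF ba] by auto
  show "x b a \<cdot> \<tau> (X b) = j b a"
    using ba F act_point[OF stages[OF F(2)]] by (simp add: x_def stage_map_def)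
  show "j b a \<cdot> incl (f b) = incl (f a)"
    using ba F is_stageD(12)[OF stages[OF F(1)] ba] by (simp add: stage_map_def)
  assume c: "c \<in> underS \<kappa> b"
  have Fc: "c \<in> Field \<kappa>" and ca: "c \<in> underS \<kappa> a"
    using underS_in_Field[OF c] underS_trans[OF c ba] by auto
  show "j b a \<cdot> j c b = j c a" by (rule stage_map_comp[OF stages stages stages]) fact+
  have "leg (f a) b \<cdot> ((step (f b) \<cdot> leg (f b) c) \<cdot> act (f c)) = leg (f a) c \<cdot> act (f c)"
    by (rule reassoc[OF is_stageD(13)[OF stages[OF F(1)] ba c]]) (use ba c F Fc in simp_all)
  then have 1: "leg (f a) b \<cdot> (step (f b) \<cdot> (leg (f b) c \<cdot> act (f c))) = x c a"
    using ba c F Fc by (simp add: x_def)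
  then show "j b a \<cdot> x c b = x c a" using ba c F Fc by (simp add: x_def stage_map_def)
  show "x b a \<cdot> T\<^sub>a (j c b) = x c a"
    using 1 act_T[OF stages[OF F(2)] c] ba c F Fc by (simp add: x_def)
qed

text \<open>The instance of \<open>attach_univ\<close> at the image of the chain. The data
  \<open>k b\<close> prescribe the values on \<open>T (X b)\<close>. They must give \<open>g\<close>
  on \<open>A\<close>, be natural in \<open>b\<close>, and, when restricted to \<open>X b\<close>
  along the point, agree with \<open>k c\<close> on what \<open>T (X c)\<close> contributed to
  \<open>X b\<close>.\<close>

lemma
  fixes E' :: "('o, 'a) cat"
  assumes a: "a \<in> Field \<kappa>" and F: "backdrop_preserving \<kappa> E M E' M' F"
  shows stage_univ_ex: "\<And>B g k. \<lbrakk>g \<in> hom E' (omap F A) B;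
      \<And>b. b \<in> underS \<kappa> a \<Longrightarrow> k b \<in> hom E' (omap F (T\<^sub>o (X b))) B;
      \<And>b. b \<in> underS \<kappa> a \<Longrightarrow> k b \<cdot>\<^bsub>E'\<^esub> (amap F (\<tau> (X b)) \<cdot>\<^bsub>E'\<^esub> amap F (incl (f b))) = g;
      \<And>b c. b \<in> underS \<kappa> a \<Longrightarrow> c \<in> underS \<kappa> b \<Longrightarrow> k b \<cdot>\<^bsub>E'\<^esub> amap F (T\<^sub>a (j c b)) = k c;
      \<And>b c. b \<in> underS \<kappa> a \<Longrightarrow> c \<in> underS \<kappa> b \<Longrightarrow>
        k b \<cdot>\<^bsub>E'\<^esub> (amap F (\<tau> (X b)) \<cdot>\<^bsub>E'\<^esub> amap F (x c b)) = k c\<rbrakk> \<Longrightarrow>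
      \<exists>u \<in> hom E' (omap F (X a)) B. u \<cdot>\<^bsub>E'\<^esub> amap F (incl (f a)) = g \<and>
        (\<forall>b \<in> underS \<kappa> a. u \<cdot>\<^bsub>E'\<^esub> amap F (x b a) = k b)"
    and stage_univ_eq: "\<And>B u v. \<lbrakk>u \<in> hom E' (omap F (X a)) B; v \<in> hom E' (omap F (X a)) B;
      u \<cdot>\<^bsub>E'\<^esub> amap F (incl (f a)) = v \<cdot>\<^bsub>E'\<^esub> amap F (incl (f a));
      \<And>b. b \<in> underS \<kappa> a \<Longrightarrow> u \<cdot>\<^bsub>E'\<^esub> amap F (x b a) = v \<cdot>\<^bsub>E'\<^esub> amap F (x b a)\<rbrakk> \<Longrightarrow> u = v"
proof -
  interpret F: cfunctor E E' F
    using F unfolding backdrop_preserving_def by unfold_locales blast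
  define P where "P b \<pi> \<rho> m s \<longleftrightarrow> corner b X j \<pi> \<rho> m \<and>
    s \<in> hom E (Cod E \<pi>) (X b) \<and> s \<cdot> \<pi> = Idn E (X b) \<and>
    (\<forall>c \<in> underS \<kappa> b. s \<cdot> \<rho> c = leg (f b) c \<cdot> act (f c)) \<and>
    is_pushout E m s (act (f b)) (step (f b))" for b \<pi> \<rho> m s
  have Field_b: "b \<in> Field \<kappa>" if "b \<in> underS \<kappa> a" for b using underS_in_Field[OF that] by simp
  have "\<exists>\<pi> \<rho> m s. P b \<pi> \<rho> m s" if b: "b \<in> underS \<kappa> a" for b
  proof -
    obtain \<pi> \<rho> m s where "corner b X j \<pi> \<rho> m"
      "s \<in> hom E (Cod E \<pi>) (X b)" "s \<cdot> \<pi> = Idn E (X b)"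
      "\<forall>c \<in> underS \<kappa> b. s \<cdot> \<rho> c = leg (f b) c \<cdot> act (f c)"
      "is_pushout E m s (act (f b)) (step (f b))"
      using stages[OF Field_b[OF b]] unfolding is_stage_def by blast
    then show ?thesis unfolding P_def by blast
  qed
  \<comment> \<open>Each stage only asserts that a corner and a folding map exist; here one of each
    is fixed for all stages below \<open>a\<close>.\<close>
  then obtain \<pi> \<rho> m s where P: "\<And>b. b \<in> underS \<kappa> a \<Longrightarrow> P b (\<pi> b) (\<rho> b) (m b) (s b)"
    by metis
  have cor: "corner b X j (\<pi> b) (\<rho> b) (m b)"
    and s: "s b \<in> Arr E" "Dom E (s b) = Cod E (\<pi> b)" "Cod E (s b) = X b" "s b \<cdot> \<pi> b = Idn E (X b)"
    and s\<rho>: "\<And>c. c \<in> underS \<kappa> b \<Longrightarrow> s b \<cdot> \<rho> b c = leg (f b) c \<cdot> act (f c)"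
    and po: "is_pushout E (m b) (s b) (act (f b)) (step (f b))"
    if "b \<in> underS \<kappa> a" for b using P[OF that] unfolding P_def by auto
  note cD = cornerD[OF cor]
  note univ = F.tgt.attach_univ[where \<kappa> = \<kappa> and I = "underS \<kappa> a"
      and z = "\<lambda>b. amap F (step (f b) \<cdot> incl (f b))"
      and dd = "\<lambda>c b. amap F (step (f b) \<cdot> leg (f b) c)" and ?i0.0 = "amap F (incl (f a))"
      and \<iota> = "\<lambda>b. amap F (leg (f a) b)" and e = "\<lambda>b. amap F (step (f b))"
      and i = "\<lambda>b. amap F (incl (f b))" and l = "\<lambda>b c. amap F (leg (f b) c)"
      and m = "\<lambda>b. amap F (m b)" and s = "\<lambda>b. amap F (s b)" and y = "\<lambda>b. amap F (act (f b))"
      and d = "\<lambda>c b. amap F (T\<^sub>a (j c b))" and j = "\<lambda>c b. amap F (j c b)"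
      and t = "\<lambda>b. amap F (\<tau> (X b))" and \<pi> = "\<lambda>b. amap F (\<pi> b)" and \<rho> = "\<lambda>b c. amap F (\<rho> b c)"]
  have prem:
    "cone_colimit \<kappa> (underS \<kappa> a) E' (\<lambda>b. amap F (step (f b) \<cdot> incl (f b)))
      (\<lambda>c b. amap F (step (f b) \<cdot> leg (f b) c)) (amap F (incl (f a))) (\<lambda>b. amap F (leg (f a) b))"
    "amap F (incl (f a)) \<in> Arr E'"
    using is_stageD(14)[OF stages[OF a] F] a by simp_all
  have prem_b:
    "amap F (leg (f a) b) \<in> hom E' (Cod E' (amap F (step (f b)))) (Cod E' (amap F (incl (f a))))"
    "amap F (step (f b) \<cdot> incl (f b)) = amap F (step (f b)) \<cdot>\<^bsub>E'\<^esub> amap F (incl (f b))"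
    "amap F (incl (f b)) \<in> hom E' (Dom E' (amap F (incl (f a)))) (Dom E' (amap F (step (f b))))"
    "is_pushout E' (amap F (m b)) (amap F (s b)) (amap F (act (f b))) (amap F (step (f b)))"
    "corner_colimit \<kappa> (underS \<kappa> b) E' (\<lambda>c b. amap F (T\<^sub>a (j c b))) (\<lambda>c. amap F (j c b))
      (\<lambda>b. amap F (\<tau> (X b))) (amap F (\<pi> b)) (\<lambda>c. amap F (\<rho> b c))"
    "amap F (\<pi> b) \<in> hom E' (Dom E' (amap F (step (f b)))) (Dom E' (amap F (m b)))"
    "amap F (\<tau> (X b)) \<in> hom E' (Dom E' (amap F (step (f b)))) (Dom E' (amap F (act (f b))))"
    "amap F (m b) \<cdot>\<^bsub>E'\<^esub> amap F (\<pi> b) = amap F (\<tau> (X b))"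
    "amap F (s b) \<cdot>\<^bsub>E'\<^esub> amap F (\<pi> b) = Idn E' (Dom E' (amap F (step (f b))))"
    "amap F (act (f b)) \<cdot>\<^bsub>E'\<^esub> amap F (\<tau> (X b)) = amap F (step (f b))"
    if b: "b \<in> underS \<kappa> a" for b
  proof -
    note ty = Field_b[OF b] b a cD(1-5)[OF b] s[OF b] M_arr[OF cD(3)[OF b]]
    show "amap F (leg (f a) b) \<in> hom E' (Cod E' (amap F (step (f b)))) (Cod E' (amap F (incl (f a))))"
      "amap F (step (f b) \<cdot> incl (f b)) = amap F (step (f b)) \<cdot>\<^bsub>E'\<^esub> amap F (incl (f b))"
      "amap F (incl (f b)) \<in> hom E' (Dom E' (amap F (incl (f a)))) (Dom E' (amap F (step (f b))))"
      "amap F (\<pi> b) \<in> hom E' (Dom E' (amap F (step (f b)))) (Dom E' (amap F (m b)))"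
      "amap F (\<tau> (X b)) \<in> hom E' (Dom E' (amap F (step (f b)))) (Dom E' (amap F (act (f b))))"
      using ty by simp_all
    show "is_pushout E' (amap F (m b)) (amap F (s b)) (amap F (act (f b))) (amap F (step (f b)))"
      using F po[OF b] cD(3)[OF b] unfolding backdrop_preserving_def by blast
    show "corner_colimit \<kappa> (underS \<kappa> b) E' (\<lambda>c b. amap F (T\<^sub>a (j c b))) (\<lambda>c. amap F (j c b))
      (\<lambda>b. amap F (\<tau> (X b))) (amap F (\<pi> b)) (\<lambda>c. amap F (\<rho> b c))"
      using cD(13)[OF b F] .
    show "amap F (m b) \<cdot>\<^bsub>E'\<^esub> amap F (\<pi> b) = amap F (\<tau> (X b))"
      using F.amap_eq[OF cD(6)[OF b]] ty by simp
    show "amap F (s b) \<cdot>\<^bsub>E'\<^esub> amap F (\<pi> b) = Idn E' (Dom E' (amap F (step (f b))))"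
      using F.amap_eq[OF s(4)[OF b]] ty by simp
    show "amap F (act (f b)) \<cdot>\<^bsub>E'\<^esub> amap F (\<tau> (X b)) = amap F (step (f b))"
      using F.amap_eq[OF act_point[OF stages[OF Field_b[OF b]]]] ty by simp
  qed
  have prem_c: "c \<in> underS \<kappa> a"
    "amap F (step (f b) \<cdot> leg (f b) c) = amap F (step (f b)) \<cdot>\<^bsub>E'\<^esub> amap F (leg (f b) c)"
    "amap F (leg (f b) c) \<in> hom E' (Cod E' (amap F (step (f c)))) (Dom E' (amap F (step (f b))))"
    "amap F (\<rho> b c) \<in> hom E' (Dom E' (amap F (act (f c)))) (Dom E' (amap F (m b)))"
    "amap F (m b) \<cdot>\<^bsub>E'\<^esub> amap F (\<rho> b c) = amap F (T\<^sub>a (j c b))"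
    "amap F (s b) \<cdot>\<^bsub>E'\<^esub> amap F (\<rho> b c) = amap F (leg (f b) c) \<cdot>\<^bsub>E'\<^esub> amap F (act (f c))"
    "amap F (T\<^sub>a (j c b)) \<in> hom E' (Dom E' (amap F (act (f c)))) (Dom E' (amap F (act (f b))))"
    if b: "b \<in> underS \<kappa> a" and c: "c \<in> underS \<kappa> b" for b c
  proof -
    show ca: "c \<in> underS \<kappa> a" using underS_trans[OF c b] .
    note ty = Field_b[OF b] Field_b[OF ca] b c a cD(1-5)[OF b] cD(7-9)[OF b c] s[OF b]
      M_arr[OF cD(3)[OF b]]
    show "amap F (step (f b) \<cdot> leg (f b) c) = amap F (step (f b)) \<cdot>\<^bsub>E'\<^esub> amap F (leg (f b) c)"
      "amap F (leg (f b) c) \<in> hom E' (Cod E' (amap F (step (f c)))) (Dom E' (amap F (step (f b))))"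
      "amap F (\<rho> b c) \<in> hom E' (Dom E' (amap F (act (f c)))) (Dom E' (amap F (m b)))"
      "amap F (T\<^sub>a (j c b)) \<in> hom E' (Dom E' (amap F (act (f c)))) (Dom E' (amap F (act (f b))))"
      using ty by simp_all
    show "amap F (m b) \<cdot>\<^bsub>E'\<^esub> amap F (\<rho> b c) = amap F (T\<^sub>a (j c b))"
      using F.amap_eq[OF cD(11)[OF b c]] ty by simp
    show "amap F (s b) \<cdot>\<^bsub>E'\<^esub> amap F (\<rho> b c) = amap F (leg (f b) c) \<cdot>\<^bsub>E'\<^esub> amap F (act (f c))"
      using F.amap_square[OF s\<rho>[OF b c]] ty by simp
  qed
  have x_F: "amap F (x b a') = amap F (leg (f a') b) \<cdot>\<^bsub>E'\<^esub> amap F (act (f b))"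
    if "b \<in> underS \<kappa> a'" for a' b using that underS_in_Field[OF that] by (simp add: x_def)
  have incl_a: "Dom E' (amap F (incl (f a))) = omap F A" "Cod E' (amap F (incl (f a))) = omap F (X a)"
    and act_b: "\<And>b. b \<in> underS \<kappa> a \<Longrightarrow> Dom E' (amap F (act (f b))) = omap F (T\<^sub>o (X b))"
    using a Field_b by simp_all
  {
    fix B g k
    assume 1: "g \<in> hom E' (omap F A) B"
      "\<And>b. b \<in> underS \<kappa> a \<Longrightarrow> k b \<in> hom E' (omap F (T\<^sub>o (X b))) B"
      "\<And>b. b \<in> underS \<kappa> a \<Longrightarrow> k b \<cdot>\<^bsub>E'\<^esub> (amap F (\<tau> (X b)) \<cdot>\<^bsub>E'\<^esub> amap F (incl (f b))) = g"
      "\<And>b c. b \<in> underS \<kappa> a \<Longrightarrow> c \<in> underS \<kappa> b \<Longrightarrow> k b \<cdot>\<^bsub>E'\<^esub> amap F (T\<^sub>a (j c b)) = k c"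
      "\<And>b c. b \<in> underS \<kappa> a \<Longrightarrow> c \<in> underS \<kappa> b \<Longrightarrow>
        k b \<cdot>\<^bsub>E'\<^esub> (amap F (\<tau> (X b)) \<cdot>\<^bsub>E'\<^esub> amap F (x c b)) = k c"
    have "\<exists>u \<in> hom E' (Cod E' (amap F (incl (f a)))) B. u \<cdot>\<^bsub>E'\<^esub> amap F (incl (f a)) = g \<and>
        (\<forall>b \<in> underS \<kappa> a. u \<cdot>\<^bsub>E'\<^esub> (amap F (leg (f a) b) \<cdot>\<^bsub>E'\<^esub> amap F (act (f b))) = k b)"
      by (rule univ(1)) (fact prem prem_b prem_c | simp only: 1 incl_a act_b flip: x_F)+
    then show "\<exists>u \<in> hom E' (omap F (X a)) B. u \<cdot>\<^bsub>E'\<^esub> amap F (incl (f a)) = g \<and>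
        (\<forall>b \<in> underS \<kappa> a. u \<cdot>\<^bsub>E'\<^esub> amap F (x b a) = k b)"
      by (simp only: incl_a x_F cong: ball_cong)
  }
  fix B u v
  assume "u \<in> hom E' (omap F (X a)) B" "v \<in> hom E' (omap F (X a)) B"
    "u \<cdot>\<^bsub>E'\<^esub> amap F (incl (f a)) = v \<cdot>\<^bsub>E'\<^esub> amap F (incl (f a))"
    "\<And>b. b \<in> underS \<kappa> a \<Longrightarrow> u \<cdot>\<^bsub>E'\<^esub> amap F (x b a) = v \<cdot>\<^bsub>E'\<^esub> amap F (x b a)"
  note 2 = this
  show "u = v"
    by (rule univ(2)[where B = B]) (fact prem prem_b prem_c | simp only: 2 incl_a act_b flip: x_F)+
qed


lemma free_algebra_of_stages:
  assumes limit: "limit_ordinal \<kappa>" "\<kappa> \<noteq> {}" and A: "A \<in> Obj E"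
  shows "\<exists>X x \<eta>. is_strongly_free \<kappa> E M T A X x \<eta>"
proof -
  \<comment> \<open>The limit property, applied to a singleton. A strictly larger index is
    essential, as \<open>T (X b)\<close> acts on stages strictly above \<open>b\<close>.\<close>
  have up: "\<exists>b. a \<in> underS \<kappa> b" if "a \<in> Field \<kappa>" for a
    using limit(1) that unfolding limit_ordinal_def by (auto dest!: spec[of _ "{a}"])
  obtain a0 where a0: "a0 \<in> Field \<kappa>" using limit(2) by (auto simp: Field_def)
  obtain L \<iota> where L: "L \<in> Obj E" and \<iota>': "\<And>b. b \<in> Field \<kappa> \<Longrightarrow> \<iota> b \<in> hom E (X b) L"
    and \<iota>j: "\<And>b c. c \<in> underS \<kappa> b \<Longrightarrow> \<iota> b \<cdot> j c b = \<iota> c"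
    and univ: "\<And>(E' :: ('o, 'a) cat) F. cat_functor E E' F \<Longrightarrow> preserves_chain_colimits \<kappa> E M E' F \<Longrightarrow>
      family_colimit \<kappa> E' (\<lambda>c b. amap F (j c b)) (omap F L) (\<lambda>b. amap F (\<iota> b))"
    by (rule long_colimit_exists[of X j]) (use j_j in auto)
  have \<iota> [simp]: "\<iota> b \<in> Arr E" "Dom E (\<iota> b) = X b" "Cod E (\<iota> b) = L" if "b \<in> Field \<kappa>" for b
    using \<iota>'[OF that] by auto
  \<comment> \<open>After passing to the colimit \<open>L\<close>, the action of
    \<open>T (X c)\<close> no longer depends on the stage in which it is performed.\<close>
  have \<iota>x: "\<iota> a \<cdot> x c a = \<iota> b \<cdot> x c b" if a: "c \<in> underS \<kappa> a" and b: "c \<in> underS \<kappa> b" for a b c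
  proof -
    have *: "\<iota> b \<cdot> x c b = \<iota> a \<cdot> x c a" if "c \<in> underS \<kappa> a" "c \<in> underS \<kappa> b" "a \<in> underS \<kappa> b" for a b
    proof -
      have F: "a \<in> Field \<kappa>" "b \<in> Field \<kappa>" using underS_in_Field[OF that(3)] by auto
      have "\<iota> b \<cdot> (j a b \<cdot> x c a) = \<iota> a \<cdot> x c a"
        by (rule reassoc[OF \<iota>j[OF that(3)]]) (use that F in simp_all)
      then show ?thesis using j_x[OF that(3,1)] by simp
    qed
    have "a = b \<or> a \<in> underS \<kappa> b \<or> b \<in> underS \<kappa> a"
      using underS_linear underS_in_Field[OF a] underS_in_Field[OF b] by blast
    then show ?thesis using *[of a b] *[of b a] a b by auto
  qed
  \<comment> \<open>Any stage gives the same unit; non-emptiness of the ordinal supplies the index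
    \<open>a0\<close>.\<close>
  define \<eta> where "\<eta> = \<iota> a0 \<cdot> incl (f a0)"
  have \<eta>: "\<iota> a \<cdot> incl (f a) = \<eta>" if a: "a \<in> Field \<kappa>" for a
  proof -
    have *: "\<iota> b \<cdot> incl (f b) = \<iota> a \<cdot> incl (f a)" if "a \<in> underS \<kappa> b" for a b
    proof -
      have F: "a \<in> Field \<kappa>" "b \<in> Field \<kappa>" using underS_in_Field[OF that] by auto
      have "\<iota> b \<cdot> (j a b \<cdot> incl (f a)) = \<iota> a \<cdot> incl (f a)"
        by (rule reassoc[OF \<iota>j[OF that]]) (use that F in simp_all)
      then show ?thesis using j_incl[OF that] by simp
    qed
    show ?thesis using underS_linear[OF a a0] *[of a a0] *[of a0 a] unfolding \<eta>_def by auto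
  qed
  have \<eta>_arr: "\<eta> \<in> Arr E" "Dom E \<eta> = A" "Cod E \<eta> = L" using a0 unfolding \<eta>_def by simp_all
  \<comment> \<open>An arbitrary stage above each index; by \<open>\<iota>x\<close> the choice does
    not influence the structure map.\<close>
  define s where "s a = (SOME b. a \<in> underS \<kappa> b)" for a
  have s: "a \<in> underS \<kappa> (s a)" "s a \<in> Field \<kappa>" if "a \<in> Field \<kappa>" for a
  proof -
    show "a \<in> underS \<kappa> (s a)" unfolding s_def using up[OF that] by (rule someI_ex)
    then show "s a \<in> Field \<kappa>" using underS_in_Field by blast
  qed
  \<comment> \<open>Since \<open>T\<close> preserves the colimit of the stages, a structure map on
    \<open>L\<close> may be given on each \<open>T (X b)\<close> separately.\<close>
  have TL: "family_colimit \<kappa> E (\<lambda>c b. T\<^sub>a (j c b)) (T\<^sub>o L) (\<lambda>b. T\<^sub>a (\<iota> b))"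
    by (rule univ[OF T.is_functor T_chains])
  obtain xL where xL: "xL \<in> hom E (T\<^sub>o L) L"
    and xL_s: "\<And>b. b \<in> Field \<kappa> \<Longrightarrow> xL \<cdot> T\<^sub>a (\<iota> b) = \<iota> (s b) \<cdot> x b (s b)"
  proof (rule family_colimit_ex[OF TL L, of "\<lambda>b. \<iota> (s b) \<cdot> x b (s b)"])
    fix b assume b: "b \<in> Field \<kappa>"
    show "\<iota> (s b) \<cdot> x b (s b) \<in> hom E (Dom E (T\<^sub>a (\<iota> b))) L" using s[OF b] b by simp
    fix c assume c: "c \<in> underS \<kappa> b"
    have cF: "c \<in> Field \<kappa>" using underS_in_Field[OF c] by simp
    have "(\<iota> (s b) \<cdot> x b (s b)) \<cdot> T\<^sub>a (j c b) = \<iota> (s b) \<cdot> x c (s b)"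
      using s[OF b] b c x_T[OF s(1)[OF b] c] by simp
    also have "\<dots> = \<iota> (s c) \<cdot> x c (s c)"
      by (rule \<iota>x[OF underS_trans[OF c s(1)[OF b]] s(1)[OF cF]])
    finally show "(\<iota> (s b) \<cdot> x b (s b)) \<cdot> T\<^sub>a (j c b) = \<iota> (s c) \<cdot> x c (s c)" .
  qed blast
  have xL_arr: "xL \<in> Arr E" "Dom E xL = T\<^sub>o L" "Cod E xL = L" using xL by auto
  have xL_eq: "xL \<cdot> T\<^sub>a (\<iota> b) = \<iota> a \<cdot> x b a" if "b \<in> underS \<kappa> a" for a b
    using xL_s[of b] \<iota>x[OF that s(1)] underS_in_Field[OF that] by simp
  have "xL \<cdot> \<tau> L = Idn E L"
  proof -
    have "family_colimit \<kappa> E (\<lambda>c b. amap (id_functor E) (j c b)) (omap (id_functor E) L)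
        (\<lambda>b. amap (id_functor E) (\<iota> b))"
      by (rule univ[OF cat_functor_id[OF category_axioms] preserves_chain_colimits_id])
    then show ?thesis
    proof (rule family_colimit_eq[of _ _ _ _ _ _ L])
      show "xL \<cdot> \<tau> L \<in> hom E (omap (id_functor E) L) L" "Idn E L \<in> hom E (omap (id_functor E) L) L"
        using xL_arr L by simp_all
      fix b assume b: "b \<in> Field \<kappa>"
      have "(xL \<cdot> \<tau> L) \<cdot> \<iota> b = xL \<cdot> (T\<^sub>a (\<iota> b) \<cdot> \<tau> (X b))"
        using xL_arr L b point_nat[of "\<iota> b" "X b" L] by simp
      also have "\<dots> = (\<iota> (s b) \<cdot> x b (s b)) \<cdot> \<tau> (X b)"
        by (rule reassoc[OF xL_s[OF b]]) (use xL_arr b in simp_all)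
      also have "\<dots> = \<iota> b"
        using s[OF b] b x_point[OF s(1)[OF b]] \<iota>j[OF s(1)[OF b]] by simp
      finally show "(xL \<cdot> \<tau> L) \<cdot> amap (id_functor E) (\<iota> b) = Idn E L \<cdot> amap (id_functor E) (\<iota> b)"
        using b by simp
    qed
  qed
  moreover have "is_free_along E' T' F \<gamma> A L xL \<eta>"
    if T': "is_ptd_endo E' T'" and F\<gamma>: "(F, \<gamma>) \<in> ptd_strong_hom E T E' T'"
      and F: "backdrop_preserving \<kappa> E M E' M' F"
    for E' :: "('o, 'a) cat" and M' T' F \<gamma>
    unfolding is_free_along_def
  proof (intro ballI impI)
    interpret T': cfunctor E' E' "endo T'"
      using T' unfolding is_ptd_endo_def nat_trans_def by unfold_locales blast
    interpret F: cfunctor E E' F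
      using F unfolding backdrop_preserving_def by unfold_locales blast
    have pt: "point T' C \<in> Arr E'" "Dom E' (point T' C) = C" "Cod E' (point T' C) = omap (endo T') C"
      if "C \<in> Obj E'" for C using T' that unfolding is_ptd_endo_def nat_trans_def by auto
    have pt_nat: "point T' (Cod E' g) \<cdot>\<^bsub>E'\<^esub> g = amap (endo T') g \<cdot>\<^bsub>E'\<^esub> point T' (Dom E' g)"
      if "g \<in> Arr E'" for g using T' that unfolding is_ptd_endo_def nat_trans_def by auto
    have \<gamma>: "\<gamma> C \<in> Arr E'" "Dom E' (\<gamma> C) = omap F (T\<^sub>o C)" "Cod E' (\<gamma> C) = omap (endo T') (omap F C)"
      and \<gamma>_pt: "\<gamma> C \<cdot>\<^bsub>E'\<^esub> amap F (\<tau> C) = point T' (omap F C)"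
      if "C \<in> Obj E" for C
      using F\<gamma> that unfolding ptd_strong_hom_def nat_iso_def nat_trans_def by auto
    have \<gamma>_nat: "\<gamma> (Cod E g) \<cdot>\<^bsub>E'\<^esub> amap F (T\<^sub>a g) = amap (endo T') (amap F g) \<cdot>\<^bsub>E'\<^esub> \<gamma> (Dom E g)"
      if "g \<in> Arr E" for g
      using F\<gamma> that unfolding ptd_strong_hom_def nat_iso_def nat_trans_def by auto
    fix B b g
    assume B: "B \<in> Obj E'" and "b \<in> hom E' (omap (endo T') B) B" and "g \<in> hom E' (omap F A) B"
      and b_pt: "b \<cdot>\<^bsub>E'\<^esub> point T' B = Idn E' B"
    then have b: "b \<in> Arr E'" "Dom E' b = omap (endo T') B" "Cod E' b = B"
      and g: "g \<in> Arr E'" "Dom E' g = omap F A" "Cod E' g = B" by auto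
    \<comment> \<open>Extends \<open>h\<close> on \<open>F C\<close> to \<open>F (T C)\<close>:
      apply \<open>\<gamma>\<close>, then \<open>T'\<close> of \<open>h\<close>, then the structure
      map \<open>b\<close>. The unit law of \<open>b\<close> makes this an extension along the
      point, and naturality of \<open>\<gamma>\<close> makes it natural in \<open>C\<close>.\<close>
    define ext where "ext h C = b \<cdot>\<^bsub>E'\<^esub> (amap (endo T') h \<cdot>\<^bsub>E'\<^esub> \<gamma> C)" for h C
    have ext: "ext h C \<in> Arr E'" "Dom E' (ext h C) = omap F (T\<^sub>o C)" "Cod E' (ext h C) = B"
      and ext_pt: "ext h C \<cdot>\<^bsub>E'\<^esub> amap F (\<tau> C) = h"
      if h: "h \<in> hom E' (omap F C) B" and C: "C \<in> Obj E" for h C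
    proof -
      have h: "h \<in> Arr E'" "Dom E' h = omap F C" "Cod E' h = B" using h by auto
      show "ext h C \<in> Arr E'" "Dom E' (ext h C) = omap F (T\<^sub>o C)" "Cod E' (ext h C) = B"
        using h b \<gamma>[OF C] unfolding ext_def by simp_all
      have "ext h C \<cdot>\<^bsub>E'\<^esub> amap F (\<tau> C) = b \<cdot>\<^bsub>E'\<^esub> (amap (endo T') h \<cdot>\<^bsub>E'\<^esub> point T' (omap F C))"
        using h b C \<gamma>[OF C] \<gamma>_pt[OF C] unfolding ext_def by simp
      also have "\<dots> = b \<cdot>\<^bsub>E'\<^esub> (point T' B \<cdot>\<^bsub>E'\<^esub> h)" using pt_nat[OF h(1)] h by simp
      also have "\<dots> = Idn E' B \<cdot>\<^bsub>E'\<^esub> h"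
        by (rule T'.src.reassoc[OF b_pt]) (use h b pt[OF B] in simp_all)
      finally show "ext h C \<cdot>\<^bsub>E'\<^esub> amap F (\<tau> C) = h" using h by simp
    qed
    have ext_T: "ext h (Cod E k) \<cdot>\<^bsub>E'\<^esub> amap F (T\<^sub>a k) = ext (h \<cdot>\<^bsub>E'\<^esub> amap F k) (Dom E k)"
      if h: "h \<in> hom E' (omap F (Cod E k)) B" and k: "k \<in> Arr E" for h k
      using h k b \<gamma>[of "Cod E k"] \<gamma>[of "Dom E k"] \<gamma>_nat[OF k] unfolding ext_def by simp
    define P where "P h a r \<longleftrightarrow> (a \<in> Field \<kappa> \<longrightarrow> r \<in> hom E' (omap F (X a)) B \<and>
        r \<cdot>\<^bsub>E'\<^esub> amap F (incl (f a)) = g \<and>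
        (\<forall>c \<in> underS \<kappa> a. r \<cdot>\<^bsub>E'\<^esub> amap F (x c a) = ext (h c) (X c)))" for h a r
    \<comment> \<open>Compatibility with the chain maps need not be built into the recursion:
      \<open>j c a\<close> is \<open>x c a\<close> after the point, and \<open>ext\<close> undoes
      the point.\<close>
    have P_j: "r \<cdot>\<^bsub>E'\<^esub> amap F (j c a) = h c"
      if P: "P h a r" and Pc: "P h c (h c)" and c: "c \<in> underS \<kappa> a" for h a r c
    proof -
      have Fi: "a \<in> Field \<kappa>" "c \<in> Field \<kappa>" using underS_in_Field[OF c] by auto
      have r: "r \<in> Arr E'" "Dom E' r = omap F (X a)" "r \<cdot>\<^bsub>E'\<^esub> amap F (x c a) = ext (h c) (X c)"
        and hc: "h c \<in> hom E' (omap F (X c)) B"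
        using P Pc c Fi unfolding P_def by auto
      have "r \<cdot>\<^bsub>E'\<^esub> amap F (j c a) = r \<cdot>\<^bsub>E'\<^esub> (amap F (x c a) \<cdot>\<^bsub>E'\<^esub> amap F (\<tau> (X c)))"
        using F.amap_eq[OF x_point[OF c]] c Fi by simp
      also have "\<dots> = ext (h c) (X c) \<cdot>\<^bsub>E'\<^esub> amap F (\<tau> (X c))"
        by (rule T'.src.reassoc[OF r(3)]) (use r c Fi in simp_all)
      finally show ?thesis using ext_pt[OF hc] Fi by simp
    qed
    have "\<exists>h. \<forall>a. P h a (h a)"
    proof (rule dependent_wf_choice[OF wf_underS])
      show "P h a r = P h' a r" if "\<And>c. (c, a) \<in> {(b, a). b \<in> underS \<kappa> a} \<Longrightarrow> h c = h' c" for h h' a r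
        using that by (simp add: P_def)
      fix a h
      assume IH: "\<And>c. (c, a) \<in> {(b, a). b \<in> underS \<kappa> a} \<Longrightarrow> P h c (h c)"
      show "\<exists>r. P h a r"
      proof (cases "a \<in> Field \<kappa>")
        case False
        then show ?thesis by (simp add: P_def)
      next
        case a: True
        have Pc: "P h c (h c)" and hc: "h c \<in> hom E' (omap F (X c)) B"
          and hi: "h c \<cdot>\<^bsub>E'\<^esub> amap F (incl (f c)) = g" and cF: "c \<in> Field \<kappa>"
          if "c \<in> underS \<kappa> a" for c
          using IH[of c] that underS_in_Field[OF that] unfolding P_def by auto
        have tau: "ext (h c) (X c) \<cdot>\<^bsub>E'\<^esub> (amap F (\<tau> (X c)) \<cdot>\<^bsub>E'\<^esub> z) = h c \<cdot>\<^bsub>E'\<^esub> z"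
          if c: "c \<in> underS \<kappa> a" and z: "z \<in> Arr E'" "Cod E' z = omap F (X c)" for c z
          by (rule T'.src.reassoc[OF ext_pt[OF hc[OF c]]])
            (use z cF[OF c] ext[OF hc[OF c]] in simp_all)
        have "\<exists>u \<in> hom E' (omap F (X a)) B. u \<cdot>\<^bsub>E'\<^esub> amap F (incl (f a)) = g \<and>
            (\<forall>c \<in> underS \<kappa> a. u \<cdot>\<^bsub>E'\<^esub> amap F (x c a) = ext (h c) (X c))"
        proof (rule stage_univ_ex[OF a F])
          show "g \<in> hom E' (omap F A) B" using g by simp
          fix c assume c: "c \<in> underS \<kappa> a"
          show "ext (h c) (X c) \<in> hom E' (omap F (T\<^sub>o (X c))) B"
            using ext[OF hc[OF c]] cF[OF c] by simp
          show "ext (h c) (X c) \<cdot>\<^bsub>E'\<^esub> (amap F (\<tau> (X c)) \<cdot>\<^bsub>E'\<^esub> amap F (incl (f c))) = g"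
            using tau[OF c] hi[OF c] cF[OF c] by simp
          fix e assume e: "e \<in> underS \<kappa> c"
          have ea: "e \<in> underS \<kappa> a" by (rule underS_trans[OF e c])
          have "h c \<cdot>\<^bsub>E'\<^esub> amap F (j e c) = h e" by (rule P_j[OF Pc[OF c] Pc[OF ea] e])
          then show "ext (h c) (X c) \<cdot>\<^bsub>E'\<^esub> amap F (T\<^sub>a (j e c)) = ext (h e) (X e)"
            using ext_T[of "h c" "j e c"] hc[OF c] e by simp
          show "ext (h c) (X c) \<cdot>\<^bsub>E'\<^esub> (amap F (\<tau> (X c)) \<cdot>\<^bsub>E'\<^esub> amap F (x e c)) = ext (h e) (X e)"
            using tau[OF c, of "amap F (x e c)"] e Pc[OF c] cF[OF c] unfolding P_def by simp
        qed
        then show ?thesis unfolding P_def by blast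
      qed
    qed
    then obtain h where P: "\<And>a. P h a (h a)" by blast
    have h: "h a \<in> Arr E'" "Dom E' (h a) = omap F (X a)" "Cod E' (h a) = B"
      and h_incl: "h a \<cdot>\<^bsub>E'\<^esub> amap F (incl (f a)) = g"
      and h_x: "\<And>c. c \<in> underS \<kappa> a \<Longrightarrow> h a \<cdot>\<^bsub>E'\<^esub> amap F (x c a) = ext (h c) (X c)"
      if "a \<in> Field \<kappa>" for a using P[of a] that unfolding P_def by auto
    have Fpres: "preserves_chain_colimits \<kappa> E M E' F"
      using F unfolding backdrop_preserving_def by blast
    have FL: "family_colimit \<kappa> E' (\<lambda>c b. amap F (j c b)) (omap F L) (\<lambda>b. amap F (\<iota> b))"
      by (rule univ[OF F.is_functor Fpres])
    \<comment> \<open>Maps out of \<open>F (T L)\<close> are to be compared stagewise. For this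
      \<open>F\<close> after \<open>T\<close> has to preserve the colimit, which uses that
      \<open>T\<close> keeps chains within \<open>M\<close>.\<close>
    have FT: "cat_functor E E' (comp_functor E F (endo T))"
      by (rule cat_functor_comp[OF T.is_functor F.is_functor])
    have FTpres: "preserves_chain_colimits \<kappa> E M E' (comp_functor E F (endo T))"
      by (rule preserves_chain_colimits_comp[OF T_chains Fpres T.is_functor wide wide Tar_M])
    have FTL: "family_colimit \<kappa> E' (\<lambda>c b. amap (comp_functor E F (endo T)) (j c b))
        (omap (comp_functor E F (endo T)) L) (\<lambda>b. amap (comp_functor E F (endo T)) (\<iota> b))"
      by (rule univ[OF FT FTpres])
    have FxL: "amap F xL \<cdot>\<^bsub>E'\<^esub> amap F (T\<^sub>a (\<iota> c)) = amap F (\<iota> a) \<cdot>\<^bsub>E'\<^esub> amap F (x c a)"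
      if "c \<in> underS \<kappa> a" for a c
      using F.amap_square[OF xL_eq[OF that]] xL_arr that underS_in_Field[OF that] by simp
    have F\<eta>: "amap F (\<iota> a) \<cdot>\<^bsub>E'\<^esub> amap F (incl (f a)) = amap F \<eta>" if "a \<in> Field \<kappa>" for a
      using F.amap_eq[OF \<eta>[OF that]] that by simp
    obtain u where u': "u \<in> hom E' (omap F L) B" and u\<iota>: "\<And>a. a \<in> Field \<kappa> \<Longrightarrow> u \<cdot>\<^bsub>E'\<^esub> amap F (\<iota> a) = h a"
    proof (rule family_colimit_ex[OF FL B, of h])
      show "h a \<in> hom E' (Dom E' (amap F (\<iota> a))) B" if "a \<in> Field \<kappa>" for a
        using that h by simp
      show "h a \<cdot>\<^bsub>E'\<^esub> amap F (j c a) = h c" if "c \<in> underS \<kappa> a" for a c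
        by (rule P_j[OF P P that])
    qed blast
    have u: "u \<in> Arr E'" "Dom E' u = omap F L" "Cod E' u = B" using u' by auto
    show "\<exists>!h. h \<in> hom E' (omap F L) B \<and> h \<cdot>\<^bsub>E'\<^esub> amap F \<eta> = g \<and>
        h \<cdot>\<^bsub>E'\<^esub> amap F xL = b \<cdot>\<^bsub>E'\<^esub> (amap (endo T') h \<cdot>\<^bsub>E'\<^esub> \<gamma> L)"
    proof (rule ex1I[of _ u], intro conjI)
      show "u \<in> hom E' (omap F L) B" by fact
      have "u \<cdot>\<^bsub>E'\<^esub> (amap F (\<iota> a0) \<cdot>\<^bsub>E'\<^esub> amap F (incl (f a0))) = h a0 \<cdot>\<^bsub>E'\<^esub> amap F (incl (f a0))"
        by (rule T'.src.reassoc[OF u\<iota>[OF a0]]) (use u a0 in simp_all)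
      then show "u \<cdot>\<^bsub>E'\<^esub> amap F \<eta> = g" using F\<eta>[OF a0] h_incl[OF a0] by simp
      \<comment> \<open>That \<open>u\<close> is an algebra map is tested on each
        \<open>F (T (X c))\<close>. There \<open>xL\<close> acts in the later stage
        \<open>s c\<close>, where the recursion prescribed the value of \<open>h (s c)\<close> as an
        extension of \<open>h c\<close>.\<close>
      have "u \<cdot>\<^bsub>E'\<^esub> amap F xL = ext u L"
      proof (rule family_colimit_eq[OF FTL, of _ B])
        show "u \<cdot>\<^bsub>E'\<^esub> amap F xL \<in> hom E' (omap (comp_functor E F (endo T)) L) B"
          "ext u L \<in> hom E' (omap (comp_functor E F (endo T)) L) B"
          using u xL_arr L ext[of u L] by simp_all
        fix c assume c: "c \<in> Field \<kappa>"
        note sc = s[OF c]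
        have "(u \<cdot>\<^bsub>E'\<^esub> amap F xL) \<cdot>\<^bsub>E'\<^esub> amap F (T\<^sub>a (\<iota> c)) =
            u \<cdot>\<^bsub>E'\<^esub> (amap F (\<iota> (s c)) \<cdot>\<^bsub>E'\<^esub> amap F (x c (s c)))"
          using u xL_arr c FxL[OF sc(1)] by simp
        also have "\<dots> = h (s c) \<cdot>\<^bsub>E'\<^esub> amap F (x c (s c))"
          by (rule T'.src.reassoc[OF u\<iota>[OF sc(2)]]) (use u sc in simp_all)
        also have "\<dots> = ext (h c) (X c)" by (rule h_x[OF sc(2,1)])
        also have "\<dots> = ext u L \<cdot>\<^bsub>E'\<^esub> amap F (T\<^sub>a (\<iota> c))"
          using ext_T[of u "\<iota> c"] u c u\<iota>[OF c] by simp
        finally show "(u \<cdot>\<^bsub>E'\<^esub> amap F xL) \<cdot>\<^bsub>E'\<^esub> amap (comp_functor E F (endo T)) (\<iota> c) =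
            ext u L \<cdot>\<^bsub>E'\<^esub> amap (comp_functor E F (endo T)) (\<iota> c)" using c by simp
      qed
      then show "u \<cdot>\<^bsub>E'\<^esub> amap F xL = b \<cdot>\<^bsub>E'\<^esub> (amap (endo T') u \<cdot>\<^bsub>E'\<^esub> \<gamma> L)" unfolding ext_def .
      fix v
      assume v': "v \<in> hom E' (omap F L) B \<and> v \<cdot>\<^bsub>E'\<^esub> amap F \<eta> = g \<and>
        v \<cdot>\<^bsub>E'\<^esub> amap F xL = b \<cdot>\<^bsub>E'\<^esub> (amap (endo T') v \<cdot>\<^bsub>E'\<^esub> \<gamma> L)"
      then have v: "v \<in> Arr E'" "Dom E' v = omap F L" "Cod E' v = B"
        and v\<eta>: "v \<cdot>\<^bsub>E'\<^esub> amap F \<eta> = g" and vx: "v \<cdot>\<^bsub>E'\<^esub> amap F xL = ext v L"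
        by (auto simp: ext_def)
      \<comment> \<open>Any solution restricts to the same \<open>h\<close> by induction: on
        \<open>T (X c)\<close> with \<open>c < a\<close> the algebra equation expresses it through
        its restriction to \<open>X c\<close>.\<close>
      have v\<iota>: "a \<in> Field \<kappa> \<longrightarrow> v \<cdot>\<^bsub>E'\<^esub> amap F (\<iota> a) = h a" for a
      proof (induction a rule: wf_induct_rule[OF wf_underS])
        case (1 a)
        show ?case
        proof
          assume a: "a \<in> Field \<kappa>"
          show "v \<cdot>\<^bsub>E'\<^esub> amap F (\<iota> a) = h a"
          proof (rule stage_univ_eq[OF a F, of _ B])
            show "v \<cdot>\<^bsub>E'\<^esub> amap F (\<iota> a) \<in> hom E' (omap F (X a)) B" "h a \<in> hom E' (omap F (X a)) B"
              using v a h[OF a] by simp_all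
            show "(v \<cdot>\<^bsub>E'\<^esub> amap F (\<iota> a)) \<cdot>\<^bsub>E'\<^esub> amap F (incl (f a)) = h a \<cdot>\<^bsub>E'\<^esub> amap F (incl (f a))"
              using v a F\<eta>[OF a] v\<eta> h_incl[OF a] by simp
            fix c assume c: "c \<in> underS \<kappa> a"
            have cF: "c \<in> Field \<kappa>" using underS_in_Field[OF c] by simp
            have "(v \<cdot>\<^bsub>E'\<^esub> amap F (\<iota> a)) \<cdot>\<^bsub>E'\<^esub> amap F (x c a) = v \<cdot>\<^bsub>E'\<^esub> (amap F xL \<cdot>\<^bsub>E'\<^esub> amap F (T\<^sub>a (\<iota> c)))"
              using v a c FxL[OF c] by simp
            also have "\<dots> = ext v L \<cdot>\<^bsub>E'\<^esub> amap F (T\<^sub>a (\<iota> c))"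
              by (rule T'.src.reassoc[OF vx]) (use v xL_arr cF in simp_all)
            also have "\<dots> = ext (h c) (X c)"
              using ext_T[of v "\<iota> c"] v cF 1[of c] c by simp
            finally show "(v \<cdot>\<^bsub>E'\<^esub> amap F (\<iota> a)) \<cdot>\<^bsub>E'\<^esub> amap F (x c a) = h a \<cdot>\<^bsub>E'\<^esub> amap F (x c a)"
              using h_x[OF a c] by simp
          qed
        qed
      qed
      show "v = u"
        by (rule family_colimit_eq[OF FL, of _ B]) (use v u v\<iota> u\<iota> in simp_all)
    qed
  qed
  ultimately show ?thesis
    unfolding is_strongly_free_def
    using L xL \<eta>_arr by (intro exI[of _ L] exI[of _ xL] exI[of _ \<eta>]) auto
qed

end

theorem (in configuration) free_algebra_exists:
  assumes "limit_ordinal \<kappa>" "\<kappa> \<noteq> {}" "A \<in> Obj E"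
  shows "\<exists>X x \<eta>. is_strongly_free \<kappa> E M T A X x \<eta>"
proof -
  obtain f where "\<forall>a \<in> Field \<kappa>. is_stage A f a" using stages_exist[OF assms(3)] by blast
  then interpret staged \<kappa> E M T A f by unfold_locales blast
  show ?thesis by (rule free_algebra_of_stages[OF assms])
qed


section \<open>The monad of free algebras\<close>

lemma is_monadD:
  assumes "is_monad E M"
  shows "is_ptd_endo E (ptd_of M)" "cat_functor E E (endo M)"
    "\<And>A. A \<in> Obj E \<Longrightarrow> point M A \<in> hom E A (omap (endo M) A)"
    "\<And>f. f \<in> Arr E \<Longrightarrow> point M (Cod E f) \<cdot>\<^bsub>E\<^esub> f = amap (endo M) f \<cdot>\<^bsub>E\<^esub> point M (Dom E f)"
    "\<And>A. A \<in> Obj E \<Longrightarrow> multn M A \<in> hom E (omap (endo M) (omap (endo M) A)) (omap (endo M) A)"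
    "\<And>f. f \<in> Arr E \<Longrightarrow>
      multn M (Cod E f) \<cdot>\<^bsub>E\<^esub> amap (endo M) (amap (endo M) f) = amap (endo M) f \<cdot>\<^bsub>E\<^esub> multn M (Dom E f)"
    "\<And>A. A \<in> Obj E \<Longrightarrow> multn M A \<cdot>\<^bsub>E\<^esub> point M (omap (endo M) A) = Idn E (omap (endo M) A)"
    "\<And>A. A \<in> Obj E \<Longrightarrow> multn M A \<cdot>\<^bsub>E\<^esub> amap (endo M) (point M A) = Idn E (omap (endo M) A)"
    "\<And>A. A \<in> Obj E \<Longrightarrow>
      multn M A \<cdot>\<^bsub>E\<^esub> multn M (omap (endo M) A) = multn M A \<cdot>\<^bsub>E\<^esub> amap (endo M) (multn M A)"
proof -
  show pt: "is_ptd_endo E (ptd_of M)" using assms unfolding is_monad_def by blast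
  show fu: "cat_functor E E (endo M)"
    using assms unfolding is_monad_def nat_trans_def by blast
  then interpret cfunctor E E "endo M" by unfold_locales
  show "\<And>A. A \<in> Obj E \<Longrightarrow> point M A \<in> hom E A (omap (endo M) A)"
    "\<And>f. f \<in> Arr E \<Longrightarrow> point M (Cod E f) \<cdot>\<^bsub>E\<^esub> f = amap (endo M) f \<cdot>\<^bsub>E\<^esub> point M (Dom E f)"
    using pt unfolding is_ptd_endo_def nat_trans_def by (simp_all add: ptd_of_def)
  show "\<And>A. A \<in> Obj E \<Longrightarrow> multn M A \<in> hom E (omap (endo M) (omap (endo M) A)) (omap (endo M) A)"
    "\<And>f. f \<in> Arr E \<Longrightarrow>
      multn M (Cod E f) \<cdot>\<^bsub>E\<^esub> amap (endo M) (amap (endo M) f) = amap (endo M) f \<cdot>\<^bsub>E\<^esub> multn M (Dom E f)"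
    using assms unfolding is_monad_def nat_trans_def by simp_all
  show "\<And>A. A \<in> Obj E \<Longrightarrow> multn M A \<cdot>\<^bsub>E\<^esub> point M (omap (endo M) A) = Idn E (omap (endo M) A)"
    "\<And>A. A \<in> Obj E \<Longrightarrow> multn M A \<cdot>\<^bsub>E\<^esub> amap (endo M) (point M A) = Idn E (omap (endo M) A)"
    "\<And>A. A \<in> Obj E \<Longrightarrow>
      multn M A \<cdot>\<^bsub>E\<^esub> multn M (omap (endo M) A) = multn M A \<cdot>\<^bsub>E\<^esub> amap (endo M) (multn M A)"
    using assms unfolding is_monad_def by simp_all
qed

text \<open>Covers the algebras of the pointed endofunctor and of the monad alike, with
  \<open>X\<close> the set of objects satisfying the respective laws.\<close>

lemma category_algebras:
  assumes "cat_functor E E P"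
    and X: "\<And>A a. (A, a) \<in> X \<Longrightarrow> A \<in> Obj E \<and> a \<in> hom E (omap P A) A"
  shows "category (concrete_cat X (\<lambda>(A, a) (B, b). {f \<in> hom E A B. f \<cdot>\<^bsub>E\<^esub> a = b \<cdot>\<^bsub>E\<^esub> amap P f})
     (\<lambda>(A, a). Idn E A) (\<lambda>x y z g f. g \<cdot>\<^bsub>E\<^esub> f))"
proof (rule category_concrete_cat)
  interpret P: cfunctor E E P by standard fact
  note X' = X[unfolded in_hom]
  show "(case x of (A, a) \<Rightarrow> Idn E A) \<in> (case x of (A, a) \<Rightarrow> \<lambda>(B, b). {f \<in> hom E A B. f \<cdot>\<^bsub>E\<^esub> a = b \<cdot>\<^bsub>E\<^esub> amap P f}) x"
    if "x \<in> X" for x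
    using that X' by (cases x) auto
  show "g \<cdot>\<^bsub>E\<^esub> f \<in> (case x of (A, a) \<Rightarrow> \<lambda>(B, b). {f \<in> hom E A B. f \<cdot>\<^bsub>E\<^esub> a = b \<cdot>\<^bsub>E\<^esub> amap P f}) z"
    if "x \<in> X" "y \<in> X" "z \<in> X"
      and f: "f \<in> (case x of (A, a) \<Rightarrow> \<lambda>(B, b). {f \<in> hom E A B. f \<cdot>\<^bsub>E\<^esub> a = b \<cdot>\<^bsub>E\<^esub> amap P f}) y"
      and g: "g \<in> (case y of (A, a) \<Rightarrow> \<lambda>(B, b). {f \<in> hom E A B. f \<cdot>\<^bsub>E\<^esub> a = b \<cdot>\<^bsub>E\<^esub> amap P f}) z"
    for x y z f g
  proof -
    obtain A a B b C c where xyz: "x = (A, a)" "y = (B, b)" "z = (C, c)"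
      by (cases x; cases y; cases z)
    have ty: "A \<in> Obj E" "B \<in> Obj E" "C \<in> Obj E" "a \<in> Arr E" "b \<in> Arr E" "c \<in> Arr E"
      "Dom E a = omap P A" "Dom E b = omap P B" "Dom E c = omap P C" "Cod E a = A" "Cod E b = B" "Cod E c = C"
      "f \<in> Arr E" "Dom E f = A" "Cod E f = B" "g \<in> Arr E" "Dom E g = B" "Cod E g = C"
      and eq: "f \<cdot>\<^bsub>E\<^esub> a = b \<cdot>\<^bsub>E\<^esub> amap P f" "g \<cdot>\<^bsub>E\<^esub> b = c \<cdot>\<^bsub>E\<^esub> amap P g"
      using that X'[of A a] X'[of B b] X'[of C c] unfolding xyz by auto
    have "(g \<cdot>\<^bsub>E\<^esub> f) \<cdot>\<^bsub>E\<^esub> a = g \<cdot>\<^bsub>E\<^esub> (b \<cdot>\<^bsub>E\<^esub> amap P f)" using ty eq(1) by simp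
    also have "\<dots> = (c \<cdot>\<^bsub>E\<^esub> amap P g) \<cdot>\<^bsub>E\<^esub> amap P f"
      by (rule P.src.reassoc[OF eq(2)]) (use ty in simp_all)
    finally show ?thesis using ty unfolding xyz by simp
  qed
qed (use cfunctor.amap_arr[OF cfunctor.intro[OF assms(1)]] category.assoc[of E] category.Cmp_Idn'[of E]
      category.Idn_Cmp'[of E] assms(1) in \<open>auto simp: cat_functor_def\<close>)

text \<open>An arbitrary choice of free algebras on all objects. The monad and both of its universal
  properties are derived from this alone, without reference to how the free algebras were
  built.\<close>

locale free_algebras = pointed_endo E T
  for E :: "('o, 'a) cat" (structure) and T :: "('o, 'a) ptd_endo" +
  fixes N :: "'o \<Rightarrow> 'o" and x \<eta> :: "'o \<Rightarrow> 'a"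
  assumes N [simp]: "A \<in> Obj E \<Longrightarrow> N A \<in> Obj E"
    and x: "A \<in> Obj E \<Longrightarrow> x A \<in> hom E (T\<^sub>o (N A)) (N A)"
    and x_point: "A \<in> Obj E \<Longrightarrow> x A \<cdot> \<tau> (N A) = Idn E (N A)"
    and unit: "A \<in> Obj E \<Longrightarrow> \<eta> A \<in> hom E A (N A)"
    and free: "\<lbrakk>A \<in> Obj E; B \<in> Obj E; b \<in> hom E (T\<^sub>o B) B; b \<cdot> \<tau> B = Idn E B; f \<in> hom E A B\<rbrakk>
      \<Longrightarrow> \<exists>!h. h \<in> hom E (N A) B \<and> h \<cdot> \<eta> A = f \<and> h \<cdot> x A = b \<cdot> T\<^sub>a h"
begin

lemma x_arr [simp]:
  assumes "A \<in> Obj E"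
  shows "x A \<in> Arr E" "Dom E (x A) = T\<^sub>o (N A)" "Cod E (x A) = N A"
  using x[OF assms] by simp_all

lemma unit_arr [simp]:
  assumes "A \<in> Obj E"
  shows "\<eta> A \<in> Arr E" "Dom E (\<eta> A) = A" "Cod E (\<eta> A) = N A"
  using unit[OF assms] by simp_all

text \<open>An algebra is represented by its structure map; the carrier is the codomain.\<close>

definition alg :: "'a \<Rightarrow> bool" where
  "alg a \<longleftrightarrow> a \<in> Arr E \<and> Dom E a = T\<^sub>o (Cod E a) \<and> a \<cdot> \<tau> (Cod E a) = Idn E (Cod E a)"

definition alg_hom :: "'a \<Rightarrow> 'a \<Rightarrow> 'a \<Rightarrow> bool" where
  "alg_hom a b h \<longleftrightarrow> alg a \<and> alg b \<and> h \<in> hom E (Cod E a) (Cod E b) \<and> h \<cdot> a = b \<cdot> T\<^sub>a h"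

lemma alg_x [simp]: "A \<in> Obj E \<Longrightarrow> alg (x A)"
  using x_point by (simp add: alg_def)

lemma alg_hom_comp:
  assumes "alg_hom a b h" "alg_hom b c g"
  shows "alg_hom a c (g \<cdot> h)"
proof -
  have ty: "a \<in> Arr E" "b \<in> Arr E" "c \<in> Arr E" "Dom E a = T\<^sub>o (Cod E a)" "Dom E b = T\<^sub>o (Cod E b)"
    "Dom E c = T\<^sub>o (Cod E c)" "h \<in> Arr E" "Dom E h = Cod E a" "Cod E h = Cod E b"
    "g \<in> Arr E" "Dom E g = Cod E b" "Cod E g = Cod E c"
    and eq: "h \<cdot> a = b \<cdot> T\<^sub>a h" "g \<cdot> b = c \<cdot> T\<^sub>a g"
    using assms unfolding alg_hom_def alg_def by auto
  have "(g \<cdot> h) \<cdot> a = g \<cdot> (b \<cdot> T\<^sub>a h)" using ty eq(1) by simp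
  also have "\<dots> = (c \<cdot> T\<^sub>a g) \<cdot> T\<^sub>a h" by (rule reassoc[OF eq(2)]) (use ty in simp_all)
  finally show ?thesis using assms ty unfolding alg_hom_def by simp
qed

lemma alg_hom_Idn: "alg a \<Longrightarrow> alg_hom a a (Idn E (Cod E a))"
  by (auto simp: alg_hom_def alg_def)

text \<open>The source of all monad laws and naturality squares below: both sides are algebra maps
  out of a free algebra, and they agree on the unit.\<close>

lemma alg_hom_eq:
  assumes "alg_hom (x A) b h" "alg_hom (x A) b g" "h \<cdot> \<eta> A = g \<cdot> \<eta> A" "A \<in> Obj E"
  shows "h = g"
proof -
  have "b \<in> hom E (T\<^sub>o (Cod E b)) (Cod E b)" "b \<cdot> \<tau> (Cod E b) = Idn E (Cod E b)" "Cod E b \<in> Obj E"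
    "h \<cdot> \<eta> A \<in> hom E A (Cod E b)"
    using assms unfolding alg_hom_def alg_def by auto
  from free[OF assms(4) this(3,1,2,4)] show ?thesis
    using assms unfolding alg_hom_def by auto
qed

definition lift :: "'o \<Rightarrow> 'a \<Rightarrow> 'a \<Rightarrow> 'a" where
  "lift A b f = (THE h. alg_hom (x A) b h \<and> h \<cdot> \<eta> A = f)"

lemma
  assumes "A \<in> Obj E" "alg b" "f \<in> hom E A (Cod E b)"
  shows lift_hom: "alg_hom (x A) b (lift A b f)"
    and lift_unit: "lift A b f \<cdot> \<eta> A = f"
proof -
  have "b \<in> hom E (T\<^sub>o (Cod E b)) (Cod E b)" "b \<cdot> \<tau> (Cod E b) = Idn E (Cod E b)" "Cod E b \<in> Obj E"
    using assms unfolding alg_def by auto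
  from free[OF assms(1) this(3,1,2) assms(3)]
  have "\<exists>!h. alg_hom (x A) b h \<and> h \<cdot> \<eta> A = f"
    using assms by (auto simp: alg_hom_def)
  from theI'[OF this] show "alg_hom (x A) b (lift A b f)" "lift A b f \<cdot> \<eta> A = f"
    unfolding lift_def by auto
qed

definition nf :: "'a \<Rightarrow> 'a" where
  "nf f = lift (Dom E f) (x (Cod E f)) (\<eta> (Cod E f) \<cdot> f)"

text \<open>The counit of the adjunction between free and underlying objects, at the free algebra on
  \<open>A\<close>.\<close>

definition mu :: "'o \<Rightarrow> 'a" where
  "mu A = lift (N A) (x A) (Idn E (N A))"

lemma nf_hom: "\<lbrakk>f \<in> Arr E; Dom E f = A; Cod E f = B\<rbrakk> \<Longrightarrow> alg_hom (x A) (x B) (nf f)"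
  unfolding nf_def using lift_hom[of A "x B" "\<eta> B \<cdot> f"] by auto

lemma nf_unit: "f \<in> Arr E \<Longrightarrow> nf f \<cdot> \<eta> (Dom E f) = \<eta> (Cod E f) \<cdot> f"
  unfolding nf_def by (rule lift_unit) simp_all

lemma nf_arr [simp]:
  assumes "f \<in> Arr E"
  shows "nf f \<in> Arr E" "Dom E (nf f) = N (Dom E f)" "Cod E (nf f) = N (Cod E f)"
  using nf_hom[OF assms refl refl] assms unfolding alg_hom_def by auto

lemma mu_hom: "A \<in> Obj E \<Longrightarrow> alg_hom (x (N A)) (x A) (mu A)"
  unfolding mu_def by (rule lift_hom) simp_all

lemma mu_unit: "A \<in> Obj E \<Longrightarrow> mu A \<cdot> \<eta> (N A) = Idn E (N A)"
  unfolding mu_def by (rule lift_unit) simp_all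

lemma mu_arr [simp]:
  assumes "A \<in> Obj E"
  shows "mu A \<in> Arr E" "Dom E (mu A) = N (N A)" "Cod E (mu A) = N A"
  using mu_hom[OF assms] assms unfolding alg_hom_def by auto

lemma nf_Idn: "A \<in> Obj E \<Longrightarrow> nf (Idn E A) = Idn E (N A)"
  by (rule alg_hom_eq[of A "x A"])
    (use nf_hom[of "Idn E A"] nf_unit[of "Idn E A"] alg_hom_Idn[of "x A"] in simp_all)

lemma nf_Cmp:
  assumes "f \<in> Arr E" "g \<in> Arr E" "Dom E g = Cod E f"
  shows "nf (g \<cdot> f) = nf g \<cdot> nf f"
proof (rule alg_hom_eq)
  show "alg_hom (x (Dom E f)) (x (Cod E g)) (nf (g \<cdot> f))" by (rule nf_hom) (use assms in simp_all)
  show "alg_hom (x (Dom E f)) (x (Cod E g)) (nf g \<cdot> nf f)"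
    by (rule alg_hom_comp[where b = "x (Cod E f)"]) (use assms in \<open>simp_all add: nf_hom\<close>)
  have "nf g \<cdot> (\<eta> (Cod E f) \<cdot> f) = (\<eta> (Cod E g) \<cdot> g) \<cdot> f"
    by (rule reassoc) (use assms nf_unit[of g] in simp_all)
  then show "nf (g \<cdot> f) \<cdot> \<eta> (Dom E f) = (nf g \<cdot> nf f) \<cdot> \<eta> (Dom E f)"
    using assms nf_unit[of "g \<cdot> f"] nf_unit[of f] by simp
qed (use assms in simp)

definition free_monad :: "('o, 'a) mnd" where
  "free_monad = \<lparr>endo = \<lparr>omap = (\<lambda>A \<in> Obj E. N A), amap = (\<lambda>f \<in> Arr E. nf f)\<rparr>,
     point = (\<lambda>A \<in> Obj E. \<eta> A), multn = (\<lambda>A \<in> Obj E. mu A)\<rparr>"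

lemma free_monad_simps [simp]:
  "A \<in> Obj E \<Longrightarrow> omap (endo free_monad) A = N A"
  "f \<in> Arr E \<Longrightarrow> amap (endo free_monad) f = nf f"
  "A \<in> Obj E \<Longrightarrow> point free_monad A = \<eta> A"
  "A \<in> Obj E \<Longrightarrow> multn free_monad A = mu A"
  by (simp_all add: free_monad_def)

lemma mu_assoc:
  assumes A: "A \<in> Obj E"
  shows "mu A \<cdot> mu (N A) = mu A \<cdot> nf (mu A)"
proof (rule alg_hom_eq[of "N (N A)" "x A"])
  show "alg_hom (x (N (N A))) (x A) (mu A \<cdot> mu (N A))"
    by (rule alg_hom_comp[OF mu_hom mu_hom]) (use A in simp_all)
  show "alg_hom (x (N (N A))) (x A) (mu A \<cdot> nf (mu A))"
    by (rule alg_hom_comp[where b = "x (N A)"]) (use A in \<open>simp_all add: nf_hom mu_hom\<close>)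
  have "mu A \<cdot> (\<eta> (N A) \<cdot> mu A) = Idn E (N A) \<cdot> mu A"
    by (rule reassoc[OF mu_unit]) (use A in simp_all)
  then show "(mu A \<cdot> mu (N A)) \<cdot> \<eta> (N (N A)) = (mu A \<cdot> nf (mu A)) \<cdot> \<eta> (N (N A))"
    using A mu_unit[of "N A"] nf_unit[of "mu A"] by simp
qed (use A in simp)

lemma mu_nf_unit:
  assumes A: "A \<in> Obj E"
  shows "mu A \<cdot> nf (\<eta> A) = Idn E (N A)"
proof (rule alg_hom_eq[of A "x A"])
  show "alg_hom (x A) (x A) (mu A \<cdot> nf (\<eta> A))"
    by (rule alg_hom_comp[where b = "x (N A)"]) (use A in \<open>simp_all add: nf_hom mu_hom\<close>)
  show "alg_hom (x A) (x A) (Idn E (N A))" using alg_hom_Idn[of "x A"] A by simp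
  have "mu A \<cdot> (\<eta> (N A) \<cdot> \<eta> A) = Idn E (N A) \<cdot> \<eta> A"
    by (rule reassoc[OF mu_unit]) (use A in simp_all)
  then show "(mu A \<cdot> nf (\<eta> A)) \<cdot> \<eta> A = Idn E (N A) \<cdot> \<eta> A"
    using A nf_unit[of "\<eta> A"] by simp
qed (use A in simp)

lemma mu_nat:
  assumes f: "f \<in> Arr E"
  shows "mu (Cod E f) \<cdot> nf (nf f) = nf f \<cdot> mu (Dom E f)"
proof (rule alg_hom_eq[of "N (Dom E f)" "x (Cod E f)"])
  show "alg_hom (x (N (Dom E f))) (x (Cod E f)) (mu (Cod E f) \<cdot> nf (nf f))"
    by (rule alg_hom_comp[where b = "x (N (Cod E f))"]) (use f in \<open>simp_all add: nf_hom mu_hom\<close>)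
  show "alg_hom (x (N (Dom E f))) (x (Cod E f)) (nf f \<cdot> mu (Dom E f))"
    by (rule alg_hom_comp[where b = "x (Dom E f)"]) (use f in \<open>simp_all add: nf_hom mu_hom\<close>)
  have "mu (Cod E f) \<cdot> (\<eta> (N (Cod E f)) \<cdot> nf f) = Idn E (N (Cod E f)) \<cdot> nf f"
    by (rule reassoc[OF mu_unit]) (use f in simp_all)
  then show "(mu (Cod E f) \<cdot> nf (nf f)) \<cdot> \<eta> (N (Dom E f)) = (nf f \<cdot> mu (Dom E f)) \<cdot> \<eta> (N (Dom E f))"
    using f nf_unit[of "nf f"] mu_unit[of "Dom E f"] by simp
qed (use f in simp)

lemma functor_free_monad: "cat_functor E E (endo free_monad)"
  by (rule cat_functorI) (use nf_Idn nf_Cmp in \<open>auto simp: category_axioms free_monad_def\<close>)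

lemma is_ptd_endo_free_monad: "is_ptd_endo E (ptd_of free_monad)"
  unfolding is_ptd_endo_def nat_trans_def
  using functor_free_monad cat_functor_id[OF category_axioms] nf_unit
  by (auto simp: ptd_of_def) (auto simp: free_monad_def)

lemma is_monad_free_monad: "is_monad E free_monad"
proof -
  have "multn free_monad \<in> extensional (Obj E)" by (simp add: free_monad_def)
  then show ?thesis
    unfolding is_monad_def nat_trans_def
    using functor_free_monad cat_functor_comp[OF functor_free_monad functor_free_monad]
      is_ptd_endo_free_monad mu_unit mu_nf_unit mu_assoc mu_nat
    by auto
qed

section \<open>The two universal properties of the monad\<close>

definition generators :: "'o \<Rightarrow> 'a" where
  "generators = (\<lambda>A \<in> Obj E. x A \<cdot> T\<^sub>a (\<eta> A))"

lemma generators_arr [simp]: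
  assumes "A \<in> Obj E"
  shows "generators A \<in> Arr E" "Dom E (generators A) = T\<^sub>o A" "Cod E (generators A) = N A"
  using assms by (simp_all add: generators_def)

lemma alg_hom_generators:
  assumes h: "alg_hom (x A) b h" and A: "A \<in> Obj E"
  shows "h \<cdot> generators A = b \<cdot> T\<^sub>a (h \<cdot> \<eta> A)"
proof -
  have ty: "h \<in> Arr E" "Dom E h = N A" "Cod E h = Cod E b" "b \<in> Arr E" "Dom E b = T\<^sub>o (Cod E b)"
    and eq: "h \<cdot> x A = b \<cdot> T\<^sub>a h"
    using h A unfolding alg_hom_def alg_def by auto
  have "h \<cdot> (x A \<cdot> T\<^sub>a (\<eta> A)) = (b \<cdot> T\<^sub>a h) \<cdot> T\<^sub>a (\<eta> A)"
    by (rule reassoc[OF eq]) (use ty A in simp_all)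
  then show ?thesis using ty A by (simp add: generators_def)
qed

text \<open>Recovers the free structure map from the monad and its generators. This is how equations
  about the multiplication turn into statements about algebra maps, for monad morphisms and for
  monad algebras.\<close>

lemma x_eq: "A \<in> Obj E \<Longrightarrow> mu A \<cdot> generators (N A) = x A"
  using alg_hom_generators[OF mu_hom, of A] mu_unit[of A] by simp

lemma ptd_endo_hom_generators: "ptd_endo_hom E T (ptd_of free_monad) generators"
  unfolding ptd_endo_hom_def nat_trans_def
proof (intro conjI ballI)
  show "is_ptd_endo E T" by (rule ptd)
  show "is_ptd_endo E (ptd_of free_monad)" by (rule is_ptd_endo_free_monad)
  show "cat_functor E E (endo T)" by (rule T.is_functor)
  show "cat_functor E E (endo (ptd_of free_monad))" using functor_free_monad by (simp add: ptd_of_def)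
  show "generators \<in> extensional (Obj E)" by (simp add: generators_def)
  show "generators A \<in> hom E (T\<^sub>o A) (omap (endo (ptd_of free_monad)) A)" if "A \<in> Obj E" for A
    using that by (simp add: ptd_of_def)
  show "generators (Cod E f) \<cdot> T\<^sub>a f = amap (endo (ptd_of free_monad)) f \<cdot> generators (Dom E f)"
    if f: "f \<in> Arr E" for f
    using f alg_hom_generators[OF nf_hom[OF f refl refl]] nf_unit[OF f] by (simp add: ptd_of_def generators_def)
  show "generators A \<cdot> \<tau> A = point (ptd_of free_monad) A" if A: "A \<in> Obj E" for A
  proof -
    have "x A \<cdot> (\<tau> (N A) \<cdot> \<eta> A) = Idn E (N A) \<cdot> \<eta> A"
      by (rule reassoc[OF x_point]) (use A in simp_all)
    then show ?thesis using A point_nat[of "\<eta> A" A "N A"] by (simp add: ptd_of_def generators_def)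
  qed
qed

text \<open>A pointed map \<open>\<delta>\<close> from \<open>T\<close> to a monad \<open>M'\<close>
  makes every \<open>M' A\<close> an algebra, and the functorial action and multiplication of
  \<open>M'\<close> become algebra maps. A monad morphism extending \<open>\<delta>\<close> is then,
  at each \<open>A\<close>, the algebra map out of the free algebra that extends the unit of
  \<open>M'\<close>.\<close>

lemma is_free_monad_free_monad: "is_free_monad E T free_monad generators"
  unfolding is_free_monad_def
proof (intro conjI allI impI)
  show "is_monad E free_monad" by (rule is_monad_free_monad)
  show "ptd_endo_hom E T (ptd_of free_monad) generators" by (rule ptd_endo_hom_generators)
  fix M' \<delta>
  assume asm: "is_monad E M' \<and> ptd_endo_hom E T (ptd_of M') \<delta>"
  then have M': "is_monad E M'" by blast
  note M'D = is_monadD[OF M']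
  interpret M': cfunctor E E "endo M'" by unfold_locales (rule M'D)
  define M0 where "M0 = omap (endo M')"
  have M0 [simp]: "M0 A \<in> Obj E" if "A \<in> Obj E" for A using that by (simp add: M0_def)
  have M1 [simp]: "Dom E (amap (endo M') f) = M0 (Dom E f)" "Cod E (amap (endo M') f) = M0 (Cod E f)"
    if "f \<in> Arr E" for f using that by (simp_all add: M0_def)
  have \<eta>' [simp]: "point M' A \<in> Arr E" "Dom E (point M' A) = A" "Cod E (point M' A) = M0 A"
    if "A \<in> Obj E" for A using M'D(3)[OF that] by (auto simp: M0_def)
  have \<mu>' [simp]: "multn M' A \<in> Arr E" "Dom E (multn M' A) = M0 (M0 A)" "Cod E (multn M' A) = M0 A"
    if "A \<in> Obj E" for A using M'D(5)[OF that] by (auto simp: M0_def)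
  have \<delta> [simp]: "\<delta> A \<in> Arr E" "Dom E (\<delta> A) = T\<^sub>o A" "Cod E (\<delta> A) = M0 A"
    and \<delta>_pt: "\<delta> A \<cdot> \<tau> A = point M' A" if "A \<in> Obj E" for A
    using asm that unfolding ptd_endo_hom_def nat_trans_def ptd_of_def by (auto simp: M0_def)
  have \<delta>_nat: "\<delta> (Cod E f) \<cdot> T\<^sub>a f = amap (endo M') f \<cdot> \<delta> (Dom E f)" if "f \<in> Arr E" for f
    using asm that unfolding ptd_endo_hom_def nat_trans_def ptd_of_def by auto
  note M0_def [symmetric, simp] and M'D = M'D [folded M0_def]
  define str where "str A = multn M' A \<cdot> \<delta> (M0 A)" for A
  have str [simp]: "str A \<in> Arr E" "Dom E (str A) = T\<^sub>o (M0 A)" "Cod E (str A) = M0 A"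
    if "A \<in> Obj E" for A using that by (simp_all add: str_def)
  have str_alg: "alg (str A)" if A: "A \<in> Obj E" for A
    using A \<delta>_pt[of "M0 A"] M'D(7)[OF A] by (simp add: alg_def str_def)
  have M'_hom: "alg_hom (str (Dom E f)) (str (Cod E f)) (amap (endo M') f)" if f: "f \<in> Arr E" for f
  proof -
    have "amap (endo M') f \<cdot> (multn M' (Dom E f) \<cdot> \<delta> (M0 (Dom E f))) =
        (multn M' (Cod E f) \<cdot> amap (endo M') (amap (endo M') f)) \<cdot> \<delta> (M0 (Dom E f))"
      by (rule reassoc[OF M'D(6)[OF f, symmetric]]) (use f in simp_all)
    then have "amap (endo M') f \<cdot> str (Dom E f) = str (Cod E f) \<cdot> T\<^sub>a (amap (endo M') f)"
      using f \<delta>_nat[of "amap (endo M') f"] by (simp add: str_def)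
    then show ?thesis using f str_alg by (simp add: alg_hom_def)
  qed
  have \<mu>'_hom: "alg_hom (str (M0 A)) (str A) (multn M' A)" if A: "A \<in> Obj E" for A
  proof -
    have "multn M' A \<cdot> (multn M' (M0 A) \<cdot> \<delta> (M0 (M0 A))) =
        (multn M' A \<cdot> amap (endo M') (multn M' A)) \<cdot> \<delta> (M0 (M0 A))"
      using A by (intro reassoc) (simp_all add: M'D(9))
    then have "multn M' A \<cdot> str (M0 A) = str A \<cdot> T\<^sub>a (multn M' A)"
      using A \<delta>_nat[of "multn M' A"] by (simp add: str_def)
    then show ?thesis using A str_alg by (simp add: alg_hom_def)
  qed
  define \<phi> where "\<phi> = (\<lambda>A \<in> Obj E. lift A (str A) (point M' A))"
  have \<phi>_hom: "alg_hom (x A) (str A) (\<phi> A)" and \<phi>_unit: "\<phi> A \<cdot> \<eta> A = point M' A"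
    if A: "A \<in> Obj E" for A
    using lift_hom[OF A str_alg[OF A], of "point M' A"] lift_unit[OF A str_alg[OF A], of "point M' A"] A
    by (simp_all add: \<phi>_def)
  have \<phi> [simp]: "\<phi> A \<in> Arr E" "Dom E (\<phi> A) = N A" "Cod E (\<phi> A) = M0 A" if "A \<in> Obj E" for A
    using \<phi>_hom[OF that] that unfolding alg_hom_def by auto
  have \<phi>_nat: "\<phi> (Cod E f) \<cdot> nf f = amap (endo M') f \<cdot> \<phi> (Dom E f)" if f: "f \<in> Arr E" for f
  proof (rule alg_hom_eq[of "Dom E f" "str (Cod E f)"])
    show "alg_hom (x (Dom E f)) (str (Cod E f)) (\<phi> (Cod E f) \<cdot> nf f)"
      by (rule alg_hom_comp[where b = "x (Cod E f)"]) (use f \<phi>_hom in \<open>simp_all add: nf_hom\<close>)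
    show "alg_hom (x (Dom E f)) (str (Cod E f)) (amap (endo M') f \<cdot> \<phi> (Dom E f))"
      by (rule alg_hom_comp[where b = "str (Dom E f)"]) (use f \<phi>_hom M'_hom in simp_all)
    have "\<phi> (Cod E f) \<cdot> (\<eta> (Cod E f) \<cdot> f) = point M' (Cod E f) \<cdot> f"
      by (rule reassoc[OF \<phi>_unit]) (use f in simp_all)
    then show "(\<phi> (Cod E f) \<cdot> nf f) \<cdot> \<eta> (Dom E f) = (amap (endo M') f \<cdot> \<phi> (Dom E f)) \<cdot> \<eta> (Dom E f)"
      using f nf_unit[OF f] \<phi>_unit[of "Dom E f"] M'D(4)[OF f] by simp
  qed (use f in simp)
  have \<phi>_mult: "\<phi> A \<cdot> mu A = multn M' A \<cdot> (amap (endo M') (\<phi> A) \<cdot> \<phi> (N A))" if A: "A \<in> Obj E" for A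
  proof (rule alg_hom_eq[of "N A" "str A"])
    show "alg_hom (x (N A)) (str A) (\<phi> A \<cdot> mu A)"
      by (rule alg_hom_comp[OF mu_hom \<phi>_hom]) (use A in simp_all)
    have "alg_hom (x (N A)) (str (M0 A)) (amap (endo M') (\<phi> A) \<cdot> \<phi> (N A))"
      by (rule alg_hom_comp[where b = "str (N A)"]) (use A \<phi>_hom M'_hom[of "\<phi> A"] in simp_all)
    then show "alg_hom (x (N A)) (str A) (multn M' A \<cdot> (amap (endo M') (\<phi> A) \<cdot> \<phi> (N A)))"
      by (rule alg_hom_comp[OF _ \<mu>'_hom]) (use A in simp_all)
    have "multn M' A \<cdot> (point M' (M0 A) \<cdot> \<phi> A) = Idn E (M0 A) \<cdot> \<phi> A"
      using A by (intro reassoc) (simp_all add: M'D(7))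
    then show "(\<phi> A \<cdot> mu A) \<cdot> \<eta> (N A) = (multn M' A \<cdot> (amap (endo M') (\<phi> A) \<cdot> \<phi> (N A))) \<cdot> \<eta> (N A)"
      using A mu_unit[OF A] \<phi>_unit[of "N A"] M'D(4)[of "\<phi> A"] by simp
  qed (use A in simp)
  have \<phi>_\<delta>: "\<delta> A = \<phi> A \<cdot> generators A" if A: "A \<in> Obj E" for A
  proof -
    have "\<phi> A \<cdot> generators A = multn M' A \<cdot> (\<delta> (M0 A) \<cdot> T\<^sub>a (point M' A))"
      using alg_hom_generators[OF \<phi>_hom[OF A] A] \<phi>_unit[OF A] A by (simp add: str_def)
    also have "\<dots> = multn M' A \<cdot> (amap (endo M') (point M' A) \<cdot> \<delta> A)"
      using \<delta>_nat[of "point M' A"] A by simp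
    also have "\<dots> = Idn E (M0 A) \<cdot> \<delta> A"
      using A by (intro reassoc) (simp_all add: M'D(8))
    finally show ?thesis using A by simp
  qed
  have mh: "monad_hom E free_monad M' \<phi>"
    unfolding monad_hom_def ptd_endo_hom_def nat_trans_def
    using is_monad_free_monad M' is_ptd_endo_free_monad M'D(1,2) functor_free_monad
      \<phi>_nat \<phi>_mult \<phi>_unit
    by (auto simp: ptd_of_def) (auto simp: \<phi>_def)
  show "\<exists>!\<phi>. monad_hom E free_monad M' \<phi> \<and> (\<forall>A\<in>Obj E. \<delta> A = \<phi> A \<cdot> generators A)"
  proof (intro ex1I[of _ \<phi>] conjI ballI mh \<phi>_\<delta>)
    fix \<psi> assume \<psi>: "monad_hom E free_monad M' \<psi> \<and> (\<forall>A\<in>Obj E. \<delta> A = \<psi> A \<cdot> generators A)"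
    have \<psi>_arr [simp]: "\<psi> A \<in> Arr E" "Dom E (\<psi> A) = N A" "Cod E (\<psi> A) = M0 A"
      and \<psi>_unit: "\<psi> A \<cdot> \<eta> A = point M' A"
      and \<psi>_mult: "\<psi> A \<cdot> mu A = multn M' A \<cdot> (amap (endo M') (\<psi> A) \<cdot> \<psi> (N A))"
      and \<psi>_\<delta>: "\<psi> A \<cdot> generators A = \<delta> A" if "A \<in> Obj E" for A
      using \<psi> that unfolding monad_hom_def ptd_endo_hom_def nat_trans_def
      by (auto simp: ptd_of_def)
    have "\<psi> A = \<phi> A" if A: "A \<in> Obj E" for A
    proof (rule alg_hom_eq)
      \<comment> \<open>Multiplicativity of \<open>\<psi>\<close>, precomposed with the generators
        of \<open>N A\<close>, says by \<open>x_eq\<close> that \<open>\<psi> A\<close> is an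
        algebra map, and freeness leaves no choice.\<close>
      have "\<psi> A \<cdot> (mu A \<cdot> generators (N A)) =
          (multn M' A \<cdot> (amap (endo M') (\<psi> A) \<cdot> \<psi> (N A))) \<cdot> generators (N A)"
        by (rule reassoc[OF \<psi>_mult]) (use A in simp_all)
      also have "\<dots> = multn M' A \<cdot> (amap (endo M') (\<psi> A) \<cdot> \<delta> (N A))"
        using A \<psi>_\<delta>[of "N A"] by simp
      also have "\<dots> = str A \<cdot> T\<^sub>a (\<psi> A)"
        using A \<delta>_nat[of "\<psi> A"] by (simp add: str_def)
      finally show "alg_hom (x A) (str A) (\<psi> A)"
        using A str_alg x_eq[OF A] by (simp add: alg_hom_def)
    qed (use A \<phi>_hom \<psi>_unit \<phi>_unit in simp_all)
    moreover have "\<psi> \<in> extensional (Obj E)"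
      using \<psi> unfolding monad_hom_def ptd_endo_hom_def nat_trans_def by blast
    ultimately show "\<psi> = \<phi>"
      by (intro extensionalityI[of \<psi> "Obj E" \<phi>]) (auto simp: \<phi>_def)
  qed
qed

text \<open>The associativity law of \<open>a\<close>, precomposed with the generators of
  \<open>N A\<close>, says by \<open>x_eq\<close> that \<open>a\<close> itself is an algebra map
  from the free algebra to the restricted one.\<close>

lemma monad_alg_alg_hom:
  assumes "a \<in> hom E (N A) A" "A \<in> Obj E" "a \<cdot> \<eta> A = Idn E A" "a \<cdot> mu A = a \<cdot> nf a"
  shows "alg (a \<cdot> generators A)" "alg_hom (x A) (a \<cdot> generators A) a"
proof -
  have a: "a \<in> Arr E" "Dom E a = N A" "Cod E a = A" using assms by auto
  have "generators A \<cdot> \<tau> A = \<eta> A"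
    using ptd_endo_hom_generators assms(2) unfolding ptd_endo_hom_def by (simp add: ptd_of_def)
  then show alg: "alg (a \<cdot> generators A)" using a assms by (simp add: alg_def)
  have "a \<cdot> x A = (a \<cdot> mu A) \<cdot> generators (N A)" using a assms(2) x_eq[of A] by simp
  also have "\<dots> = a \<cdot> (nf a \<cdot> generators (N A))" using a assms(2,4) by simp
  also have "nf a \<cdot> generators (N A) = generators A \<cdot> T\<^sub>a a"
    using ptd_endo_hom_generators a assms(2) unfolding ptd_endo_hom_def nat_trans_def
    by (auto simp: ptd_of_def)
  finally show "alg_hom (x A) (a \<cdot> generators A) a"
    using alg a assms(2) by (simp add: alg_hom_def)
qed

text \<open>The inverse of restriction on objects: the monad structure on \<open>B\<close> is the
  algebra map from the free algebra that extends the identity. Associativity is again uniqueness of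
  maps out of a free algebra.\<close>

lemma lift_Idn:
  assumes "b \<in> hom E (T\<^sub>o B) B" "B \<in> Obj E" "b \<cdot> \<tau> B = Idn E B"
  defines "b' \<equiv> lift B b (Idn E B)"
  shows "b' \<in> hom E (N B) B" "b' \<cdot> \<eta> B = Idn E B" "b' \<cdot> mu B = b' \<cdot> nf b'"
    "b' \<cdot> generators B = b" "alg_hom (x B) b b'"
proof -
  have b: "b \<in> Arr E" "Dom E b = T\<^sub>o B" "Cod E b = B" using assms by auto
  have alg: "alg b" using b assms by (simp add: alg_def)
  show h: "alg_hom (x B) b b'" and u: "b' \<cdot> \<eta> B = Idn E B"
    unfolding b'_def using lift_hom[OF assms(2) alg, of "Idn E B"] lift_unit[OF assms(2) alg, of "Idn E B"]
      b assms(2) by simp_all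
  show b': "b' \<in> hom E (N B) B" using h b assms(2) unfolding alg_hom_def by simp
  show "b' \<cdot> generators B = b"
    using alg_hom_generators[OF h assms(2)] u b assms(2) by simp
  show "b' \<cdot> mu B = b' \<cdot> nf b'"
  proof (rule alg_hom_eq[of "N B" b])
    show "alg_hom (x (N B)) b (b' \<cdot> mu B)" by (rule alg_hom_comp[OF mu_hom h]) fact
    show "alg_hom (x (N B)) b (b' \<cdot> nf b')" by (rule alg_hom_comp[OF nf_hom h]) (use b' in simp_all)
    have "b' \<cdot> (\<eta> B \<cdot> b') = Idn E B \<cdot> b'" by (rule reassoc[OF u]) (use b' assms(2) in simp_all)
    then show "(b' \<cdot> mu B) \<cdot> \<eta> (N B) = (b' \<cdot> nf b') \<cdot> \<eta> (N B)"
      using b' assms(2) mu_unit[of B] nf_unit[of b'] by simp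
  qed (use assms in simp)
qed

text \<open>Restriction along the generators is bijective on structures over a fixed object, and
  both directions keep the underlying map of a morphism. So the isomorphism reduces to these
  bijections and to agreement of the two notions of algebra map.\<close>

lemma is_alg_free_monad_free_monad: "is_alg_free_monad E T free_monad generators"
  unfolding is_alg_free_monad_def
proof (intro conjI is_monad_free_monad ptd_endo_hom_generators)
  define XM where "XM = {(A, a). A \<in> Obj E \<and> a \<in> hom E (omap (endo free_monad) A) A \<and>
    a \<cdot> point free_monad A = Idn E A \<and>
    a \<cdot> multn free_monad A = a \<cdot> amap (endo free_monad) a}"
  define HM where "HM = (\<lambda>(A, a) (B, b). {f \<in> hom E A B. f \<cdot> a = b \<cdot> amap (endo free_monad) f})"
  define XT where "XT = {(A, a). A \<in> Obj E \<and> a \<in> hom E (T\<^sub>o A) A \<and> a \<cdot> \<tau> A = Idn E A}"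
  define HT where "HT = (\<lambda>(A, a) (B, b). {f \<in> hom E A B. f \<cdot> a = b \<cdot> T\<^sub>a f})"
  define idt :: "'o \<times> 'a \<Rightarrow> 'a" where "idt = (\<lambda>(A, a). Idn E A)"
  define cmp :: "'o \<times> 'a \<Rightarrow> 'o \<times> 'a \<Rightarrow> 'o \<times> 'a \<Rightarrow> 'a \<Rightarrow> 'a \<Rightarrow> 'a" where "cmp = (\<lambda>x y z g f. g \<cdot> f)"
  have M_eq: "monad_Alg E free_monad = concrete_cat XM HM idt cmp"
    unfolding monad_Alg_def XM_def HM_def idt_def cmp_def ..
  have T_eq: "ptd_Alg E T = concrete_cat XT HT idt cmp"
    unfolding ptd_Alg_def XT_def HT_def idt_def cmp_def ..
  have catM: "category (concrete_cat XM HM idt cmp)"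
    unfolding HM_def idt_def cmp_def
    by (rule category_algebras[OF functor_free_monad]) (auto simp: XM_def)
  have catT: "category (concrete_cat XT HT idt cmp)"
    unfolding HT_def idt_def cmp_def
    by (rule category_algebras[OF T.is_functor]) (auto simp: XT_def)
  have XM: "A \<in> Obj E" "a \<in> hom E (N A) A" "a \<cdot> \<eta> A = Idn E A" "a \<cdot> mu A = a \<cdot> nf a"
    if "(A, a) \<in> XM" for A a using that unfolding XM_def by auto
  have XT: "A \<in> Obj E" "a \<in> hom E (T\<^sub>o A) A" "a \<cdot> \<tau> A = Idn E A" if "(A, a) \<in> XT" for A a
    using that unfolding XT_def by auto
  define \<phi>' where "\<phi>' = (\<lambda>(B, b). (B, lift B b (Idn E B)))"
  have \<phi>: "restrict_alg E generators y \<in> XT" if "y \<in> XM" for y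
  proof -
    obtain A a where y: "y = (A, a)" by (cases y)
    note X = XM[OF that[unfolded y]]
    show ?thesis using monad_alg_alg_hom(1)[OF X(2,1,3,4)] X
      by (simp add: y restrict_alg_def XT_def alg_def)
  qed
  have \<phi>': "\<phi>' y \<in> XM" if "y \<in> XT" for y
  proof -
    obtain B b where y: "y = (B, b)" by (cases y)
    note X = XT[OF that[unfolded y]]
    show ?thesis using lift_Idn(1-3)[OF X(2,1,3)] X by (simp add: y \<phi>'_def XM_def)
  qed
  have \<phi>'\<phi>: "\<phi>' (restrict_alg E generators y) = y" if "y \<in> XM" for y
  proof -
    obtain A a where y: "y = (A, a)" by (cases y)
    note X = XM[OF that[unfolded y]]
    have al: "alg (a \<cdot> generators A)" by (rule monad_alg_alg_hom(1)[OF X(2,1,3,4)])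
    have "lift A (a \<cdot> generators A) (Idn E A) = a"
      by (rule alg_hom_eq[of A "a \<cdot> generators A"])
        (use lift_hom[OF X(1) al, of "Idn E A"] lift_unit[OF X(1) al, of "Idn E A"] X
          monad_alg_alg_hom(2)[OF X(2,1,3,4)] in simp_all)
    then show ?thesis by (simp add: y restrict_alg_def \<phi>'_def)
  qed
  have \<phi>\<phi>': "restrict_alg E generators (\<phi>' y) = y" if "y \<in> XT" for y
  proof -
    obtain B b where y: "y = (B, b)" by (cases y)
    note X = XT[OF that[unfolded y]]
    show ?thesis using lift_Idn(4)[OF X(2,1,3)] by (simp add: y restrict_alg_def \<phi>'_def)
  qed
  have arr: "f \<in> HT (restrict_alg E generators y) (restrict_alg E generators z)"
    if "y \<in> XM" "z \<in> XM" "f \<in> HM y z" for y z f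
  proof -
    obtain A a B b where yz: "y = (A, a)" "z = (B, b)" by (cases y; cases z)
    note X = XM[OF that(1)[unfolded yz]] XM[OF that(2)[unfolded yz]]
    have f: "f \<in> Arr E" "Dom E f = A" "Cod E f = B" "f \<cdot> a = b \<cdot> nf f"
      using that(3) unfolding yz HM_def by auto
    have "f \<cdot> (a \<cdot> generators A) = (b \<cdot> nf f) \<cdot> generators A"
      by (rule reassoc[OF f(4)]) (use f X in simp_all)
    also have "\<dots> = b \<cdot> (generators B \<cdot> T\<^sub>a f)"
      using ptd_endo_hom_generators f X unfolding ptd_endo_hom_def nat_trans_def
      by (auto simp: ptd_of_def)
    finally show ?thesis using f X by (simp add: yz restrict_alg_def HT_def)
  qed
  have arr': "f \<in> HM (\<phi>' y) (\<phi>' z)" if "y \<in> XT" "z \<in> XT" "f \<in> HT y z" for y z f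
  proof -
    obtain A a B b where yz: "y = (A, a)" "z = (B, b)" by (cases y; cases z)
    note Xa = XT[OF that(1)[unfolded yz]] and Xb = XT[OF that(2)[unfolded yz]]
    note La = lift_Idn[OF Xa(2,1,3)] and Lb = lift_Idn[OF Xb(2,1,3)]
    have f: "f \<in> Arr E" "Dom E f = A" "Cod E f = B" "f \<cdot> a = b \<cdot> T\<^sub>a f"
      using that(3) unfolding yz HT_def by auto
    have fh: "alg_hom a b f" using f Xa Xb by (simp add: alg_hom_def alg_def)
    \<comment> \<open>Both sides are algebra maps out of the free algebra on \<open>A\<close> that
      restrict to \<open>f\<close>, hence a map of \<open>T\<close>-algebras respects the extended
      structures.\<close>
    have "f \<cdot> lift A a (Idn E A) = lift B b (Idn E B) \<cdot> nf f"
    proof (rule alg_hom_eq[of A b])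
      show "alg_hom (x A) b (f \<cdot> lift A a (Idn E A))" by (rule alg_hom_comp[OF La(5) fh])
      show "alg_hom (x A) b (lift B b (Idn E B) \<cdot> nf f)"
        by (rule alg_hom_comp[OF nf_hom Lb(5)]) (use f in simp_all)
      have "lift B b (Idn E B) \<cdot> (\<eta> B \<cdot> f) = Idn E B \<cdot> f"
        by (rule reassoc[OF Lb(2)]) (use Lb(1) f Xb in simp_all)
      then show "(f \<cdot> lift A a (Idn E A)) \<cdot> \<eta> A = (lift B b (Idn E B) \<cdot> nf f) \<cdot> \<eta> A"
        using La(1,2) Lb(1) f Xa Xb nf_unit[of f] by simp
    qed fact
    then show ?thesis using f by (simp add: yz \<phi>'_def HM_def)
  qed
  have F: "cat_functor (monad_Alg E free_monad) (ptd_Alg E T) (alg_functor E free_monad generators)"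
    unfolding alg_functor_def M_eq T_eq concrete_cat_simps(1)
    by (rule concrete_functor[OF catM catT, where \<psi> = "\<lambda>y z f. f"])
      (use \<phi> arr in \<open>auto simp: idt_def cmp_def restrict_alg_def\<close>)
  define G where "G = \<lparr>omap = (\<lambda>y \<in> XT. \<phi>' y),
     amap = (\<lambda>t \<in> Arr (concrete_cat XT HT idt cmp). Tagged (\<phi>' (source t)) (\<phi>' (target t)) (body t))\<rparr>"
  have G: "cat_functor (ptd_Alg E T) (monad_Alg E free_monad) G"
    unfolding G_def M_eq T_eq
    by (rule concrete_functor[OF catT catM, where \<psi> = "\<lambda>y z f. f"])
      (use \<phi>' arr' in \<open>auto simp: idt_def cmp_def \<phi>'_def\<close>)
  have "comp_functor (monad_Alg E free_monad) G (alg_functor E free_monad generators) =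
      id_functor (monad_Alg E free_monad)"
    unfolding M_eq alg_functor_def G_def comp_functor_def id_functor_def
    by (simp add: concrete_cat_simps \<phi> \<phi>'\<phi> arr cong: restrict_cong)
  moreover have "comp_functor (ptd_Alg E T) (alg_functor E free_monad generators) G =
      id_functor (ptd_Alg E T)"
    unfolding T_eq alg_functor_def M_eq G_def comp_functor_def id_functor_def
    by (simp add: concrete_cat_simps \<phi>' \<phi>\<phi>' arr' cong: restrict_cong)
  ultimately show "is_cat_iso (monad_Alg E free_monad) (ptd_Alg E T) (alg_functor E free_monad generators)"
    unfolding is_cat_iso_def using F G by blast
qed

end


section \<open>Strong morphisms\<close>

lemma (in category) is_isoI:
  "\<lbrakk>f \<in> hom C A B; g \<in> hom C B A; g \<cdot> f = Idn C A; f \<cdot> g = Idn C B\<rbrakk> \<Longrightarrow> is_iso C f"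
  unfolding is_iso_def by auto

lemma (in category) is_iso_Idn: "A \<in> Obj C \<Longrightarrow> is_iso C (Idn C A)"
  by (rule is_isoI[of _ A A "Idn C A"]) simp_all

lemma (in category) is_iso_Cmp:
  assumes "is_iso C f" "is_iso C g" "f \<in> hom C A B" "g \<in> hom C B D"
  shows "is_iso C (g \<cdot> f)"
proof -
  obtain f' where f': "f' \<in> hom C B A" "f' \<cdot> f = Idn C A" "f \<cdot> f' = Idn C B"
    using is_iso_inverse[OF assms(1,3)] .
  obtain g' where g': "g' \<in> hom C D B" "g' \<cdot> g = Idn C B" "g \<cdot> g' = Idn C D"
    using is_iso_inverse[OF assms(2,4)] .
  have ty: "f \<in> Arr C" "Dom C f = A" "Cod C f = B" "g \<in> Arr C" "Dom C g = B" "Cod C g = D"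
    "f' \<in> Arr C" "Dom C f' = B" "Cod C f' = A" "g' \<in> Arr C" "Dom C g' = D" "Cod C g' = B"
    using assms f' g' by auto
  show ?thesis
  proof (rule is_isoI[of _ A D "f' \<cdot> g'"])
    have "f' \<cdot> (g' \<cdot> (g \<cdot> f)) = f' \<cdot> (Idn C B \<cdot> f)"
      using reassoc[OF g'(2), of f] ty by simp
    then show "(f' \<cdot> g') \<cdot> (g \<cdot> f) = Idn C A" using ty f'(2) by simp
    have "g \<cdot> (f \<cdot> (f' \<cdot> g')) = g \<cdot> (Idn C B \<cdot> g')"
      using reassoc[OF f'(3), of g'] ty by simp
    then show "(g \<cdot> f) \<cdot> (f' \<cdot> g') = Idn C D" using ty g'(3) by simp
  qed (use ty in simp_all)
qed

lemma (in cfunctor) is_iso_amap: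
  assumes "is_iso C f"
  shows "is_iso D (amap F f)"
proof -
  have f: "f \<in> Arr C" using assms unfolding is_iso_def by blast
  obtain g where g: "g \<in> hom C (Cod C f) (Dom C f)" "g \<cdot>\<^bsub>C\<^esub> f = Idn C (Dom C f)" "f \<cdot>\<^bsub>C\<^esub> g = Idn C (Cod C f)"
    using assms unfolding is_iso_def by blast
  show ?thesis
    by (rule tgt.is_isoI[of _ "omap F (Dom C f)" "omap F (Cod C f)" "amap F g"])
      (use f g amap_eq[OF g(2)] amap_eq[OF g(3)] in simp_all)
qed

locale strong_morphism = p1: pointed_endo E1 T1 + p2: pointed_endo E2 T2 + F: cfunctor E1 E2 F
  for E1 :: "('o, 'a) cat" and T1 and E2 :: "('o, 'a) cat" and T2 and F +
  fixes \<gamma> :: "'o \<Rightarrow> 'a"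
  assumes strong: "(F, \<gamma>) \<in> ptd_strong_hom E1 T1 E2 T2"
begin

lemma
  assumes "A \<in> Obj E1"
  shows comparison_arr [simp]: "\<gamma> A \<in> Arr E2" "Dom E2 (\<gamma> A) = omap F (omap (endo T1) A)"
      "Cod E2 (\<gamma> A) = omap (endo T2) (omap F A)"
    and comparison_iso: "is_iso E2 (\<gamma> A)"
    and comparison_point: "\<gamma> A \<cdot>\<^bsub>E2\<^esub> amap F (point T1 A) = point T2 (omap F A)"
  using strong assms unfolding ptd_strong_hom_def nat_iso_def nat_trans_def by auto

lemma comparison_nat:
  "\<lbrakk>f \<in> Arr E1; Dom E1 f = A; Cod E1 f = B\<rbrakk>
    \<Longrightarrow> \<gamma> B \<cdot>\<^bsub>E2\<^esub> amap F (amap (endo T1) f) = amap (endo T2) (amap F f) \<cdot>\<^bsub>E2\<^esub> \<gamma> A"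
  using strong unfolding ptd_strong_hom_def nat_iso_def nat_trans_def by auto

lemma comparison_extensional: "\<gamma> \<in> extensional (Obj E1)"
  using strong unfolding ptd_strong_hom_def nat_iso_def nat_trans_def by auto

end

lemma strong_morphismI:
  assumes "is_ptd_endo E1 T1" "is_ptd_endo E2 T2" "(F, \<gamma>) \<in> ptd_strong_hom E1 T1 E2 T2"
  shows "strong_morphism E1 T1 E2 T2 F \<gamma>"
proof -
  have F: "cat_functor E1 E2 F" using assms(3) unfolding ptd_strong_hom_def by blast
  show ?thesis
    using F assms unfolding cat_functor_def
    by (intro strong_morphism.intro pointed_endo.intro cfunctor.intro
        strong_morphism_axioms.intro pointed_endo_axioms.intro F) auto
qed

lemma ptd_strong_homI:
  assumes "cat_functor E1 E2 F" "cat_functor E1 E1 (endo T1)" "cat_functor E2 E2 (endo T2)"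
    and "\<gamma> \<in> extensional (Obj E1)"
    and "\<And>A. A \<in> Obj E1 \<Longrightarrow>
      \<gamma> A \<in> hom E2 (omap F (omap (endo T1) A)) (omap (endo T2) (omap F A)) \<and> is_iso E2 (\<gamma> A)"
    and "\<And>f. f \<in> Arr E1 \<Longrightarrow> \<gamma> (Cod E1 f) \<cdot>\<^bsub>E2\<^esub> amap F (amap (endo T1) f) =
      amap (endo T2) (amap F f) \<cdot>\<^bsub>E2\<^esub> \<gamma> (Dom E1 f)"
    and "\<And>A. A \<in> Obj E1 \<Longrightarrow> \<gamma> A \<cdot>\<^bsub>E2\<^esub> amap F (point T1 A) = point T2 (omap F A)"
  shows "(F, \<gamma>) \<in> ptd_strong_hom E1 T1 E2 T2"
proof -
  interpret cfunctor E1 E2 F by standard fact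
  show ?thesis
    using assms cat_functor_comp[OF assms(2,1)] cat_functor_comp[OF assms(1,3)]
    unfolding ptd_strong_hom_def nat_iso_def nat_trans_def by auto
qed

lemma strong_id_ptd:
  assumes "is_ptd_endo E T"
  shows "strong_id E (endo T) \<in> ptd_strong_hom E T E T"
proof -
  have "category E" using assms unfolding is_ptd_endo_def nat_trans_def cat_functor_def by blast
  then interpret pointed_endo E T by (intro pointed_endo.intro pointed_endo_axioms.intro assms)
  show ?thesis
    unfolding strong_id_def
    by (rule ptd_strong_homI)
      (use cat_functor_id[OF category_axioms] T.is_functor is_iso_Idn in auto)
qed

lemma strong_comp_ptd:
  assumes F: "strong_morphism E1 T1 E2 T2 F \<gamma>" and G: "strong_morphism E2 T2 E3 T3 G \<delta>"
  shows "strong_comp E1 E3 (G, \<delta>) (F, \<gamma>) \<in> ptd_strong_hom E1 T1 E3 T3"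
proof -
  interpret F: strong_morphism E1 T1 E2 T2 F \<gamma> by (rule F)
  interpret G: strong_morphism E2 T2 E3 T3 G \<delta> by (rule G)
  show ?thesis
    unfolding strong_comp_def prod.case
  proof (rule ptd_strong_homI)
    show "cat_functor E1 E3 (comp_functor E1 G F)"
      by (rule cat_functor_comp[OF F.F.is_functor G.F.is_functor])
    show "cat_functor E1 E1 (endo T1)" "cat_functor E3 E3 (endo T3)"
      by (rule F.p1.T.is_functor G.p2.T.is_functor)+
    fix A assume A: "A \<in> Obj E1"
    have "is_iso E3 (\<delta> (omap F A) \<cdot>\<^bsub>E3\<^esub> amap G (\<gamma> A))"
      by (rule G.p2.is_iso_Cmp[OF G.F.is_iso_amap[OF F.comparison_iso[OF A]] G.comparison_iso])
        (use A in simp_all)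
    then show "(\<lambda>A\<in>Obj E1. \<delta> (omap F A) \<cdot>\<^bsub>E3\<^esub> amap G (\<gamma> A)) A
         \<in> hom E3 (omap (comp_functor E1 G F) (omap (endo T1) A))
             (omap (endo T3) (omap (comp_functor E1 G F) A)) \<and>
         is_iso E3 ((\<lambda>A\<in>Obj E1. \<delta> (omap F A) \<cdot>\<^bsub>E3\<^esub> amap G (\<gamma> A)) A)" using A by simp
    have "(\<delta> (omap F A) \<cdot>\<^bsub>E3\<^esub> amap G (\<gamma> A)) \<cdot>\<^bsub>E3\<^esub> amap G (amap F (point T1 A)) =
        \<delta> (omap F A) \<cdot>\<^bsub>E3\<^esub> amap G (point T2 (omap F A))"
      using A G.F.amap_eq[OF F.comparison_point[OF A]] by simp
    then show "(\<lambda>A\<in>Obj E1. \<delta> (omap F A) \<cdot>\<^bsub>E3\<^esub> amap G (\<gamma> A)) A \<cdot>\<^bsub>E3\<^esub>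
        amap (comp_functor E1 G F) (point T1 A) = point T3 (omap (comp_functor E1 G F) A)"
      using A G.comparison_point by simp
  next
    fix f assume f: "f \<in> Arr E1"
    have "\<delta> (omap F (Cod E1 f)) \<cdot>\<^bsub>E3\<^esub> (amap G (\<gamma> (Cod E1 f)) \<cdot>\<^bsub>E3\<^esub> amap G (amap F (amap (endo T1) f))) =
        \<delta> (omap F (Cod E1 f)) \<cdot>\<^bsub>E3\<^esub> (amap G (amap (endo T2) (amap F f)) \<cdot>\<^bsub>E3\<^esub> amap G (\<gamma> (Dom E1 f)))"
      using f G.F.amap_square[OF F.comparison_nat[OF f refl refl]] by simp
    also have "\<dots> = (amap (endo T3) (amap G (amap F f)) \<cdot>\<^bsub>E3\<^esub> \<delta> (omap F (Dom E1 f))) \<cdot>\<^bsub>E3\<^esub>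
        amap G (\<gamma> (Dom E1 f))"
      by (rule G.p2.reassoc[OF G.comparison_nat]) (use f in simp_all)
    finally show "(\<lambda>A\<in>Obj E1. \<delta> (omap F A) \<cdot>\<^bsub>E3\<^esub> amap G (\<gamma> A)) (Cod E1 f) \<cdot>\<^bsub>E3\<^esub>
         amap (comp_functor E1 G F) (amap (endo T1) f) =
         amap (endo T3) (amap (comp_functor E1 G F) f) \<cdot>\<^bsub>E3\<^esub>
         (\<lambda>A\<in>Obj E1. \<delta> (omap F A) \<cdot>\<^bsub>E3\<^esub> amap G (\<gamma> A)) (Dom E1 f)"
      using f by simp
  qed simp
qed

lemma strong_comp_units:
  assumes "strong_morphism E1 T1 E2 T2 F \<gamma>"
  shows "strong_comp E1 E2 (F, \<gamma>) (strong_id E1 (endo T1)) = (F, \<gamma>)"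
    and "strong_comp E1 E2 (strong_id E2 (endo T2)) (F, \<gamma>) = (F, \<gamma>)"
proof -
  interpret strong_morphism E1 T1 E2 T2 F \<gamma> by fact
  show "strong_comp E1 E2 (F, \<gamma>) (strong_id E1 (endo T1)) = (F, \<gamma>)"
    "strong_comp E1 E2 (strong_id E2 (endo T2)) (F, \<gamma>) = (F, \<gamma>)"
    using comparison_extensional
    by (auto simp: strong_comp_def strong_id_def comp_functor_id[OF F.is_functor]
        intro!: extensionalityI[where A = "Obj E1"])
qed

lemma strong_comp_assoc:
  assumes "strong_morphism E1 T1 E2 T2 F \<gamma>" "strong_morphism E2 T2 E3 T3 G \<delta>"
    and "strong_morphism E3 T3 E4 T4 H \<epsilon>"
  shows "strong_comp E1 E4 (strong_comp E2 E4 (H, \<epsilon>) (G, \<delta>)) (F, \<gamma>) =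
    strong_comp E1 E4 (H, \<epsilon>) (strong_comp E1 E3 (G, \<delta>) (F, \<gamma>))"
proof -
  interpret F: strong_morphism E1 T1 E2 T2 F \<gamma> by fact
  interpret G: strong_morphism E2 T2 E3 T3 G \<delta> by fact
  interpret H: strong_morphism E3 T3 E4 T4 H \<epsilon> by fact
  show ?thesis
    by (auto simp: strong_comp_def comp_functor_assoc[OF F.F.is_functor] intro!: restrict_ext)
qed

lemma ptd_of_simps [simp]: "endo (ptd_of M) = endo M" "point (ptd_of M) = point M"
  by (simp_all add: ptd_of_def)

section \<open>The categories of monads and of configurations\<close>

lemma strong_morphism_monad:
  assumes "is_monad E1 M1" "is_monad E2 M2" "(F, \<gamma>) \<in> monad_strong_hom E1 M1 E2 M2"
  shows "strong_morphism E1 (ptd_of M1) E2 (ptd_of M2) F \<gamma>"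
    and "\<And>A. A \<in> Obj E1 \<Longrightarrow> \<gamma> A \<cdot>\<^bsub>E2\<^esub> amap F (multn M1 A) = multn M2 (omap F A) \<cdot>\<^bsub>E2\<^esub>
      (amap (endo M2) (\<gamma> A) \<cdot>\<^bsub>E2\<^esub> \<gamma> (omap (endo M1) A))"
  using assms is_monadD(1) by (auto simp: monad_strong_hom_def intro!: strong_morphismI)

text \<open>The two compatibility squares with multiplication are pasted; the square between them is
  naturality of \<open>\<delta>\<close> at \<open>\<gamma> A\<close>.\<close>

lemma strong_comp_monad:
  assumes M: "is_monad E1 M1" "is_monad E2 M2" "is_monad E3 M3"
    and F\<gamma>: "(F, \<gamma>) \<in> monad_strong_hom E1 M1 E2 M2" and G\<delta>: "(G, \<delta>) \<in> monad_strong_hom E2 M2 E3 M3"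
  shows "strong_comp E1 E3 (G, \<delta>) (F, \<gamma>) \<in> monad_strong_hom E1 M1 E3 M3"
proof -
  note S = strong_morphism_monad[OF M(1,2) F\<gamma>] strong_morphism_monad[OF M(2,3) G\<delta>]
  interpret F: strong_morphism E1 "ptd_of M1" E2 "ptd_of M2" F \<gamma> by (rule S)
  interpret G: strong_morphism E2 "ptd_of M2" E3 "ptd_of M3" G \<delta> by (rule S)
  note F.comparison_arr[unfolded ptd_of_simps, simp] G.comparison_arr[unfolded ptd_of_simps, simp]
    F.p1.T.omap_Obj[unfolded ptd_of_simps, simp] F.p2.T.omap_Obj[unfolded ptd_of_simps, simp]
    G.p2.T.omap_Obj[unfolded ptd_of_simps, simp]
    F.p2.T.amap_arr[unfolded ptd_of_simps, simp] G.p2.T.amap_arr[unfolded ptd_of_simps, simp]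
    G.p2.T.amap_Cmp[unfolded ptd_of_simps, simp]
  have mu1 [simp]: "multn M1 A \<in> Arr E1" "Dom E1 (multn M1 A) = omap (endo M1) (omap (endo M1) A)"
    "Cod E1 (multn M1 A) = omap (endo M1) A" if "A \<in> Obj E1" for A
    using is_monadD(5)[OF M(1) that] by auto
  have mu2 [simp]: "multn M2 A \<in> Arr E2" "Dom E2 (multn M2 A) = omap (endo M2) (omap (endo M2) A)"
    "Cod E2 (multn M2 A) = omap (endo M2) A" if "A \<in> Obj E2" for A
    using is_monadD(5)[OF M(2) that] by auto
  have mu3 [simp]: "multn M3 A \<in> Arr E3" "Dom E3 (multn M3 A) = omap (endo M3) (omap (endo M3) A)"
    "Cod E3 (multn M3 A) = omap (endo M3) A" if "A \<in> Obj E3" for A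
    using is_monadD(5)[OF M(3) that] by auto
  have "(\<delta> (omap F A) \<cdot>\<^bsub>E3\<^esub> amap G (\<gamma> A)) \<cdot>\<^bsub>E3\<^esub> amap G (amap F (multn M1 A)) =
      multn M3 (omap G (omap F A)) \<cdot>\<^bsub>E3\<^esub>
        (amap (endo M3) (\<delta> (omap F A) \<cdot>\<^bsub>E3\<^esub> amap G (\<gamma> A)) \<cdot>\<^bsub>E3\<^esub>
          (\<delta> (omap F (omap (endo M1) A)) \<cdot>\<^bsub>E3\<^esub> amap G (\<gamma> (omap (endo M1) A))))"
    if A: "A \<in> Obj E1" for A
  proof -
    have "(\<delta> (omap F A) \<cdot>\<^bsub>E3\<^esub> amap G (\<gamma> A)) \<cdot>\<^bsub>E3\<^esub> amap G (amap F (multn M1 A)) =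
        \<delta> (omap F A) \<cdot>\<^bsub>E3\<^esub> amap G (\<gamma> A \<cdot>\<^bsub>E2\<^esub> amap F (multn M1 A))"
      using A by simp
    also have "\<dots> = \<delta> (omap F A) \<cdot>\<^bsub>E3\<^esub> (amap G (multn M2 (omap F A)) \<cdot>\<^bsub>E3\<^esub>
        (amap G (amap (endo M2) (\<gamma> A)) \<cdot>\<^bsub>E3\<^esub> amap G (\<gamma> (omap (endo M1) A))))"
      unfolding S(2)[OF A] using A by simp
    also have "\<dots> = (multn M3 (omap G (omap F A)) \<cdot>\<^bsub>E3\<^esub>
        (amap (endo M3) (\<delta> (omap F A)) \<cdot>\<^bsub>E3\<^esub> \<delta> (omap (endo M2) (omap F A)))) \<cdot>\<^bsub>E3\<^esub>
        (amap G (amap (endo M2) (\<gamma> A)) \<cdot>\<^bsub>E3\<^esub> amap G (\<gamma> (omap (endo M1) A)))"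
      by (rule G.p2.reassoc[OF S(4)]) (use A in simp_all)
    also have "\<dots> = multn M3 (omap G (omap F A)) \<cdot>\<^bsub>E3\<^esub>
        (amap (endo M3) (\<delta> (omap F A)) \<cdot>\<^bsub>E3\<^esub> (\<delta> (omap (endo M2) (omap F A)) \<cdot>\<^bsub>E3\<^esub>
        (amap G (amap (endo M2) (\<gamma> A)) \<cdot>\<^bsub>E3\<^esub> amap G (\<gamma> (omap (endo M1) A)))))"
      using A by simp
    also have "\<delta> (omap (endo M2) (omap F A)) \<cdot>\<^bsub>E3\<^esub>
        (amap G (amap (endo M2) (\<gamma> A)) \<cdot>\<^bsub>E3\<^esub> amap G (\<gamma> (omap (endo M1) A))) =
        (amap (endo M3) (amap G (\<gamma> A)) \<cdot>\<^bsub>E3\<^esub> \<delta> (omap F (omap (endo M1) A))) \<cdot>\<^bsub>E3\<^esub>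
          amap G (\<gamma> (omap (endo M1) A))"
      by (rule G.p2.reassoc[OF G.comparison_nat[unfolded ptd_of_simps]]) (use A in simp_all)
    finally show ?thesis using A by simp
  qed
  then show ?thesis
    using strong_comp_ptd[OF S(1,3)]
    by (simp add: monad_strong_hom_def strong_comp_def)
qed

lemma strong_id_monad:
  assumes "is_monad E M"
  shows "strong_id E (endo M) \<in> monad_strong_hom E M E M"
proof -
  interpret cfunctor E E "endo M" by unfold_locales (rule is_monadD[OF assms])
  have "Idn E (omap (endo M) A) \<cdot>\<^bsub>E\<^esub> amap (id_functor E) (multn M A) =
      multn M A \<cdot>\<^bsub>E\<^esub> (amap (endo M) (Idn E (omap (endo M) A)) \<cdot>\<^bsub>E\<^esub> Idn E (omap (endo M) (omap (endo M) A)))"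
    if "A \<in> Obj E" for A
    using is_monadD(5)[OF assms that] that by simp
  then show ?thesis
    using strong_id_ptd[OF is_monadD(1)[OF assms]] unfolding monad_strong_hom_def
    by (simp add: strong_id_def)
qed

lemma category_Mnd_s: "category (Mnd_s :: (('o, 'a) mnd_obj, (('o, 'a) mnd_obj, ('o, 'a) strong) tagged) cat)"
  unfolding Mnd_s_def
proof (rule category_concrete_cat; clarsimp)
  fix E :: "('o, 'a) cat" and M
  assume "is_monad E M"
  then show "strong_id E (endo M) \<in> monad_strong_hom E M E M" by (rule strong_id_monad)
next
  fix E1 :: "('o, 'a) cat" and M1 E2 M2 E3 M3 F \<gamma> G \<delta>
  assume "is_monad E1 M1" "is_monad E2 M2" "is_monad E3 M3"
    "(F, \<gamma>) \<in> monad_strong_hom E1 M1 E2 M2" "(G, \<delta>) \<in> monad_strong_hom E2 M2 E3 M3"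
  then show "strong_comp E1 E3 (G, \<delta>) (F, \<gamma>) \<in> monad_strong_hom E1 M1 E3 M3"
    by (rule strong_comp_monad)
next
  fix E1 :: "('o, 'a) cat" and M1 E2 M2 F \<gamma>
  assume "is_monad E1 M1" "is_monad E2 M2" "(F, \<gamma>) \<in> monad_strong_hom E1 M1 E2 M2"
  note S = strong_comp_units[OF strong_morphism_monad(1)[OF this], unfolded ptd_of_simps]
  show "strong_comp E1 E2 (F, \<gamma>) (strong_id E1 (endo M1)) = (F, \<gamma>)" by (rule S)
  show "strong_comp E1 E2 (strong_id E2 (endo M2)) (F, \<gamma>) = (F, \<gamma>)" by (rule S)
next
  fix E1 :: "('o, 'a) cat" and M1 E2 M2 E3 M3 E4 M4 F \<gamma> G \<delta> H \<epsilon>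
  assume M: "is_monad E1 M1" "is_monad E2 M2" "is_monad E3 M3" "is_monad E4 M4"
    and H: "(F, \<gamma>) \<in> monad_strong_hom E1 M1 E2 M2" "(G, \<delta>) \<in> monad_strong_hom E2 M2 E3 M3"
    "(H, \<epsilon>) \<in> monad_strong_hom E3 M3 E4 M4"
  show "strong_comp E1 E4 (strong_comp E2 E4 (H, \<epsilon>) (G, \<delta>)) (F, \<gamma>) =
      strong_comp E1 E4 (H, \<epsilon>) (strong_comp E1 E3 (G, \<delta>) (F, \<gamma>))"
    by (rule strong_comp_assoc[OF strong_morphism_monad(1)[OF M(1,2) H(1)]
          strong_morphism_monad(1)[OF M(2,3) H(2)] strong_morphism_monad(1)[OF M(3,4) H(3)]])
qed

lemma is_conf_objD:
  assumes "is_conf_obj \<kappa> (E, M, T)"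
  shows "category E" "wide_subcat E M" "is_ptd_endo E T"
  using assms unfolding is_conf_obj_def by auto

lemma configurationI:
  assumes "Well_order \<kappa>" "is_conf_obj \<kappa> (E, M, T)"
  shows "configuration \<kappa> E M T"
  using assms unfolding is_conf_obj_def
  by (intro configuration.intro backdrop_cat.intro well_order.intro backdrop_cat_axioms.intro
      pointed_endo.intro pointed_endo_axioms.intro configuration_axioms.intro) auto

lemma category_ConfMnd:
  assumes wo: "Well_order (\<kappa> :: 'k rel)"
  shows "category (ConfMnd \<kappa> :: (('o, 'a) conf_obj, (('o, 'a) conf_obj, ('o, 'a) strong) tagged) cat)"
  unfolding ConfMnd_def
proof (rule category_concrete_cat; clarsimp split: prod.splits)
  fix E :: "('o, 'a) cat" and M T F \<gamma>
  assume c: "is_conf_obj \<kappa> (E, M, T)" and "strong_id E (endo T) = (F, \<gamma>)"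
  then interpret configuration \<kappa> E M T by (intro configurationI wo)
  show "(F, \<gamma>) \<in> ptd_strong_hom E T E T \<and> backdrop_preserving \<kappa> E M E M F"
    using strong_id_ptd[OF ptd] backdrop_preserving_id \<open>strong_id E (endo T) = (F, \<gamma>)\<close>
    by (auto simp: strong_id_def)
next
  fix E1 :: "('o, 'a) cat" and M1 T1 E2 M2 T2 E3 M3 T3 F \<gamma> G \<delta> H \<epsilon>
  assume c: "is_conf_obj \<kappa> (E1, M1, T1)" "is_conf_obj \<kappa> (E2, M2, T2)" "is_conf_obj \<kappa> (E3, M3, T3)"
    and "(F, \<gamma>) \<in> ptd_strong_hom E1 T1 E2 T2" "backdrop_preserving \<kappa> E1 M1 E2 M2 F"
    "(G, \<delta>) \<in> ptd_strong_hom E2 T2 E3 T3" "backdrop_preserving \<kappa> E2 M2 E3 M3 G"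
    "strong_comp E1 E3 (G, \<delta>) (F, \<gamma>) = (H, \<epsilon>)"
  then show "(H, \<epsilon>) \<in> ptd_strong_hom E1 T1 E3 T3 \<and> backdrop_preserving \<kappa> E1 M1 E3 M3 H"
    using strong_comp_ptd[OF strong_morphismI strong_morphismI, OF is_conf_objD(3)[OF c(1)]
        is_conf_objD(3)[OF c(2)] _ is_conf_objD(3)[OF c(2)] is_conf_objD(3)[OF c(3)]]
      backdrop_preserving_comp[OF _ _ is_conf_objD(2)[OF c(1)] is_conf_objD(2)[OF c(2)]]
    by (auto simp: strong_comp_def)
next
  fix E1 :: "('o, 'a) cat" and M1 T1 E2 M2 T2 F \<gamma>
  assume "is_conf_obj \<kappa> (E1, M1, T1)" "is_conf_obj \<kappa> (E2, M2, T2)"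
    "(F, \<gamma>) \<in> ptd_strong_hom E1 T1 E2 T2"
  then have "strong_morphism E1 T1 E2 T2 F \<gamma>" by (intro strong_morphismI is_conf_objD(3))
  note S = strong_comp_units[OF this]
  show "strong_comp E1 E2 (F, \<gamma>) (strong_id E1 (endo T1)) = (F, \<gamma>)" by (rule S)
  show "strong_comp E1 E2 (strong_id E2 (endo T2)) (F, \<gamma>) = (F, \<gamma>)" by (rule S)
next
  fix E1 :: "('o, 'a) cat" and M1 T1 E2 M2 T2 E3 M3 T3 E4 M4 T4 F \<gamma> G \<delta> H \<epsilon>
  assume M: "is_conf_obj \<kappa> (E1, M1, T1)" "is_conf_obj \<kappa> (E2, M2, T2)" "is_conf_obj \<kappa> (E3, M3, T3)"
    "is_conf_obj \<kappa> (E4, M4, T4)"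
    and H: "(F, \<gamma>) \<in> ptd_strong_hom E1 T1 E2 T2" "(G, \<delta>) \<in> ptd_strong_hom E2 T2 E3 T3"
    "(H, \<epsilon>) \<in> ptd_strong_hom E3 T3 E4 T4"
  note pt = M[THEN is_conf_objD(3)]
  show "strong_comp E1 E4 (strong_comp E2 E4 (H, \<epsilon>) (G, \<delta>)) (F, \<gamma>) =
      strong_comp E1 E4 (H, \<epsilon>) (strong_comp E1 E3 (G, \<delta>) (F, \<gamma>))"
    by (rule strong_comp_assoc[OF strong_morphismI[OF pt(1,2) H(1)]
          strong_morphismI[OF pt(2,3) H(2)] strong_morphismI[OF pt(3,4) H(3)]])
qed


section \<open>Functoriality of the free monad\<close>

text \<open>The effect of \<open>F\<close> preserving colimits is condensed into the assumption
  \<open>along\<close>; the comparison of free monads and all its properties are derived from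
  that.\<close>

locale free_algebra_morphism = A1: free_algebras E1 T1 N1 x1 \<eta>1 + A2: free_algebras E2 T2 N2 x2 \<eta>2 +
    strong_morphism E1 T1 E2 T2 F \<gamma>
  for E1 :: "('o, 'a) cat" and T1 N1 x1 \<eta>1 and E2 :: "('o, 'a) cat" and T2 N2 x2 \<eta>2 and F \<gamma> +
  assumes along: "A \<in> Obj E1 \<Longrightarrow> is_free_along E2 T2 F \<gamma> A (N1 A) (x1 A) (\<eta>1 A)"
begin

text \<open>Algebra maps out of \<open>F (N1 A)\<close> with the transported structure, written
  without an inverse of \<open>\<gamma>\<close>; the transported structure map itself is formed only
  in \<open>theta_iso\<close>.\<close>

definition along_hom :: "'o \<Rightarrow> 'a \<Rightarrow> 'a \<Rightarrow> bool" where
  "along_hom A b h \<longleftrightarrow> A2.alg b \<and> h \<in> hom E2 (omap F (N1 A)) (Cod E2 b) \<and>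
     h \<cdot>\<^bsub>E2\<^esub> amap F (x1 A) = b \<cdot>\<^bsub>E2\<^esub> (amap (endo T2) h \<cdot>\<^bsub>E2\<^esub> \<gamma> (N1 A))"

lemma along_hom_ex1:
  assumes "A \<in> Obj E1" "A2.alg b" "g \<in> hom E2 (omap F A) (Cod E2 b)"
  shows "\<exists>!h. along_hom A b h \<and> h \<cdot>\<^bsub>E2\<^esub> amap F (\<eta>1 A) = g"
proof -
  have "b \<in> hom E2 (omap (endo T2) (Cod E2 b)) (Cod E2 b)"
    "b \<cdot>\<^bsub>E2\<^esub> point T2 (Cod E2 b) = Idn E2 (Cod E2 b)" "Cod E2 b \<in> Obj E2"
    using assms(2) unfolding A2.alg_def by auto
  then have "\<exists>!h. h \<in> hom E2 (omap F (N1 A)) (Cod E2 b) \<and> h \<cdot>\<^bsub>E2\<^esub> amap F (\<eta>1 A) = g \<and>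
      h \<cdot>\<^bsub>E2\<^esub> amap F (x1 A) = b \<cdot>\<^bsub>E2\<^esub> (amap (endo T2) h \<cdot>\<^bsub>E2\<^esub> \<gamma> (N1 A))"
    using along[OF assms(1)] assms(3) unfolding is_free_along_def by blast
  then show ?thesis using assms(2) by (auto simp: along_hom_def)
qed

lemma along_hom_eq:
  assumes "along_hom A b h" "along_hom A b g" "h \<cdot>\<^bsub>E2\<^esub> amap F (\<eta>1 A) = g \<cdot>\<^bsub>E2\<^esub> amap F (\<eta>1 A)"
    and "A \<in> Obj E1"
  shows "h = g"
proof -
  have "h \<cdot>\<^bsub>E2\<^esub> amap F (\<eta>1 A) \<in> hom E2 (omap F A) (Cod E2 b)" "A2.alg b"
    using assms unfolding along_hom_def by auto
  from along_hom_ex1[OF assms(4) this(2,1)] show ?thesis using assms by auto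
qed

lemma along_hom_comp:
  assumes h: "along_hom A b h" and g: "A2.alg_hom b c g" and A: "A \<in> Obj E1"
  shows "along_hom A c (g \<cdot>\<^bsub>E2\<^esub> h)"
proof -
  have ty: "b \<in> Arr E2" "c \<in> Arr E2" "Dom E2 b = omap (endo T2) (Cod E2 b)"
    "Dom E2 c = omap (endo T2) (Cod E2 c)" "h \<in> Arr E2" "Dom E2 h = omap F (N1 A)" "Cod E2 h = Cod E2 b"
    "g \<in> Arr E2" "Dom E2 g = Cod E2 b" "Cod E2 g = Cod E2 c"
    and eq: "h \<cdot>\<^bsub>E2\<^esub> amap F (x1 A) = b \<cdot>\<^bsub>E2\<^esub> (amap (endo T2) h \<cdot>\<^bsub>E2\<^esub> \<gamma> (N1 A))"
      "g \<cdot>\<^bsub>E2\<^esub> b = c \<cdot>\<^bsub>E2\<^esub> amap (endo T2) g"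
    using h g unfolding along_hom_def A2.alg_hom_def A2.alg_def by auto
  have "(g \<cdot>\<^bsub>E2\<^esub> h) \<cdot>\<^bsub>E2\<^esub> amap F (x1 A) = g \<cdot>\<^bsub>E2\<^esub> (b \<cdot>\<^bsub>E2\<^esub> (amap (endo T2) h \<cdot>\<^bsub>E2\<^esub> \<gamma> (N1 A)))"
    using ty eq(1) A by simp
  also have "\<dots> = (c \<cdot>\<^bsub>E2\<^esub> amap (endo T2) g) \<cdot>\<^bsub>E2\<^esub> (amap (endo T2) h \<cdot>\<^bsub>E2\<^esub> \<gamma> (N1 A))"
    by (rule A2.reassoc[OF eq(2)]) (use ty A in simp_all)
  finally show ?thesis
    using g ty A unfolding along_hom_def A2.alg_hom_def by simp
qed

lemma along_hom_pre:
  assumes h: "along_hom B b h" and k: "A1.alg_hom (x1 A) (x1 B) k" and A: "A \<in> Obj E1" "B \<in> Obj E1"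
  shows "along_hom A b (h \<cdot>\<^bsub>E2\<^esub> amap F k)"
proof -
  have ty: "b \<in> Arr E2" "Dom E2 b = omap (endo T2) (Cod E2 b)"
    "h \<in> Arr E2" "Dom E2 h = omap F (N1 B)" "Cod E2 h = Cod E2 b"
    "k \<in> Arr E1" "Dom E1 k = N1 A" "Cod E1 k = N1 B"
    and eq: "h \<cdot>\<^bsub>E2\<^esub> amap F (x1 B) = b \<cdot>\<^bsub>E2\<^esub> (amap (endo T2) h \<cdot>\<^bsub>E2\<^esub> \<gamma> (N1 B))"
      "k \<cdot>\<^bsub>E1\<^esub> x1 A = x1 B \<cdot>\<^bsub>E1\<^esub> amap (endo T1) k"
    using h k A unfolding along_hom_def A1.alg_hom_def A2.alg_def by auto
  have "(h \<cdot>\<^bsub>E2\<^esub> amap F k) \<cdot>\<^bsub>E2\<^esub> amap F (x1 A) =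
      h \<cdot>\<^bsub>E2\<^esub> (amap F (x1 B) \<cdot>\<^bsub>E2\<^esub> amap F (amap (endo T1) k))"
    using F.amap_square[OF eq(2)] ty A by simp
  also have "\<dots> = (b \<cdot>\<^bsub>E2\<^esub> (amap (endo T2) h \<cdot>\<^bsub>E2\<^esub> \<gamma> (N1 B))) \<cdot>\<^bsub>E2\<^esub> amap F (amap (endo T1) k)"
    by (rule A2.reassoc[OF eq(1)]) (use ty A in simp_all)
  also have "\<dots> = b \<cdot>\<^bsub>E2\<^esub> (amap (endo T2) (h \<cdot>\<^bsub>E2\<^esub> amap F k) \<cdot>\<^bsub>E2\<^esub> \<gamma> (N1 A))"
    using ty A comparison_nat[OF ty(6-8)] by simp
  finally show ?thesis using h ty A unfolding along_hom_def by simp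
qed

definition theta :: "'o \<Rightarrow> 'a" where
  "theta = (\<lambda>A \<in> Obj E1. THE h. along_hom A (x2 (omap F A)) h \<and>
     h \<cdot>\<^bsub>E2\<^esub> amap F (\<eta>1 A) = \<eta>2 (omap F A))"

lemma
  assumes A: "A \<in> Obj E1"
  shows theta_hom: "along_hom A (x2 (omap F A)) (theta A)"
    and theta_unit: "theta A \<cdot>\<^bsub>E2\<^esub> amap F (\<eta>1 A) = \<eta>2 (omap F A)"
proof -
  have "\<exists>!h. along_hom A (x2 (omap F A)) h \<and> h \<cdot>\<^bsub>E2\<^esub> amap F (\<eta>1 A) = \<eta>2 (omap F A)"
    by (rule along_hom_ex1) (use A in simp_all)
  from theI'[OF this] show "along_hom A (x2 (omap F A)) (theta A)"
    "theta A \<cdot>\<^bsub>E2\<^esub> amap F (\<eta>1 A) = \<eta>2 (omap F A)"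
    using A by (simp_all add: theta_def)
qed

lemma theta_arr [simp]:
  assumes "A \<in> Obj E1"
  shows "theta A \<in> Arr E2" "Dom E2 (theta A) = omap F (N1 A)" "Cod E2 (theta A) = N2 (omap F A)"
  using theta_hom[OF assms] assms unfolding along_hom_def by auto

lemma theta_extensional: "theta \<in> extensional (Obj E1)"
  by (simp add: theta_def)

text \<open>Turns the characterisation of the comparison into an equality of functions. Preservation
  of identities and composites holds on the nose for this reason.\<close>

lemma theta_eqI:
  assumes "\<theta> \<in> extensional (Obj E1)"
    and "\<And>A. A \<in> Obj E1 \<Longrightarrow> along_hom A (x2 (omap F A)) (\<theta> A)"
    and "\<And>A. A \<in> Obj E1 \<Longrightarrow> \<theta> A \<cdot>\<^bsub>E2\<^esub> amap F (\<eta>1 A) = \<eta>2 (omap F A)"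
  shows "\<theta> = theta"
proof (rule extensionalityI[OF assms(1)])
  show "theta \<in> extensional (Obj E1)" by (rule theta_extensional)
  show "\<theta> A = theta A" if "A \<in> Obj E1" for A
    by (rule along_hom_eq[OF assms(2) theta_hom]) (use that assms(3) theta_unit in simp_all)
qed

text \<open>\<open>F (N1 A)\<close> and \<open>N2 (F A)\<close> are both free on \<open>F A\<close>,
  so the comparison has an inverse; the two composites are identities by uniqueness on either
  side.\<close>

lemma theta_iso:
  assumes A: "A \<in> Obj E1"
  shows "is_iso E2 (theta A)"
proof -
  obtain g where "g \<in> hom E2 (omap (endo T2) (omap F (N1 A))) (omap F (omap (endo T1) (N1 A)))"
    and g\<gamma>: "g \<cdot>\<^bsub>E2\<^esub> \<gamma> (N1 A) = Idn E2 (omap F (omap (endo T1) (N1 A)))"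
    and \<gamma>g: "\<gamma> (N1 A) \<cdot>\<^bsub>E2\<^esub> g = Idn E2 (omap (endo T2) (omap F (N1 A)))"
    by (rule A2.is_iso_inverse[OF comparison_iso[of "N1 A"],
          of "omap F (omap (endo T1) (N1 A))" "omap (endo T2) (omap F (N1 A))"]) (use A in simp_all)
  then have g: "g \<in> Arr E2" "Dom E2 g = omap (endo T2) (omap F (N1 A))"
    "Cod E2 g = omap F (omap (endo T1) (N1 A))" by auto
  \<comment> \<open>The structure map on \<open>F (N1 A)\<close> transported along the inverse
    \<open>g\<close> of \<open>\<gamma> (N1 A)\<close>. Maps \<open>along_hom\<close> out of it are
    then ordinary algebra maps.\<close>
  define c where "c = amap F (x1 A) \<cdot>\<^bsub>E2\<^esub> g"
  have c: "c \<in> Arr E2" "Dom E2 c = omap (endo T2) (omap F (N1 A))" "Cod E2 c = omap F (N1 A)"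
    using g A by (simp_all add: c_def)
  have c_\<gamma>: "c \<cdot>\<^bsub>E2\<^esub> \<gamma> (N1 A) = amap F (x1 A)" using g g\<gamma> A by (simp add: c_def)
  have "c \<cdot>\<^bsub>E2\<^esub> (\<gamma> (N1 A) \<cdot>\<^bsub>E2\<^esub> amap F (point T1 (N1 A))) = amap F (x1 A) \<cdot>\<^bsub>E2\<^esub> amap F (point T1 (N1 A))"
    by (rule A2.reassoc[OF c_\<gamma>]) (use c A in simp_all)
  then have c_alg: "A2.alg c"
    using c A comparison_point[of "N1 A"] F.amap_eq[OF A1.x_point[OF A]] by (simp add: A2.alg_def)
  define k where "k = A2.lift (omap F A) c (amap F (\<eta>1 A))"
  have k: "A2.alg_hom (x2 (omap F A)) c k" "k \<cdot>\<^bsub>E2\<^esub> \<eta>2 (omap F A) = amap F (\<eta>1 A)"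
    unfolding k_def using A2.lift_hom[OF _ c_alg, of "omap F A" "amap F (\<eta>1 A)"]
      A2.lift_unit[OF _ c_alg, of "omap F A" "amap F (\<eta>1 A)"] A c by simp_all
  have k_arr: "k \<in> Arr E2" "Dom E2 k = N2 (omap F A)" "Cod E2 k = omap F (N1 A)"
    using k(1) A c unfolding A2.alg_hom_def by auto
  have \<theta>x: "theta A \<cdot>\<^bsub>E2\<^esub> amap F (x1 A) =
      x2 (omap F A) \<cdot>\<^bsub>E2\<^esub> (amap (endo T2) (theta A) \<cdot>\<^bsub>E2\<^esub> \<gamma> (N1 A))"
    using theta_hom[OF A] unfolding along_hom_def by blast
  have \<theta>: "A2.alg_hom c (x2 (omap F A)) (theta A)"
  proof -
    have "theta A \<cdot>\<^bsub>E2\<^esub> (amap F (x1 A) \<cdot>\<^bsub>E2\<^esub> g) =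
        (x2 (omap F A) \<cdot>\<^bsub>E2\<^esub> (amap (endo T2) (theta A) \<cdot>\<^bsub>E2\<^esub> \<gamma> (N1 A))) \<cdot>\<^bsub>E2\<^esub> g"
      by (rule A2.reassoc[OF \<theta>x]) (use A g in simp_all)
    then have "theta A \<cdot>\<^bsub>E2\<^esub> c = x2 (omap F A) \<cdot>\<^bsub>E2\<^esub> amap (endo T2) (theta A)"
      using A g \<gamma>g by (simp add: c_def)
    then show ?thesis using A c c_alg by (simp add: A2.alg_hom_def)
  qed
  have "k \<cdot>\<^bsub>E2\<^esub> theta A = Idn E2 (omap F (N1 A))"
  proof (rule along_hom_eq)
    show "along_hom A c (k \<cdot>\<^bsub>E2\<^esub> theta A)" by (rule along_hom_comp[OF theta_hom k(1)]) fact+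
    show "along_hom A c (Idn E2 (omap F (N1 A)))"
      using c c_alg c_\<gamma> A by (simp add: along_hom_def)
    show "(k \<cdot>\<^bsub>E2\<^esub> theta A) \<cdot>\<^bsub>E2\<^esub> amap F (\<eta>1 A) = Idn E2 (omap F (N1 A)) \<cdot>\<^bsub>E2\<^esub> amap F (\<eta>1 A)"
      using A k(2) k_arr theta_unit[OF A] by simp
  qed fact
  moreover have "theta A \<cdot>\<^bsub>E2\<^esub> k = Idn E2 (N2 (omap F A))"
  proof (rule A2.alg_hom_eq[of "omap F A" "x2 (omap F A)"])
    show "A2.alg_hom (x2 (omap F A)) (x2 (omap F A)) (theta A \<cdot>\<^bsub>E2\<^esub> k)"
      by (rule A2.alg_hom_comp[OF k(1) \<theta>])
    show "A2.alg_hom (x2 (omap F A)) (x2 (omap F A)) (Idn E2 (N2 (omap F A)))"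
      using A2.alg_hom_Idn[of "x2 (omap F A)"] A by simp
    show "(theta A \<cdot>\<^bsub>E2\<^esub> k) \<cdot>\<^bsub>E2\<^esub> \<eta>2 (omap F A) = Idn E2 (N2 (omap F A)) \<cdot>\<^bsub>E2\<^esub> \<eta>2 (omap F A)"
      using A k(2) k_arr theta_unit[OF A] by simp
  qed (use A in simp)
  ultimately show ?thesis
    by (intro A2.is_isoI[of _ "omap F (N1 A)" "N2 (omap F A)" k]) (use A k_arr in simp_all)
qed

lemma theta_nat:
  assumes f: "f \<in> Arr E1"
  shows "theta (Cod E1 f) \<cdot>\<^bsub>E2\<^esub> amap F (A1.nf f) = A2.nf (amap F f) \<cdot>\<^bsub>E2\<^esub> theta (Dom E1 f)"
proof (rule along_hom_eq)
  show "along_hom (Dom E1 f) (x2 (omap F (Cod E1 f))) (theta (Cod E1 f) \<cdot>\<^bsub>E2\<^esub> amap F (A1.nf f))"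
    by (rule along_hom_pre[OF theta_hom A1.nf_hom]) (use f in simp_all)
  show "along_hom (Dom E1 f) (x2 (omap F (Cod E1 f))) (A2.nf (amap F f) \<cdot>\<^bsub>E2\<^esub> theta (Dom E1 f))"
    by (rule along_hom_comp[OF theta_hom A2.nf_hom]) (use f in simp_all)
  have "theta (Cod E1 f) \<cdot>\<^bsub>E2\<^esub> (amap F (\<eta>1 (Cod E1 f)) \<cdot>\<^bsub>E2\<^esub> amap F f) = \<eta>2 (omap F (Cod E1 f)) \<cdot>\<^bsub>E2\<^esub> amap F f"
    by (rule A2.reassoc[OF theta_unit]) (use f in simp_all)
  then show "(theta (Cod E1 f) \<cdot>\<^bsub>E2\<^esub> amap F (A1.nf f)) \<cdot>\<^bsub>E2\<^esub> amap F (\<eta>1 (Dom E1 f)) =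
      (A2.nf (amap F f) \<cdot>\<^bsub>E2\<^esub> theta (Dom E1 f)) \<cdot>\<^bsub>E2\<^esub> amap F (\<eta>1 (Dom E1 f))"
    using f F.amap_square[OF A1.nf_unit[OF f]] theta_unit[of "Dom E1 f"] A2.nf_unit[of "amap F f"] by simp
qed (use f in simp)

text \<open>Both sides are algebra maps out of the image of the free algebra on \<open>N1 A\<close>,
  and both restrict to \<open>theta A\<close> along the image of the unit.\<close>

lemma theta_mult:
  assumes A: "A \<in> Obj E1"
  shows "theta A \<cdot>\<^bsub>E2\<^esub> amap F (A1.mu A) =
    A2.mu (omap F A) \<cdot>\<^bsub>E2\<^esub> (A2.nf (theta A) \<cdot>\<^bsub>E2\<^esub> theta (N1 A))"
proof (rule along_hom_eq)
  show "along_hom (N1 A) (x2 (omap F A)) (theta A \<cdot>\<^bsub>E2\<^esub> amap F (A1.mu A))"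
    by (rule along_hom_pre[OF theta_hom A1.mu_hom]) (use A in simp_all)
  have "along_hom (N1 A) (x2 (N2 (omap F A))) (A2.nf (theta A) \<cdot>\<^bsub>E2\<^esub> theta (N1 A))"
    by (rule along_hom_comp[OF theta_hom A2.nf_hom]) (use A in simp_all)
  then show "along_hom (N1 A) (x2 (omap F A))
      (A2.mu (omap F A) \<cdot>\<^bsub>E2\<^esub> (A2.nf (theta A) \<cdot>\<^bsub>E2\<^esub> theta (N1 A)))"
    by (rule along_hom_comp[OF _ A2.mu_hom]) (use A in simp_all)
  have "A2.mu (omap F A) \<cdot>\<^bsub>E2\<^esub> (\<eta>2 (N2 (omap F A)) \<cdot>\<^bsub>E2\<^esub> theta A) = Idn E2 (N2 (omap F A)) \<cdot>\<^bsub>E2\<^esub> theta A"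
    by (rule A2.reassoc[OF A2.mu_unit]) (use A in simp_all)
  then show "(theta A \<cdot>\<^bsub>E2\<^esub> amap F (A1.mu A)) \<cdot>\<^bsub>E2\<^esub> amap F (\<eta>1 (N1 A)) =
      (A2.mu (omap F A) \<cdot>\<^bsub>E2\<^esub> (A2.nf (theta A) \<cdot>\<^bsub>E2\<^esub> theta (N1 A))) \<cdot>\<^bsub>E2\<^esub> amap F (\<eta>1 (N1 A))"
    using A F.amap_eq[OF A1.mu_unit[OF A]] theta_unit[of "N1 A"] A2.nf_unit[of "theta A"] by simp
qed (use A in simp)

lemma theta_strong: "(F, theta) \<in> monad_strong_hom E1 A1.free_monad E2 A2.free_monad"
proof -
  have "(F, theta) \<in> ptd_strong_hom E1 (ptd_of A1.free_monad) E2 (ptd_of A2.free_monad)"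
    by (rule ptd_strong_homI)
      (use F.is_functor A1.functor_free_monad A2.functor_free_monad theta_iso theta_nat theta_unit
        in \<open>auto simp: theta_extensional\<close>)
  then show ?thesis using theta_mult unfolding monad_strong_hom_def by simp
qed

end

section \<open>Comparisons of identities and composites\<close>

lemma (in free_algebras) along_strong_id:
  "is_free_along E T (id_functor E) (\<lambda>A \<in> Obj E. Idn E (T\<^sub>o A)) A (N A) (x A) (\<eta> A)"
  if A: "A \<in> Obj E"
  unfolding is_free_along_def
proof (intro ballI impI)
  fix B b f
  assume B: "B \<in> Obj E" and b: "b \<in> hom E (T\<^sub>o B) B" and f: "f \<in> hom E (omap (id_functor E) A) B"
    and b_pt: "b \<cdot> \<tau> B = Idn E B"
  have "(h \<in> hom E (omap (id_functor E) (N A)) B \<and> h \<cdot> amap (id_functor E) (\<eta> A) = f \<and>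
      h \<cdot> amap (id_functor E) (x A) = b \<cdot> (T\<^sub>a h \<cdot> (\<lambda>A\<in>Obj E. Idn E (T\<^sub>o A)) (N A))) \<longleftrightarrow>
      h \<in> hom E (N A) B \<and> h \<cdot> \<eta> A = f \<and> h \<cdot> x A = b \<cdot> T\<^sub>a h" for h
    using A by auto
  then show "\<exists>!h. h \<in> hom E (omap (id_functor E) (N A)) B \<and> h \<cdot> amap (id_functor E) (\<eta> A) = f \<and>
      h \<cdot> amap (id_functor E) (x A) = b \<cdot> (T\<^sub>a h \<cdot> (\<lambda>A\<in>Obj E. Idn E (T\<^sub>o A)) (N A))"
    using free[OF A B b b_pt, of f] f A by simp
qed

lemma (in free_algebras) theta_strong_id:
  "(id_functor E, free_algebra_morphism.theta E N x \<eta> E T x \<eta> (id_functor E) (\<lambda>A \<in> Obj E. Idn E (T\<^sub>o A)))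
    = strong_id E (endo free_monad)"
proof -
  have id: "(id_functor E, \<lambda>A \<in> Obj E. Idn E (T\<^sub>o A)) \<in> ptd_strong_hom E T E T"
    using strong_id_ptd[OF ptd] by (simp add: strong_id_def)
  interpret free_algebra_morphism E T N x \<eta> E T N x \<eta> "id_functor E" "\<lambda>A \<in> Obj E. Idn E (T\<^sub>o A)"
    by (intro free_algebra_morphism.intro free_algebras_axioms strong_morphismI ptd id
        free_algebra_morphism_axioms.intro along_strong_id)
  have "(\<lambda>A \<in> Obj E. Idn E (omap (endo free_monad) A)) = theta"
    by (rule theta_eqI) (use alg_x in \<open>auto simp: along_hom_def\<close>)
  then show ?thesis by (simp add: strong_id_def)
qed

text \<open>The pasted comparison satisfies the two conditions that single out the comparison of the
  composite: the equation for \<open>F\<close> is carried through \<open>G\<close>, continued by the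
  equation for \<open>G\<close>, and joined by naturality of \<open>\<delta>\<close>.\<close>

lemma theta_strong_comp:
  assumes F: "free_algebra_morphism E1 T1 N1 x1 \<eta>1 E2 T2 N2 x2 \<eta>2 F \<gamma>"
    and G: "free_algebra_morphism E2 T2 N2 x2 \<eta>2 E3 T3 N3 x3 \<eta>3 G \<delta>"
    and H: "free_algebra_morphism E1 T1 N1 x1 \<eta>1 E3 T3 N3 x3 \<eta>3 H \<epsilon>"
    and H_eq: "(H, \<epsilon>) = strong_comp E1 E3 (G, \<delta>) (F, \<gamma>)"
  shows "(H, free_algebra_morphism.theta E1 N1 x1 \<eta>1 E3 T3 x3 \<eta>3 H \<epsilon>) =
    strong_comp E1 E3 (G, free_algebra_morphism.theta E2 N2 x2 \<eta>2 E3 T3 x3 \<eta>3 G \<delta>)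
      (F, free_algebra_morphism.theta E1 N1 x1 \<eta>1 E2 T2 x2 \<eta>2 F \<gamma>)"
proof -
  interpret F: free_algebra_morphism E1 T1 N1 x1 \<eta>1 E2 T2 N2 x2 \<eta>2 F \<gamma> by (rule F)
  interpret G: free_algebra_morphism E2 T2 N2 x2 \<eta>2 E3 T3 N3 x3 \<eta>3 G \<delta> by (rule G)
  interpret H: free_algebra_morphism E1 T1 N1 x1 \<eta>1 E3 T3 N3 x3 \<eta>3 H \<epsilon> by (rule H)
  have H': "H = comp_functor E1 G F" and \<epsilon>: "\<epsilon> = (\<lambda>A\<in>Obj E1. \<delta> (omap F A) \<cdot>\<^bsub>E3\<^esub> amap G (\<gamma> A))"
    using H_eq by (auto simp: strong_comp_def)
  have "(\<lambda>A\<in>Obj E1. G.theta (omap F A) \<cdot>\<^bsub>E3\<^esub> amap G (F.theta A)) = H.theta"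
  proof (rule H.theta_eqI)
    fix A assume A: "A \<in> Obj E1"
    have F\<theta>: "F.theta A \<cdot>\<^bsub>E2\<^esub> amap F (x1 A) =
        x2 (omap F A) \<cdot>\<^bsub>E2\<^esub> (amap (endo T2) (F.theta A) \<cdot>\<^bsub>E2\<^esub> \<gamma> (N1 A))"
      using F.theta_hom[OF A] unfolding F.along_hom_def by blast
    have G\<theta>: "G.theta (omap F A) \<cdot>\<^bsub>E3\<^esub> amap G (x2 (omap F A)) =
        x3 (omap G (omap F A)) \<cdot>\<^bsub>E3\<^esub> (amap (endo T3) (G.theta (omap F A)) \<cdot>\<^bsub>E3\<^esub> \<delta> (N2 (omap F A)))"
      using G.theta_hom[of "omap F A"] A unfolding G.along_hom_def by simp
    have "G.theta (omap F A) \<cdot>\<^bsub>E3\<^esub> (amap G (F.theta A) \<cdot>\<^bsub>E3\<^esub> amap G (amap F (x1 A))) =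
        G.theta (omap F A) \<cdot>\<^bsub>E3\<^esub> (amap G (x2 (omap F A)) \<cdot>\<^bsub>E3\<^esub>
          (amap G (amap (endo T2) (F.theta A)) \<cdot>\<^bsub>E3\<^esub> amap G (\<gamma> (N1 A))))"
      using A G.F.amap_square[OF F\<theta>] by simp
    also have "\<dots> = (x3 (omap G (omap F A)) \<cdot>\<^bsub>E3\<^esub> (amap (endo T3) (G.theta (omap F A)) \<cdot>\<^bsub>E3\<^esub> \<delta> (N2 (omap F A))))
        \<cdot>\<^bsub>E3\<^esub> (amap G (amap (endo T2) (F.theta A)) \<cdot>\<^bsub>E3\<^esub> amap G (\<gamma> (N1 A)))"
      by (rule G.A2.reassoc[OF G\<theta>]) (use A in simp_all)
    also have "\<dots> = x3 (omap G (omap F A)) \<cdot>\<^bsub>E3\<^esub> (amap (endo T3) (G.theta (omap F A)) \<cdot>\<^bsub>E3\<^esub>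
        (\<delta> (N2 (omap F A)) \<cdot>\<^bsub>E3\<^esub> (amap G (amap (endo T2) (F.theta A)) \<cdot>\<^bsub>E3\<^esub> amap G (\<gamma> (N1 A)))))"
      using A by simp
    also have "\<delta> (N2 (omap F A)) \<cdot>\<^bsub>E3\<^esub> (amap G (amap (endo T2) (F.theta A)) \<cdot>\<^bsub>E3\<^esub> amap G (\<gamma> (N1 A))) =
        (amap (endo T3) (amap G (F.theta A)) \<cdot>\<^bsub>E3\<^esub> \<delta> (omap F (N1 A))) \<cdot>\<^bsub>E3\<^esub> amap G (\<gamma> (N1 A))"
      by (rule G.A2.reassoc[OF G.comparison_nat]) (use A in simp_all)
    finally show "H.along_hom A (x3 (omap H A))
        ((\<lambda>A\<in>Obj E1. G.theta (omap F A) \<cdot>\<^bsub>E3\<^esub> amap G (F.theta A)) A)"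
      using A unfolding H.along_hom_def by (simp add: H' \<epsilon>)
    show "(\<lambda>A\<in>Obj E1. G.theta (omap F A) \<cdot>\<^bsub>E3\<^esub> amap G (F.theta A)) A \<cdot>\<^bsub>E3\<^esub> amap H (\<eta>1 A) = \<eta>3 (omap H A)"
      using A G.F.amap_eq[OF F.theta_unit[OF A]] G.theta_unit[of "omap F A"] by (simp add: H')
  qed simp
  then show ?thesis by (simp add: strong_comp_def H')
qed

text \<open>Ordinary freeness is strong freeness at the identity, with identity components in place
  of \<open>\<gamma>\<close>.\<close>

lemma (in configuration) free_algebrasI:
  assumes "\<And>A. A \<in> Obj E \<Longrightarrow> is_strongly_free \<kappa> E M T A (N A) (x A) (\<eta> A)"
  shows "free_algebras E T N x \<eta>"
proof
  fix A assume A: "A \<in> Obj E"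
  note D = assms[OF A, unfolded is_strongly_free_def]
  show "N A \<in> Obj E" "x A \<in> hom E (T\<^sub>o (N A)) (N A)" "x A \<cdot> \<tau> (N A) = Idn E (N A)" "\<eta> A \<in> hom E A (N A)"
    using D by blast+
  then have ty: "N A \<in> Obj E" "x A \<in> Arr E" "\<eta> A \<in> Arr E" by simp_all
  fix B b f
  assume B: "B \<in> Obj E" and b: "b \<in> hom E (T\<^sub>o B) B" "b \<cdot> \<tau> B = Idn E B" and f: "f \<in> hom E A B"
  have "(id_functor E, \<lambda>A \<in> Obj E. Idn E (T\<^sub>o A)) \<in> ptd_strong_hom E T E T"
    using strong_id_ptd[OF ptd] by (simp add: strong_id_def)
  then have "is_free_along E T (id_functor E) (\<lambda>A \<in> Obj E. Idn E (T\<^sub>o A)) A (N A) (x A) (\<eta> A)"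
    using D ptd backdrop_preserving_id by blast
  then have "\<exists>!h. h \<in> hom E (omap (id_functor E) (N A)) B \<and> h \<cdot> amap (id_functor E) (\<eta> A) = f \<and>
      h \<cdot> amap (id_functor E) (x A) = b \<cdot> (T\<^sub>a h \<cdot> (\<lambda>A\<in>Obj E. Idn E (T\<^sub>o A)) (N A))"
    using B b f A unfolding is_free_along_def by simp
  moreover have "(h \<in> hom E (omap (id_functor E) (N A)) B \<and> h \<cdot> amap (id_functor E) (\<eta> A) = f \<and>
      h \<cdot> amap (id_functor E) (x A) = b \<cdot> (T\<^sub>a h \<cdot> (\<lambda>A\<in>Obj E. Idn E (T\<^sub>o A)) (N A))) \<longleftrightarrow>
      h \<in> hom E (N A) B \<and> h \<cdot> \<eta> A = f \<and> h \<cdot> x A = b \<cdot> T\<^sub>a h" for h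
    using ty by auto
  ultimately show "\<exists>!h. h \<in> hom E (N A) B \<and> h \<cdot> \<eta> A = f \<and> h \<cdot> x A = b \<cdot> T\<^sub>a h" by simp
qed

theorem theorem2p3p27:
  fixes \<kappa> :: "'k rel"
  assumes "limit_ordinal \<kappa>"
    and "\<kappa> \<noteq> {}"
  shows "\<exists>\<Phi> :: (('o, 'a) conf_obj, (('o, 'a) conf_obj, ('o, 'a) strong) tagged,
                ('o, 'a) mnd_obj, (('o, 'a) mnd_obj, ('o, 'a) strong) tagged) funct.
     cat_functor (ConfMnd \<kappa>) Mnd_s \<Phi> \<and>
     comp_functor (ConfMnd \<kappa>) Mnd_s_proj \<Phi> = ConfMnd_proj \<kappa> \<and>
     (\<forall>E M T. (E, M, T) \<in> Obj (ConfMnd \<kappa>) \<longrightarrow>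
        (\<exists>N \<gamma>. omap \<Phi> (E, M, T) = (E, N) \<and>
           is_free_monad E T N \<gamma> \<and> is_alg_free_monad E T N \<gamma>))"
proof -
  have wo: "Well_order \<kappa>" using assms(1) unfolding limit_ordinal_def by blast
  \<comment> \<open>A free algebra is fixed for each configuration and object before any morphism is
    considered. The choice may depend on \<open>M\<close> as well as on \<open>T\<close>; strong
    freeness makes it compatible with all morphisms.\<close>
  define good :: "('o, 'a) conf_obj \<Rightarrow> 'o \<Rightarrow> 'o \<times> 'a \<times> 'a \<Rightarrow> bool" where
    "good c A d \<longleftrightarrow> (case c of (E, M, T) \<Rightarrow> is_conf_obj \<kappa> c \<and> A \<in> Obj E \<longrightarrow>
      (case d of (X, x, \<eta>) \<Rightarrow> is_strongly_free \<kappa> E M T A X x \<eta>))" for c A d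
  have "\<exists>d. good c A d" for c A
  proof (cases "is_conf_obj \<kappa> c \<and> A \<in> Obj (fst c)")
    case False
    then show ?thesis by (cases c) (auto simp: good_def)
  next
    case True
    obtain E M T where c: "c = (E, M, T)" by (cases c)
    interpret configuration \<kappa> E M T using True c wo by (intro configurationI) simp_all
    show ?thesis using free_algebra_exists[OF assms, of A] True c by (auto simp: good_def)
  qed
  then obtain d where d: "\<And>c A. good c A (d c A)" by metis
  define N where "N c A = fst (d c A)" for c A
  define x where "x c A = fst (snd (d c A))" for c A
  define \<eta> where "\<eta> c A = snd (snd (d c A))" for c A
  have sf: "is_strongly_free \<kappa> E M T A (N (E, M, T) A) (x (E, M, T) A) (\<eta> (E, M, T) A)"
    if "is_conf_obj \<kappa> (E, M, T)" "A \<in> Obj E" for E M T A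
    using d[of "(E, M, T)" A] that by (auto simp: good_def N_def x_def \<eta>_def split: prod.splits)
  have fa: "free_algebras E T (N (E, M, T)) (x (E, M, T)) (\<eta> (E, M, T))"
    if c: "is_conf_obj \<kappa> (E, M, T)" for E M T
    by (rule configuration.free_algebrasI[OF configurationI[OF wo c] sf[OF c]])
  have fm: "free_algebra_morphism E1 T1 (N (E1, M1, T1)) (x (E1, M1, T1)) (\<eta> (E1, M1, T1))
      E2 T2 (N (E2, M2, T2)) (x (E2, M2, T2)) (\<eta> (E2, M2, T2)) F \<gamma>"
    if c: "is_conf_obj \<kappa> (E1, M1, T1)" "is_conf_obj \<kappa> (E2, M2, T2)"
      and F: "(F, \<gamma>) \<in> ptd_strong_hom E1 T1 E2 T2" "backdrop_preserving \<kappa> E1 M1 E2 M2 F"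
    for E1 M1 T1 E2 M2 T2 F \<gamma>
  proof (intro free_algebra_morphism.intro free_algebra_morphism_axioms.intro fa c
      strong_morphismI is_conf_objD(3)[OF c(1)] is_conf_objD(3)[OF c(2)] F)
    show "is_free_along E2 T2 F \<gamma> A (N (E1, M1, T1) A) (x (E1, M1, T1) A) (\<eta> (E1, M1, T1) A)"
      if "A \<in> Obj E1" for A
      using sf[OF c(1) that] F is_conf_objD(3)[OF c(2)] unfolding is_strongly_free_def by blast
  qed
  define mon :: "('o, 'a) conf_obj \<Rightarrow> ('o, 'a) mnd" where
    "mon c = (case c of (E, M, T) \<Rightarrow> free_algebras.free_monad E T (N c) (x c) (\<eta> c))" for c
  \<comment> \<open>The underlying functor is kept and only the natural isomorphism is replaced, by
    the comparison of the chosen free monads.\<close>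
  define th where "th c1 c2 = (\<lambda>(F, \<gamma>). (F, case (c1, c2) of ((E1, M1, T1), (E2, M2, T2)) \<Rightarrow>
      free_algebra_morphism.theta E1 (N c1) (x c1) (\<eta> c1) E2 T2 (x c2) (\<eta> c2) F \<gamma>))"
    for c1 c2 :: "('o, 'a) conf_obj"
  define lift_obj where "lift_obj c = (fst c, mon c)" for c :: "('o, 'a) conf_obj"
  define \<Phi> where "\<Phi> = \<lparr>omap = (\<lambda>c \<in> {c. is_conf_obj \<kappa> c}. lift_obj c),
     amap = (\<lambda>t \<in> Arr (ConfMnd \<kappa>). Tagged (lift_obj (source t)) (lift_obj (target t))
       (th (source t) (target t) (body t)))\<rparr>"
  have mon: "is_monad E (mon (E, M, T))" if "is_conf_obj \<kappa> (E, M, T)" for E M T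
    using free_algebras.is_monad_free_monad[OF fa[OF that]] by (simp add: mon_def)
  have \<Phi>: "cat_functor (ConfMnd \<kappa>) Mnd_s \<Phi>"
    unfolding \<Phi>_def ConfMnd_def Mnd_s_def
  proof (rule concrete_functor[OF category_ConfMnd[OF wo, unfolded ConfMnd_def] category_Mnd_s[unfolded Mnd_s_def]];
      clarsimp simp: lift_obj_def split: prod.splits)
    fix E :: "('o, 'a) cat" and M T
    assume c: "is_conf_obj \<kappa> (E, M, T)"
    show "category E \<and> is_monad E (mon (E, M, T))" using is_conf_objD(1)[OF c] mon[OF c] by simp
  next
    fix E1 :: "('o, 'a) cat" and M1 T1 E2 M2 T2 F \<gamma>
    assume c: "is_conf_obj \<kappa> (E1, M1, T1)" "is_conf_obj \<kappa> (E2, M2, T2)"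
      "(F, \<gamma>) \<in> ptd_strong_hom E1 T1 E2 T2" "backdrop_preserving \<kappa> E1 M1 E2 M2 F"
    show "th (E1, M1, T1) (E2, M2, T2) (F, \<gamma>) \<in> monad_strong_hom E1 (mon (E1, M1, T1)) E2 (mon (E2, M2, T2))"
      using free_algebra_morphism.theta_strong[OF fm[OF c]] by (simp add: th_def mon_def)
  next
    fix E :: "('o, 'a) cat" and M T
    assume c: "is_conf_obj \<kappa> (E, M, T)"
    show "th (E, M, T) (E, M, T) (strong_id E (endo T)) = strong_id E (endo (mon (E, M, T)))"
      using free_algebras.theta_strong_id[OF fa[OF c]] by (simp add: th_def mon_def strong_id_def)
  next
    fix E1 :: "('o, 'a) cat" and M1 T1 E2 M2 T2 E3 M3 T3 F \<gamma> G \<delta>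
    assume c: "is_conf_obj \<kappa> (E1, M1, T1)" "is_conf_obj \<kappa> (E2, M2, T2)" "is_conf_obj \<kappa> (E3, M3, T3)"
      and F: "(F, \<gamma>) \<in> ptd_strong_hom E1 T1 E2 T2" "backdrop_preserving \<kappa> E1 M1 E2 M2 F"
      and G: "(G, \<delta>) \<in> ptd_strong_hom E2 T2 E3 T3" "backdrop_preserving \<kappa> E2 M2 E3 M3 G"
    obtain H \<epsilon> where H: "(H, \<epsilon>) = strong_comp E1 E3 (G, \<delta>) (F, \<gamma>)"
      by (metis surj_pair)
    have "(H, \<epsilon>) \<in> ptd_strong_hom E1 T1 E3 T3"
      unfolding H by (rule strong_comp_ptd[OF strong_morphismI strong_morphismI]) (use c F G in \<open>auto dest: is_conf_objD\<close>)
    moreover have "backdrop_preserving \<kappa> E1 M1 E3 M3 H"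
      using backdrop_preserving_comp[OF F(2) G(2) is_conf_objD(2)[OF c(1)] is_conf_objD(2)[OF c(2)]] H
      by (simp add: strong_comp_def)
    ultimately show "th (E1, M1, T1) (E3, M3, T3) (strong_comp E1 E3 (G, \<delta>) (F, \<gamma>)) =
        strong_comp E1 E3 (th (E2, M2, T2) (E3, M3, T3) (G, \<delta>)) (th (E1, M1, T1) (E2, M2, T2) (F, \<gamma>))"
      using theta_strong_comp[OF fm[OF c(1,2) F] fm[OF c(2,3) G] fm[OF c(1,3)] H]
      unfolding H[symmetric] by (simp add: th_def)
  qed
  interpret \<Phi>: cfunctor "ConfMnd \<kappa>" "Mnd_s" \<Phi> by unfold_locales (rule \<Phi>)
  \<comment> \<open>This makes the triangle of projections commute as an equality of functors, not
    merely up to isomorphism.\<close>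
  have "fst (th c1 c2 u) = fst u" for c1 c2 u
    by (cases u) (simp add: th_def)
  then have "comp_functor (ConfMnd \<kappa>) Mnd_s_proj \<Phi> = ConfMnd_proj \<kappa>"
    using \<Phi>.omap_Obj \<Phi>.amap_arr(1)
    by (simp add: comp_functor_def Mnd_s_proj_def ConfMnd_proj_def \<Phi>_def ConfMnd_def concrete_cat_simps
        lift_obj_def cong: restrict_cong)
  moreover have "\<exists>N \<gamma>. omap \<Phi> (E, M, T) = (E, N) \<and> is_free_monad E T N \<gamma> \<and> is_alg_free_monad E T N \<gamma>"
    if "(E, M, T) \<in> Obj (ConfMnd \<kappa>)" for E M T
  proof -
    have c: "is_conf_obj \<kappa> (E, M, T)" using that by (simp add: ConfMnd_def concrete_cat_simps)
    interpret free_algebras E T "N (E, M, T)" "x (E, M, T)" "\<eta> (E, M, T)" by (rule fa[OF c])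
    have "omap \<Phi> (E, M, T) = (E, free_monad)" using c by (simp add: \<Phi>_def lift_obj_def mon_def)
    then show ?thesis using is_free_monad_free_monad is_alg_free_monad_free_monad by blast
  qed
  ultimately show ?thesis using \<Phi> by blast
qed

end
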